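(* Let $\alpha>-1$, $b\in L^2(\mathbb{R}_+^2)$ and $\sigma\in\mathcal{B}_2$. Suppose $[b,P_\alpha]$ extends to a bounded operator on $L^2_\alpha(\mathbb{R}_+^2,\sigma)$. Then $$\sup_{I\in\mathcal{D}}\frac1{A(Q_I)}\int_{Q_I}|b(z)-b_{Q_I}|\,dA(z)<\infty.$$ Suppose additionally that $\sigma(z)=|h'(z)|^\eta$, where $\eta\in\mathbb{R}$ and $h$ is a conformal map from $\mathbb{R}_+^2$ to some simply connected domain $\Omega\subsetneq\mathbb{C}$. Then $b\in\mathrm{BMO}^2(\mathbb{R}_+^2)$, and moreover $$\|b\|_{\mathrm{BMO}^2(\mathbb{R}_+^2)}\simeq\|[b,P_\alpha]\|_{L^2_\alpha(\mathbb{R}_+^2,\sigma)\to L^2_\alpha(\mathbb{R}_+^2,\sigma)},$$ with implicit constants independent of $b$ (they may depend on $\alpha$ and $\sigma$).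
   Context: $\mathbb{R}_+^2=\{z\in\mathbb{C}:\operatorname{Im}z>0\}$, $dA=dx\,dy$, and $dA_\alpha(z)=\frac1\pi(\alpha+1)(2\operatorname{Im}z)^\alpha dA(z)$, with $\alpha>-1$ fixed. $L^2(\mathbb{R}_+^2)$ is taken with respect to $dA$. A weight is a measurable a.e. positive function on $\mathbb{R}_+^2$; $L^2_\alpha(\mathbb{R}_+^2,\sigma)$ is the space of measurable $f$ with $\int|f|^2\sigma\,dA_\alpha<\infty$. Functions are complex valued. $P_\alpha f(z)=i^{2+\alpha}\int_{\mathbb{R}_+^2}\frac{f(w)}{(z-\overline w)^{2+\alpha}}dA_\alpha(w)$ (principal branch; $z-\overline w$ lies in the upper half plane). The commutator is $[b,P_\alpha]f=b\,P_\alpha f-P_\alpha(bf)$, initially defined for bounded compactly supported $f$. For an interval $I\subset\mathbb{R}$, $Q_I=\{x+iy: x\in I,\ y\in(0,|I|)\}$. $\mathcal{D}=\mathcal{D}^1\cup\mathcal{D}^2$, where $\mathcal{D}^1,\mathcal{D}^2$ are two fixed adjacent dyadic systems of intervals on $\mathbb{R}$, i.e. satisfying the $1/3$-trick: there is an absolute constant $C$ such that every bounded interval $I\subset\mathbb{R}$ is contained in some $J\in\mathcal{D}$ with $|J|\le C|I|$. In this statement $A(Q_I)$ and the average $b_{Q_I}=\frac1{A(Q_I)}\int_{Q_I}b\,dA$ are taken with respect to Lebesgue measure. $\mathcal{B}_2$: weights $\sigma$ with $\sup_{I\in\mathcal{D}}\Big(\frac1{A_\alpha(Q_I)}\int_{Q_I}\sigma\,dA_\alpha\Big)\Big(\frac1{A_\alpha(Q_I)}\int_{Q_I}\sigma^{-1}\,dA_\alpha\Big)<\infty$.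 $\mathrm{BMO}^2(\mathbb{R}_+^2)$: functions $b\in L^2(\mathbb{R}_+^2)$ with $\|b\|_{\mathrm{BMO}^2(\mathbb{R}_+^2)}=\sup_{I\in\mathcal{D}}\Big(\frac1{A(Q_I)}\int_{Q_I}|b-b_{Q_I}|^2dA\Big)^{1/2}<\infty$. A conformal map from $\mathbb{R}_+^2$ to $\Omega$ is a biholomorphism onto $\Omega$. *)

theory Defs
  imports "HOL-Analysis.Analysis"
begin

subsection \<open>The half-plane and its measures\<close>

definition uhp :: "complex set" where
  "uhp = {z. 0 < Im z}"

definition dA :: "complex measure" where
  "dA = lebesgue_on uhp"

definition dA_wt :: "real \<Rightarrow> complex measure" where
  "dA_wt \<alpha> = density dA (\<lambda>z. ennreal ((\<alpha> + 1) / pi * (2 * Im z) powr \<alpha>))"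

subsection \<open>Square-integrable functions and operators on them\<close>

text \<open>
  Elements of the Hilbert space over \<open>M\<close> are represented by functions, so that identities between
  elements are identities almost everywhere. In particular linearity of an operator is required
  up to null sets; together with boundedness this makes it respect equality almost everywhere.
\<close>

definition L2 :: "complex measure \<Rightarrow> (complex \<Rightarrow> complex) set" where
  "L2 M = {f \<in> borel_measurable M. integrable M (\<lambda>z. (norm (f z))\<^sup>2)}"

definition L2_norm :: "complex measure \<Rightarrow> (complex \<Rightarrow> complex) \<Rightarrow> real" where
  "L2_norm M f = sqrt (\<integral>z. (norm (f z))\<^sup>2 \<partial>M)"

definition bounded_operator ::
    "complex measure \<Rightarrow> ((complex \<Rightarrow> complex) \<Rightarrow> (complex \<Rightarrow> complex)) \<Rightarrow> bool" where
  "bounded_operator M T \<longleftrightarrow>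
     (\<forall>f\<in>L2 M. T f \<in> L2 M) \<and>
     (\<forall>f\<in>L2 M. \<forall>g\<in>L2 M. \<forall>c d :: complex.
        AE z in M. T (\<lambda>w. c * f w + d * g w) z = c * T f z + d * T g z) \<and>
     (\<exists>K. \<forall>f\<in>L2 M. L2_norm M (T f) \<le> K * L2_norm M f)"

definition operator_norm ::
    "complex measure \<Rightarrow> ((complex \<Rightarrow> complex) \<Rightarrow> (complex \<Rightarrow> complex)) \<Rightarrow> real" where
  "operator_norm M T = (SUP f \<in> {f \<in> L2 M. L2_norm M f \<le> 1}. L2_norm M (T f))"

subsection \<open>Bergman projection and its commutators\<close>

text \<open>Complex \<open>powr\<close> is the principal branch.\<close>

definition bergman :: "real \<Rightarrow> (complex \<Rightarrow> complex) \<Rightarrow> complex \<Rightarrow> complex" where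
  "bergman \<alpha> f z =
     \<i> powr complex_of_real (2 + \<alpha>) *
       (\<integral>w. f w / (z - cnj w) powr complex_of_real (2 + \<alpha>) \<partial>dA_wt \<alpha>)"

definition commutator ::
    "real \<Rightarrow> (complex \<Rightarrow> complex) \<Rightarrow> (complex \<Rightarrow> complex) \<Rightarrow> complex \<Rightarrow> complex" where
  "commutator \<alpha> b f z = b z * bergman \<alpha> f z - bergman \<alpha> (\<lambda>w. b w * f w) z"

text \<open>Bounded measurable functions with compact support inside the open half-plane.\<close>

definition test_functions :: "(complex \<Rightarrow> complex) set" where
  "test_functions =
     {f \<in> borel_measurable dA.
        (\<exists>B. \<forall>z\<in>uhp. norm (f z) \<le> B) \<and>
        (\<exists>K. compact K \<and> K \<subseteq> uhp \<and> (\<forall>z\<in>uhp - K. f z = 0))}"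

text \<open>The space of functions square-integrable against \<open>\<sigma> dA\<^sub>\<alpha>\<close> is \<open>L2 (weighted \<alpha> \<sigma>)\<close>.\<close>

definition weighted :: "real \<Rightarrow> (complex \<Rightarrow> real) \<Rightarrow> complex measure" where
  "weighted \<alpha> \<sigma> = density (dA_wt \<alpha>) (\<lambda>z. ennreal (\<sigma> z))"

definition commutator_extension ::
    "real \<Rightarrow> (complex \<Rightarrow> real) \<Rightarrow> (complex \<Rightarrow> complex) \<Rightarrow>
     ((complex \<Rightarrow> complex) \<Rightarrow> (complex \<Rightarrow> complex)) \<Rightarrow> bool" where
  "commutator_extension \<alpha> \<sigma> b T \<longleftrightarrow>
     bounded_operator (weighted \<alpha> \<sigma>) T \<and>
     (\<forall>f\<in>test_functions. AE z in dA. T f z = commutator \<alpha> b f z)"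

subsection \<open>Adjacent dyadic systems\<close>

definition len :: "real set \<Rightarrow> real" where
  "len I = measure lborel I"

definition dyadic_system :: "real set set \<Rightarrow> bool" where
  "dyadic_system \<D> \<longleftrightarrow>
     (\<forall>I\<in>\<D>. \<exists>a. \<exists>k::int. I = {a..<a + 2 powi k}) \<and>
     (\<forall>k::int. partition_on UNIV {I\<in>\<D>. len I = 2 powi k}) \<and>
     (\<forall>I\<in>\<D>. \<forall>J\<in>\<D>. I \<subseteq> J \<or> J \<subseteq> I \<or> I \<inter> J = {})"

text \<open>Degenerate intervals have to be left out, since members of a dyadic system have positive
  length.\<close>

definition adjacent_dyadic_systems :: "real set set \<Rightarrow> real set set \<Rightarrow> bool" where
  "adjacent_dyadic_systems \<D>1 \<D>2 \<longleftrightarrow>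
     dyadic_system \<D>1 \<and> dyadic_system \<D>2 \<and>
     (\<exists>C. \<forall>I. is_interval I \<and> bounded I \<and> 0 < len I \<longrightarrow>
        (\<exists>J\<in>\<D>1 \<union> \<D>2. I \<subseteq> J \<and> len J \<le> C * len I))"

definition Q :: "real set \<Rightarrow> complex set" where
  "Q I = {z. Re z \<in> I \<and> 0 < Im z \<and> Im z < len I}"

subsection \<open>Weights\<close>

definition weight :: "(complex \<Rightarrow> real) \<Rightarrow> bool" where
  "weight \<sigma> \<longleftrightarrow> \<sigma> \<in> borel_measurable dA \<and> (AE z in dA. 0 < \<sigma> z)"

text \<open>Averages of weights are taken in \<open>ennreal\<close>. Both averages are nonzero for a weight, so a
  finite product forces both to be finite.\<close>

definition average_wt :: "real \<Rightarrow> (complex \<Rightarrow> real) \<Rightarrow> complex set \<Rightarrow> ennreal" where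
  "average_wt \<alpha> \<sigma> S = (\<integral>\<^sup>+z\<in>S. ennreal (\<sigma> z) \<partial>dA_wt \<alpha>) / emeasure (dA_wt \<alpha>) S"

definition B2 :: "real \<Rightarrow> real set set \<Rightarrow> (complex \<Rightarrow> real) set" where
  "B2 \<alpha> \<D> =
     {\<sigma>. weight \<sigma> \<and>
        (SUP I\<in>\<D>. average_wt \<alpha> \<sigma> (Q I) * average_wt \<alpha> (\<lambda>z. inverse (\<sigma> z)) (Q I)) < \<infinity>}"

subsection \<open>Mean oscillation with respect to Lebesgue measure\<close>

definition average :: "(complex \<Rightarrow> complex) \<Rightarrow> complex set \<Rightarrow> complex" where
  "average b S = (LINT z:S|dA. b z) /\<^sub>R measure dA S"

definition mean_osc :: "(complex \<Rightarrow> complex) \<Rightarrow> complex set \<Rightarrow> real" where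
  "mean_osc b S = (LINT z:S|dA. norm (b z - average b S)) / measure dA S"

definition mean_osc2 :: "(complex \<Rightarrow> complex) \<Rightarrow> complex set \<Rightarrow> real" where
  "mean_osc2 b S = sqrt ((LINT z:S|dA. (norm (b z - average b S))\<^sup>2) / measure dA S)"

definition BMO2 :: "real set set \<Rightarrow> (complex \<Rightarrow> complex) set" where
  "BMO2 \<D> = {b \<in> L2 dA. bdd_above ((\<lambda>I. mean_osc2 b (Q I)) ` \<D>)}"

definition BMO2_norm :: "real set set \<Rightarrow> (complex \<Rightarrow> complex) \<Rightarrow> real" where
  "BMO2_norm \<D> b = (SUP I\<in>\<D>. mean_osc2 b (Q I))"

subsection \<open>Conformal maps\<close>

definition conformal_map :: "(complex \<Rightarrow> complex) \<Rightarrow> complex set \<Rightarrow> complex set \<Rightarrow> bool" where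
  "conformal_map h S \<Omega> \<longleftrightarrow>
     h holomorphic_on S \<and> bij_betw h S \<Omega> \<and> inv_into S h holomorphic_on \<Omega>"

end

theory Submission
  imports Defs "HOL-Complex_Analysis.Complex_Analysis"
begin


text \<open>
  Both directions come from the decomposition of the half-plane into Whitney boxes, that is, boxes
  whose height above the real axis is comparable to their size. On such a box the density of
  \<open>dA\<^sub>\<alpha>\<close> and the modulus of the Bergman kernel are constant up to bounded factors, and so is a
  weight \<open>|h'|\<^sup>\<eta>\<close> with \<open>h\<close> conformal.

  The last point is a distortion estimate (\<open>conformal_weight_regular\<close>). If \<open>h\<close> omits \<open>p\<close>, a
  logarithm \<open>F\<close> of \<open>h - p\<close> exists and the image of \<open>F\<close> contains no disc of radius larger than
  \<open>\<pi>\<close>, since \<open>h\<close> would take a value twice. Bloch's theorem bounds \<open>F'\<close>. Applied to \<open>h\<close> and to its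
  inverse, this compares \<open>|h'(z)| Im z\<close> with the distance from \<open>h z\<close> to the complement of the
  image, and it shows that this distance varies slowly in the hyperbolic metric.

  Lower bound. Let \<open>E\<close> and \<open>E'\<close> be two translates of a Whitney box at a distance that is a large
  multiple of their size. The kernel is almost a constant \<open>\<kappa>\<close> on \<open>E \<times> E'\<close>, so the commutator
  maps the indicator of \<open>E'\<close>, divided by the density, to almost \<open>\<kappa> |E'| (b - b\<^sub>E\<^sub>')\<close> on \<open>E\<close>. The
  error is a small multiple of the oscillation of \<open>b\<close> on the two boxes. Since \<open>E\<close> and \<open>E'\<close> may be
  exchanged, the error can be absorbed (\<open>mutual_absorption\<close>), and the oscillation of \<open>b\<close> on \<open>E\<close> is
  controlled by the commutator on two test functions. These are bounded in mean by
  the Cauchy-Schwarz inequality and the condition on the averages of the weight, and in square mean if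
  the weight is comparable to a constant on both boxes. Averages of \<open>b\<close> on neighbouring Whitney boxes
  then differ by a bounded amount, and summing over the generations below an interval gives the
  oscillation on Carleson boxes: the squared side lengths decay faster than the number of boxes
  grows (\<open>carleson_oscillation_from_whitney\<close>).

  Upper bound. Two points \<open>z\<close>, \<open>w\<close> lie in a common \<open>Q I\<close> with \<open>|I|\<close> comparable to
  the distance of \<open>z\<close> to the conjugate of \<open>w\<close>, so the kernel is dominated by a sum of \<open>|I| powr (-2-\<alpha>)\<close> over dyadic \<open>I\<close>
  with \<open>z, w \<in> Q I\<close>. The averages of \<open>b\<close> over \<open>Q J\<close> and \<open>Q I\<close> with \<open>J \<subseteq> I\<close> differ by a multiple of the number of
  generations in between. On each tile only square means of \<open>b\<close> and of the function enter, because
  the weight is essentially constant there. What remains is the discrete positive operator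
  \<open>tree_op\<close>. The factor counting generations costs one further application of \<open>tree_op\<close>
  (\<open>tree_op_log_bound\<close>), and \<open>tree_op\<close> is bounded on the weighted space by duality and the Carleson
  embedding (\<open>tree_op_weighted_bound\<close>). The estimate passes from test functions to the whole space
  by density.
\<close>

section \<open>Distortion of univalent functions\<close>

text \<open>
  By Bloch's theorem a larger derivative would put a disc of radius more than \<open>\<pi>\<close> into the image of
  \<open>F\<close>. Such a disc contains two points that differ by \<open>2\<pi>i\<close>, where \<open>exp\<close> takes the same value.
\<close>

lemma deriv_log_of_univalent_bound:
  fixes F :: "complex \<Rightarrow> complex"
  assumes hol: "F holomorphic_on ball a r" and r: "0 < r"
    and inj: "inj_on (\<lambda>z. exp (F z)) (ball a r)"
  shows "r * norm (deriv F a) \<le> 12 * pi"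
proof (rule ccontr)
  assume "\<not> ?thesis"
  then have gt: "pi < r * norm (deriv F a) / 12" by simp
  obtain b where b: "ball b (r * norm (deriv F a) / 12) \<subseteq> F ` ball a r"
    using Bloch[OF hol r order_refl] by blast
  \<comment> \<open>These two points differ by \<open>2\<pi>i\<close> and lie at distance \<open>\<pi>\<close> from the centre.\<close>
  have "b + \<i> * pi \<in> F ` ball a r" "b - \<i> * pi \<in> F ` ball a r"
    using gt by (auto intro!: subsetD[OF b] simp: dist_norm norm_mult)
  then obtain z1 z2 where z: "z1 \<in> ball a r" "F z1 = b + \<i> * pi" "z2 \<in> ball a r" "F z2 = b - \<i> * pi"
    by (metis imageE)
  have "exp (F z1) = exp (F z2)"
    unfolding z exp_add exp_diff by simp
  with inj z(1,3) have "z1 = z2" by (auto dest: inj_onD)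
  with z show False by (simp add: complex_eq_iff)
qed

text \<open>
  The previous bound for a logarithm of \<open>f - p\<close>. It replaces the Koebe quarter theorem, with a worse
  constant.
\<close>

lemma univalent_omitted_value_bound:
  fixes f :: "complex \<Rightarrow> complex"
  assumes hol: "f holomorphic_on ball a r" and r: "0 < r"
    and inj: "inj_on f (ball a r)" and p: "p \<notin> f ` ball a r"
  shows "r * norm (deriv f a) \<le> 12 * pi * norm (f a - p)"
proof -
  have "(\<lambda>z. f z - p) holomorphic_on ball a r"
    by (intro holomorphic_intros hol)
  then obtain F where F: "F holomorphic_on ball a r"
    and e: "\<And>z. z \<in> ball a r \<Longrightarrow> f z - p = exp (F z)"
  proof (rule contractible_imp_holomorphic_log)
    show "contractible (ball a r)" by (rule convex_imp_contractible[OF convex_ball])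
    show "f z - p \<noteq> 0" if "z \<in> ball a r" for z using that p by force
  qed (auto intro: that)
  have inj': "inj_on (\<lambda>z. exp (F z)) (ball a r)"
    using inj by (auto simp: inj_on_def simp flip: e)
  have a: "a \<in> ball a r" using r by simp
  have dF: "(F has_field_derivative deriv F a) (at a)"
    using F a open_ball holomorphic_derivI by blast
  have "((\<lambda>z. exp (F z)) has_field_derivative exp (F a) * deriv F a) (at a)"
    by (auto intro!: derivative_eq_intros dF)
  moreover have "((\<lambda>z. f z - p) has_field_derivative deriv f a) (at a)"
    using hol a open_ball holomorphic_derivI by (auto intro!: derivative_eq_intros)
  then have "((\<lambda>z. exp (F z)) has_field_derivative deriv f a) (at a)"
    by (rule has_field_derivative_transform_within_open[OF _ open_ball a]) (simp add: e)
  ultimately have "deriv f a = exp (F a) * deriv F a"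
    using DERIV_unique by blast
  then have "r * norm (deriv f a) = norm (f a - p) * (r * norm (deriv F a))"
    using e[OF a] by (simp add: norm_mult)
  also have "\<dots> \<le> norm (f a - p) * (12 * pi)"
    by (intro mult_left_mono deriv_log_of_univalent_bound F r inj') auto
  finally show ?thesis by (simp add: mult_ac)
qed

lemma open_uhp: "open uhp" and convex_uhp: "convex uhp"
  unfolding uhp_def by (auto simp: open_halfspace_Im_gt convex_halfspace_Im_gt)

lemma ball_uhp: "ball z (Im z) \<subseteq> uhp"
proof
  fix w assume "w \<in> ball z (Im z)"
  then have "norm (z - w) < Im z" by (simp add: dist_norm)
  moreover have "Im z - Im w \<le> norm (z - w)" using abs_Im_le_cmod[of "z - w"] by simp
  ultimately show "w \<in> uhp" by (simp add: uhp_def)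
qed

text \<open>
  The logarithm of \<open>h - p\<close> is Lipschitz for the hyperbolic metric, uniformly in the omitted value
  \<open>p\<close>. The segment from \<open>z\<close> to \<open>w\<close> stays above the lower of the two points.
\<close>

lemma univalent_omitted_value_Harnack:
  assumes hol: "h holomorphic_on uhp" and inj: "inj_on h uhp" and p: "p \<notin> h ` uhp"
    and z: "z \<in> uhp" and w: "w \<in> uhp" and d: "dist z w \<le> B * min (Im z) (Im w)"
  shows "norm (h z - p) \<le> exp (12 * pi * B) * norm (h w - p)"
proof -
  have "(\<lambda>z. h z - p) holomorphic_on uhp"
    by (intro holomorphic_intros hol)
  then obtain F where F: "F holomorphic_on uhp"
    and e: "\<And>z. z \<in> uhp \<Longrightarrow> h z - p = exp (F z)"
  proof (rule contractible_imp_holomorphic_log)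
    show "contractible uhp" by (rule convex_imp_contractible[OF convex_uhp])
    show "h z - p \<noteq> 0" if "z \<in> uhp" for z using that p by force
  qed (auto intro: that)
  have inj': "inj_on (\<lambda>z. exp (F z)) uhp"
    using inj by (auto simp: inj_on_def simp flip: e)
  define m where "m = min (Im z) (Im w)"
  have m: "m > 0" using z w by (auto simp: m_def uhp_def)
  define S where "S = {v. m \<le> Im v}"
  have S: "S \<subseteq> uhp" using m by (auto simp: S_def uhp_def)
  have "norm (F z - F w) \<le> 12 * pi / m * norm (z - w)"
  proof (rule field_differentiable_bound)
    show "convex S" by (simp add: S_def convex_halfspace_Im_ge)
    show "z \<in> S" "w \<in> S" by (auto simp: S_def m_def)
    fix v assume "v \<in> S"
    then have v: "v \<in> uhp" and mv: "m \<le> Im v" using S by (auto simp: S_def)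
    show "(F has_field_derivative deriv F v) (at v within S)"
      using F v open_uhp holomorphic_derivI has_field_derivative_at_within by blast
    have "m * norm (deriv F v) \<le> Im v * norm (deriv F v)"
      by (intro mult_right_mono mv) auto
    also have "\<dots> \<le> 12 * pi"
      using v ball_uhp by (intro deriv_log_of_univalent_bound holomorphic_on_subset[OF F] inj_on_subset[OF inj'])
        (auto simp: uhp_def)
    finally show "norm (deriv F v) \<le> 12 * pi / m" using m by (simp add: field_simps)
  qed
  also have "\<dots> \<le> 12 * pi / m * (B * m)"
    using d m by (intro mult_left_mono) (auto simp: dist_norm m_def)
  also have "\<dots> = 12 * pi * B" using m by simp
  finally have "Re (F z - F w) \<le> 12 * pi * B"
    using complex_Re_le_cmod order_trans by blast
  then have "exp (Re (F z)) \<le> exp (12 * pi * B + Re (F w))" by simp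
  then show ?thesis by (simp add: e z w exp_add)
qed

text \<open>
  Slow variation at bounded hyperbolic distance, expressed through Euclidean distance and height.
\<close>

definition hyperbolically_regular :: "(complex \<Rightarrow> real) \<Rightarrow> bool" where
  "hyperbolically_regular \<sigma> \<longleftrightarrow>
     (\<forall>B. \<exists>C>0. \<forall>z\<in>uhp. \<forall>w\<in>uhp. dist z w \<le> B * min (Im z) (Im w) \<longrightarrow> \<sigma> z \<le> C * \<sigma> w)"

text \<open>
  The first bound takes for \<open>p\<close> a point of the complement of \<open>\<Omega>\<close> nearest to \<open>h z\<close>. The second one
  is the same estimate for the inverse map on the largest disc around \<open>h z\<close> in \<open>\<Omega>\<close>, with the omitted
  value \<open>Re z\<close>.
\<close>

lemma conformal_deriv_bounds:
  assumes conf: "conformal_map h uhp \<Omega>" and \<Omega>: "open \<Omega>" "\<Omega> \<noteq> UNIV" and z: "z \<in> uhp"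
  shows "Im z * norm (deriv h z) \<le> 12 * pi * infdist (h z) (- \<Omega>)"
    and "infdist (h z) (- \<Omega>) \<le> 12 * pi * Im z * norm (deriv h z)"
    and "0 < infdist (h z) (- \<Omega>)"
proof -
  have hol: "h holomorphic_on uhp" and bij: "bij_betw h uhp \<Omega>"
    and hol': "inv_into uhp h holomorphic_on \<Omega>"
    using conf by (auto simp: conformal_map_def)
  have inj: "inj_on h uhp" and im: "h ` uhp = \<Omega>" using bij by (auto simp: bij_betw_def)
  have ne: "- \<Omega> \<noteq> {}" using \<Omega> by auto
  have cl: "closed (- \<Omega>)" using \<Omega> by auto
  have y: "Im z > 0" using z by (simp add: uhp_def)
  obtain p where p: "p \<in> - \<Omega>" "infdist (h z) (- \<Omega>) = dist (h z) p"
    using infdist_attains_inf[OF cl ne] by blast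
  show "Im z * norm (deriv h z) \<le> 12 * pi * infdist (h z) (- \<Omega>)"
    unfolding p(2) dist_norm
    using ball_uhp[of z] p(1) im y
    by (intro univalent_omitted_value_bound holomorphic_on_subset[OF hol] inj_on_subset[OF inj]) auto
  have hz: "h z \<in> \<Omega>" using im z by auto
  show pos: "0 < infdist (h z) (- \<Omega>)"
    using hz cl ne infdist_pos_not_in_closed by blast
  define d where "d = infdist (h z) (- \<Omega>)"
  define g where "g = inv_into uhp h"
  have sub: "ball (h z) d \<subseteq> \<Omega>"
  proof
    fix v assume v: "v \<in> ball (h z) d"
    show "v \<in> \<Omega>"
    proof (rule ccontr)
      assume "v \<notin> \<Omega>"
      then have "d \<le> dist (h z) v" unfolding d_def by (intro infdist_le) auto
      with v show False by simp
    qed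
  qed
  have gh: "\<And>v. v \<in> uhp \<Longrightarrow> g (h v) = v" unfolding g_def using inj by simp
  have injg: "inj_on g \<Omega>" unfolding g_def using im inj_on_inv_into by blast
  have gim: "g ` \<Omega> \<subseteq> uhp" unfolding g_def using im by (auto intro: inv_into_into)
  have "d * norm (deriv g (h z)) \<le> 12 * pi * norm (g (h z) - Re z)"
  proof (rule univalent_omitted_value_bound)
    show "g holomorphic_on ball (h z) d" using hol' sub g_def holomorphic_on_subset by blast
    show "inj_on g (ball (h z) d)" using injg sub inj_on_subset by blast
    show "0 < d" using pos d_def by simp
    have "complex_of_real (Re z) \<notin> uhp" by (simp add: uhp_def)
    then show "complex_of_real (Re z) \<notin> g ` ball (h z) d" using sub gim by blast
  qed
  also have "g (h z) - Re z = \<i> * Im z" using gh[OF z] by (simp add: complex_eq_iff)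
  also have "norm (\<i> * Im z) = Im z" using y by (simp add: norm_mult)
  finally have 1: "d * norm (deriv g (h z)) \<le> 12 * pi * Im z" .
  have dh: "(h has_field_derivative deriv h z) (at z)"
    using hol z open_uhp holomorphic_derivI by blast
  have dg: "(g has_field_derivative deriv g (h z)) (at (h z))"
    using hol' hz \<Omega> holomorphic_derivI unfolding g_def by blast
  have "((\<lambda>v. g (h v)) has_field_derivative deriv g (h z) * deriv h z) (at z)"
    using DERIV_chain2[OF dg dh] .
  then have "((\<lambda>v. v) has_field_derivative deriv g (h z) * deriv h z) (at z)"
    by (rule has_field_derivative_transform_within_open[OF _ open_uhp z]) (simp add: gh)
  then have "deriv g (h z) * deriv h z = 1"
    using DERIV_unique DERIV_ident by blast
  then have "norm (deriv g (h z)) * norm (deriv h z) = 1" by (metis norm_mult norm_one)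
  then have "d = d * norm (deriv g (h z)) * norm (deriv h z)" by simp
  also have "\<dots> \<le> 12 * pi * Im z * norm (deriv h z)"
    by (intro mult_right_mono 1) auto
  finally show "infdist (h z) (- \<Omega>) \<le> 12 * pi * Im z * norm (deriv h z)" by (simp add: d_def)
qed

text \<open>
  The derivative is comparable to the distance of \<open>h z\<close> to the boundary divided by \<open>Im z\<close>, and both
  quantities vary slowly: the distance is an infimum of the functions \<open>|h - p|\<close>.
\<close>

lemma conformal_deriv_Harnack:
  assumes conf: "conformal_map h uhp \<Omega>" and \<Omega>: "open \<Omega>" "\<Omega> \<noteq> UNIV"
    and z: "z \<in> uhp" and w: "w \<in> uhp" and d: "dist z w \<le> B * min (Im z) (Im w)"
  shows "norm (deriv h z) \<le> (12 * pi)\<^sup>2 * exp (12 * pi * B) * (1 + B) * norm (deriv h w)"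
proof -
  have hol: "h holomorphic_on uhp" and inj: "inj_on h uhp" and im: "h ` uhp = \<Omega>"
    using conf by (auto simp: conformal_map_def bij_betw_def)
  have ne: "- \<Omega> \<noteq> {}" using \<Omega> by auto
  have cl: "closed (- \<Omega>)" using \<Omega> by auto
  have yz: "Im z > 0" and yw: "Im w > 0" using z w by (auto simp: uhp_def)
  have B: "B \<ge> 0"
  proof (rule ccontr)
    assume "\<not> B \<ge> 0"
    then have "B * min (Im z) (Im w) < 0" using yz yw by (simp add: mult_neg_pos)
    with d show False using zero_le_dist[of z w] by linarith
  qed
  obtain p where p: "p \<in> - \<Omega>" "infdist (h w) (- \<Omega>) = dist (h w) p"
    using infdist_attains_inf[OF cl ne] by blast
  have "infdist (h z) (- \<Omega>) \<le> dist (h z) p" by (rule infdist_le[OF p(1)])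
  also have "\<dots> \<le> exp (12 * pi * B) * infdist (h w) (- \<Omega>)"
    unfolding p(2) dist_norm using p(1) im
    by (intro univalent_omitted_value_Harnack hol inj z w d) auto
  finally have 1: "infdist (h z) (- \<Omega>) \<le> exp (12 * pi * B) * infdist (h w) (- \<Omega>)" .
  have "Im w - Im z \<le> dist z w" using abs_Im_le_cmod[of "z - w"] by (simp add: dist_norm)
  also have "\<dots> \<le> B * Im z" using d B by (smt (verit) min_def mult_left_mono)
  finally have 2: "Im w \<le> (1 + B) * Im z" by (simp add: algebra_simps)
  have "Im z * norm (deriv h z) \<le> 12 * pi * infdist (h z) (- \<Omega>)"
    by (rule conformal_deriv_bounds[OF conf \<Omega> z])
  also have "\<dots> \<le> 12 * pi * (exp (12 * pi * B) * infdist (h w) (- \<Omega>))"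
    by (intro mult_left_mono 1) auto
  also have "\<dots> \<le> 12 * pi * (exp (12 * pi * B) * (12 * pi * Im w * norm (deriv h w)))"
    by (intro mult_left_mono conformal_deriv_bounds[OF conf \<Omega> w]) auto
  also have "\<dots> \<le> 12 * pi * (exp (12 * pi * B) * (12 * pi * ((1 + B) * Im z) * norm (deriv h w)))"
    by (intro mult_left_mono mult_right_mono 2) auto
  also have "\<dots> = Im z * ((12 * pi)\<^sup>2 * exp (12 * pi * B) * (1 + B) * norm (deriv h w))"
    by (simp add: power2_eq_square mult_ac)
  finally show ?thesis using yz by simp
qed

lemma conformal_weight_regular:
  assumes conf: "conformal_map h uhp \<Omega>" and \<Omega>: "open \<Omega>" "\<Omega> \<noteq> UNIV"
    and \<sigma>: "\<And>z. z \<in> uhp \<Longrightarrow> \<sigma> z = norm (deriv h z) powr \<eta>"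
  shows "hyperbolically_regular \<sigma>" and "\<And>z. z \<in> uhp \<Longrightarrow> 0 < \<sigma> z"
proof -
  have nz: "norm (deriv h z) > 0" if "z \<in> uhp" for z
    using conformal_deriv_bounds(2,3)[OF conf \<Omega> that] by fastforce
  then show "\<And>z. z \<in> uhp \<Longrightarrow> 0 < \<sigma> z" by (auto simp: \<sigma>)
  show "hyperbolically_regular \<sigma>"
    unfolding hyperbolically_regular_def
  proof
    fix B :: real
    define C where "C = max 1 ((12 * pi)\<^sup>2 * exp (12 * pi * B) * (1 + B))"
    show "\<exists>C>0. \<forall>z\<in>uhp. \<forall>w\<in>uhp. dist z w \<le> B * min (Im z) (Im w) \<longrightarrow> \<sigma> z \<le> C * \<sigma> w"
    proof (intro exI[of _ "C powr \<bar>\<eta>\<bar>"] conjI ballI impI)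
      have C: "C \<ge> 1" by (simp add: C_def)
      then show "0 < C powr \<bar>\<eta>\<bar>" by simp
      fix z w assume z: "z \<in> uhp" and w: "w \<in> uhp" and d: "dist z w \<le> B * min (Im z) (Im w)"
      have H: "norm (deriv h z) \<le> C * norm (deriv h w)"
        if "z \<in> uhp" "w \<in> uhp" "dist z w \<le> B * min (Im z) (Im w)" for z w
        using conformal_deriv_Harnack[OF conf \<Omega> that]
        by (rule order_trans) (auto simp: C_def intro!: mult_right_mono)
      have zw: "norm (deriv h z) \<le> C * norm (deriv h w)" by (rule H[OF z w d])
      have wz: "norm (deriv h w) \<le> C * norm (deriv h z)"
        using d by (intro H[OF w z]) (simp add: dist_commute min.commute)
      show "\<sigma> z \<le> C powr \<bar>\<eta>\<bar> * \<sigma> w"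
      proof (cases "\<eta> \<ge> 0")
        case True
        have "norm (deriv h z) powr \<eta> \<le> (C * norm (deriv h w)) powr \<eta>"
          using zw True by (intro powr_mono2) auto
        then show ?thesis using True C by (simp add: \<sigma> z w powr_mult)
      next
        case False
        have "(C * norm (deriv h z)) powr \<eta> \<le> norm (deriv h w) powr \<eta>"
          using wz False nz[OF w] by (intro powr_mono2') auto
        then have "C powr \<eta> * \<sigma> z \<le> \<sigma> w" using C by (simp add: \<sigma> z w powr_mult)
        then have "C powr (-\<eta>) * (C powr \<eta> * \<sigma> z) \<le> C powr (-\<eta>) * \<sigma> w"
          by (intro mult_left_mono) auto
        moreover have "C powr (-\<eta>) * (C powr \<eta> * \<sigma> z) = \<sigma> z"
          using C by (simp flip: mult.assoc powr_add)
        ultimately show ?thesis using False by simp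
      qed
    qed
  qed
qed


section \<open>Carleson embedding for finite laminar families\<close>

lemma sum_sq_div_add:
  fixes x y a b :: real
  assumes "a > 0" "b > 0"
  shows "(x + y)\<^sup>2 / (a + b) \<le> x\<^sup>2 / a + y\<^sup>2 / b"
proof -
  have "x\<^sup>2 / a + y\<^sup>2 / b - (x + y)\<^sup>2 / (a + b) = (x * b - y * a)\<^sup>2 / (a * b * (a + b))"
    using assms by (simp add: divide_simps add_pos_pos) (simp add: algebra_simps power2_eq_square)
  also have "\<dots> \<ge> 0" using assms by simp
  finally show ?thesis by simp
qed

text \<open>
  The induction step of the Carleson embedding: a new top element with mass \<open>a\<close> and value \<open>\<xi>\<close> is
  put over a family with total mass \<open>V\<close> and total value \<open>Y\<close>. With \<open>t = a / (a + V)\<close> the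
  claim reduces to \<open>(2 + t) (2 - t) \<le> 4\<close>.
\<close>

lemma carleson_step:
  fixes \<xi> Y a V :: real
  assumes a: "a > 0" and V: "V > 0"
  shows "a * ((\<xi> + Y) / (a + V))\<^sup>2 + 2 * (\<xi> + Y)\<^sup>2 / (a + V) \<le> 4 * \<xi>\<^sup>2 / a + 2 * Y\<^sup>2 / V"
proof -
  have W: "a + V > 0" using a V by simp
  have le: "(\<xi> + Y)\<^sup>2 / (a / 4 + V / 2) \<le> \<xi>\<^sup>2 / (a / 4) + Y\<^sup>2 / (V / 2)"
    using a V by (intro sum_sq_div_add) auto
  have "(3 * a + 2 * V) * (a + 2 * V) \<le> 4 * (a + V)\<^sup>2"
    using a V by (simp add: algebra_simps power2_eq_square)
  then have "(3 * a + 2 * V) / (a + V)\<^sup>2 \<le> 4 / (a + 2 * V)"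
    using a V W by (simp add: divide_simps mult_ac)
  then have "(\<xi> + Y)\<^sup>2 * ((3 * a + 2 * V) / (a + V)\<^sup>2) \<le> (\<xi> + Y)\<^sup>2 * (4 / (a + 2 * V))"
    by (intro mult_left_mono) auto
  also have "\<dots> = (\<xi> + Y)\<^sup>2 / (a / 4 + V / 2)"
    using a V by (simp add: field_simps)
  also note le
  also have "(\<xi> + Y)\<^sup>2 * ((3 * a + 2 * V) / (a + V)\<^sup>2)
      = a * ((\<xi> + Y) / (a + V))\<^sup>2 + 2 * (\<xi> + Y)\<^sup>2 / (a + V)"
  proof -
    have "2 * t / w = t * (2 * w) / w\<^sup>2" if "w > 0" for t w :: real
      using that by (simp add: power2_eq_square field_simps)
    from this[OF W]
    have "2 * (\<xi> + Y)\<^sup>2 / (a + V) = (\<xi> + Y)\<^sup>2 * (2 * (a + V)) / (a + V)\<^sup>2" .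
    then show ?thesis by (simp add: power_divide add_divide_distrib[symmetric] algebra_simps)
  qed
  finally show ?thesis by (simp add: mult.commute)
qed

definition laminar :: "'a set set \<Rightarrow> bool" where
  "laminar \<F> \<longleftrightarrow> {} \<notin> \<F> \<and> (\<forall>I\<in>\<F>. \<forall>J\<in>\<F>. I \<subseteq> J \<or> J \<subseteq> I \<or> I \<inter> J = {})"

lemma laminar_subset: "laminar \<F> \<Longrightarrow> \<G> \<subseteq> \<F> \<Longrightarrow> laminar \<G>"
  unfolding laminar_def by (meson subsetD)

text \<open>
  The second summand on the left is what makes the induction on the family work: it stores the part
  of the budget \<open>4 \<Sum> \<xi>\<^sup>2 / a\<close> that is still available for the sets above. A maximal element either
  splits the family into two disjoint families, for which the stored terms add up by
  \<open>sum_sq_div_add\<close>, or it contains all others and \<open>carleson_step\<close> applies.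
\<close>

lemma carleson_embedding_strong:
  fixes a \<xi> :: "'a set \<Rightarrow> real"
  assumes "finite \<F>" "laminar \<F>" "\<And>I. I \<in> \<F> \<Longrightarrow> 0 < a I"
  shows "(\<Sum>I\<in>\<F>. a I * ((\<Sum>K\<in>{K\<in>\<F>. K \<subseteq> I}. \<xi> K) / (\<Sum>K\<in>{K\<in>\<F>. K \<subseteq> I}. a K))\<^sup>2)
           + 2 * (\<Sum>K\<in>\<F>. \<xi> K)\<^sup>2 / (\<Sum>K\<in>\<F>. a K) \<le> 4 * (\<Sum>K\<in>\<F>. (\<xi> K)\<^sup>2 / a K)"
  using assms
proof (induction "card \<F>" arbitrary: \<F> rule: less_induct)
  case less
  define L where "L \<F> = (\<Sum>I\<in>\<F>. a I * ((\<Sum>K\<in>{K\<in>\<F>. K \<subseteq> I}. \<xi> K) / (\<Sum>K\<in>{K\<in>\<F>. K \<subseteq> I}. a K))\<^sup>2)" for \<F>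
  define X where "X \<F> = (\<Sum>K\<in>\<F>. \<xi> K)" for \<F>
  define W where "W \<F> = (\<Sum>K\<in>\<F>. a K)" for \<F>
  define E where "E \<F> = (\<Sum>K\<in>\<F>. (\<xi> K)\<^sup>2 / a K)" for \<F>
  have IH: "L \<G> + 2 * (X \<G>)\<^sup>2 / W \<G> \<le> 4 * E \<G>" if "\<G> \<subset> \<F>" for \<G>
    unfolding L_def X_def W_def E_def
    using less.prems that laminar_subset[OF \<open>laminar \<F>\<close>] finite_subset
    by (intro less.hyps psubset_card_mono) auto
  have Wpos: "W \<G> > 0" if "\<G> \<subseteq> \<F>" "\<G> \<noteq> {}" for \<G>
    unfolding W_def using that less.prems finite_subset by (intro sum_pos) auto
  show ?case
  proof (cases "\<F> = {}")
    case False
    then obtain R where R: "R \<in> \<F>" and max: "\<And>J. J \<in> \<F> \<Longrightarrow> R \<subseteq> J \<Longrightarrow> J = R"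
      using finite_has_maximal[OF \<open>finite \<F>\<close>] by metis
    define U where "U = {K\<in>\<F>. K \<subseteq> R}"
    define V where "V = \<F> - U"
    have UV: "\<F> = U \<union> V" "U \<inter> V = {}" "U \<subseteq> \<F>" "V \<subseteq> \<F>" "finite U" "finite V"
      using less.prems by (auto simp: U_def V_def)
    have add: "X \<F> = X U + X V" "W \<F> = W U + W V" "E \<F> = E U + E V"
      unfolding X_def W_def E_def by (simp_all add: UV sum.union_disjoint)
    have "L \<F> + 2 * (X \<F>)\<^sup>2 / W \<F> \<le> 4 * E \<F>"
    proof (cases "V = {}")
      case False
      have disj: "K \<inter> R = {}" if "K \<in> V" for K
        using that max[of K] R less.prems(2) unfolding V_def U_def laminar_def by blast
      have 1: "{K\<in>\<F>. K \<subseteq> I} = {K\<in>U. K \<subseteq> I}" if "I \<in> U" for I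
        using that by (auto simp: U_def)
      have 2: "{K\<in>\<F>. K \<subseteq> I} = {K\<in>V. K \<subseteq> I}" if "I \<in> V" for I
      proof -
        have "\<not> K \<subseteq> R" if "K \<in> \<F>" "K \<subseteq> I" for K
        proof
          assume "K \<subseteq> R"
          then have "K = {}" using that(2) disj[OF \<open>I \<in> V\<close>] by blast
          then show False using that(1) less.prems(2) by (simp add: laminar_def)
        qed
        then show ?thesis by (auto simp: U_def V_def)
      qed
      have "L \<F> = L U + L V"
        unfolding L_def using 1 2 UV
        by (subst UV(1), subst sum.union_disjoint) (auto intro!: arg_cong2[of _ _ _ _ "(+)"] sum.cong)
      moreover have "R \<in> U" using R by (auto simp: U_def)
      moreover have "L U + 2 * (X U)\<^sup>2 / W U \<le> 4 * E U" using False UV by (intro IH) auto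
      moreover have "L V + 2 * (X V)\<^sup>2 / W V \<le> 4 * E V" using \<open>R \<in> U\<close> UV by (intro IH) auto
      moreover have "(X \<F>)\<^sup>2 / W \<F> \<le> (X U)\<^sup>2 / W U + (X V)\<^sup>2 / W V"
        unfolding add using False \<open>R \<in> U\<close> UV by (intro sum_sq_div_add Wpos) auto
      ultimately show ?thesis unfolding add by simp
    next
      case True
      then have sub: "K \<subseteq> R" if "K \<in> \<F>" for K using that by (auto simp: U_def V_def)
      define \<G> where "\<G> = \<F> - {R}"
      have G: "\<F> = insert R \<G>" "R \<notin> \<G>" "finite \<G>" "\<G> \<subset> \<F>" using R less.prems by (auto simp: \<G>_def)
      have 1: "{K\<in>\<F>. K \<subseteq> R} = \<F>" using sub by auto
      have 2: "{K\<in>\<F>. K \<subseteq> I} = {K\<in>\<G>. K \<subseteq> I}" if "I \<in> \<G>" for I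
        using that max[of I] by (auto simp: \<G>_def)
      have L: "L \<F> = a R * (X \<F> / W \<F>)\<^sup>2 + L \<G>"
      proof -
        have "L \<F> = a R * ((\<Sum>K\<in>{K\<in>\<F>. K \<subseteq> R}. \<xi> K) / (\<Sum>K\<in>{K\<in>\<F>. K \<subseteq> R}. a K))\<^sup>2
           + (\<Sum>I\<in>\<G>. a I * ((\<Sum>K\<in>{K\<in>\<F>. K \<subseteq> I}. \<xi> K) / (\<Sum>K\<in>{K\<in>\<F>. K \<subseteq> I}. a K))\<^sup>2)"
          unfolding L_def using G R less.prems by (simp add: \<G>_def sum.remove)
        also have "(\<Sum>I\<in>\<G>. a I * ((\<Sum>K\<in>{K\<in>\<F>. K \<subseteq> I}. \<xi> K) / (\<Sum>K\<in>{K\<in>\<F>. K \<subseteq> I}. a K))\<^sup>2) = L \<G>"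
          unfolding L_def by (intro sum.cong refl) (simp add: 2)
        finally show ?thesis by (simp add: 1 X_def W_def)
      qed
      have add': "X \<F> = \<xi> R + X \<G>" "W \<F> = a R + W \<G>" "E \<F> = (\<xi> R)\<^sup>2 / a R + E \<G>"
        unfolding X_def W_def E_def using G by simp_all
      have aR: "a R > 0" using less.prems R by auto
      show ?thesis
      proof (cases "\<G> = {}")
        case True
        then have "X \<G> = 0" "W \<G> = 0" "E \<G> = 0" "L \<G> = 0" by (simp_all add: X_def W_def E_def L_def)
        then show ?thesis unfolding L add' using aR by (simp add: power_divide power2_eq_square divide_right_mono)
      next
        case False
        have "a R * (X \<F> / W \<F>)\<^sup>2 + 2 * (X \<F>)\<^sup>2 / W \<F> \<le> 4 * (\<xi> R)\<^sup>2 / a R + 2 * (X \<G>)\<^sup>2 / W \<G>"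
          unfolding add' using False G by (intro carleson_step aR Wpos) auto
        then show ?thesis unfolding L using IH[OF G(4)] add' by simp
      qed
    qed
    then show ?thesis unfolding L_def X_def W_def E_def .
  qed simp
qed

lemma carleson_embedding:
  fixes a \<xi> :: "'a set \<Rightarrow> real"
  assumes "finite \<F>" "laminar \<F>" "\<And>I. I \<in> \<F> \<Longrightarrow> 0 < a I"
  shows "(\<Sum>I\<in>\<F>. a I * ((\<Sum>K\<in>{K\<in>\<F>. K \<subseteq> I}. \<xi> K) / (\<Sum>K\<in>{K\<in>\<F>. K \<subseteq> I}. a K))\<^sup>2)
           \<le> 4 * (\<Sum>K\<in>\<F>. (\<xi> K)\<^sup>2 / a K)"
proof -
  have "0 \<le> (\<Sum>K\<in>\<F>. a K)"
    by (rule sum_nonneg) (rule less_imp_le[OF assms(3)])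
  then have nn: "0 \<le> 2 * (\<Sum>K\<in>\<F>. \<xi> K)\<^sup>2 / (\<Sum>K\<in>\<F>. a K)"
    by (rule divide_nonneg_nonneg[rotated]) simp
  have "u + v \<le> w \<Longrightarrow> 0 \<le> v \<Longrightarrow> u \<le> w" for u v w :: real
    by linarith
  from this[OF carleson_embedding_strong[OF assms] nn] show ?thesis .
qed

lemma sqrt_mult_square: "0 \<le> t \<Longrightarrow> (sqrt t * u)\<^sup>2 = t * u\<^sup>2"
  by (simp add: power_mult_distrib)

section \<open>Positive dyadic operators\<close>

text \<open>
  The discrete model of the sum over \<open>I\<close> of the average over \<open>Q I\<close>, restricted to \<open>Q I\<close>: \<open>x K\<close> is the
  size of a function on the tile of \<open>K\<close>, and \<open>m K\<close> stands for the measure of that tile as well as for that of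
  the whole box \<open>Q K\<close>, which are comparable.
\<close>

definition tree_op :: "'a set set \<Rightarrow> ('a set \<Rightarrow> real) \<Rightarrow> ('a set \<Rightarrow> real) \<Rightarrow> 'a set \<Rightarrow> real" where
  "tree_op \<F> m x J = (\<Sum>I\<in>{I\<in>\<F>. J \<subseteq> I}. (\<Sum>K\<in>{K\<in>\<F>. K \<subseteq> I}. m K * x K) / m I)"

lemma sum_swap_subset:
  assumes "finite \<F>"
  shows "(\<Sum>J\<in>\<F>. \<Sum>I\<in>{I\<in>\<F>. J \<subseteq> I}. f J I) = (\<Sum>I\<in>\<F>. \<Sum>J\<in>{J\<in>\<F>. J \<subseteq> I}. f J I)"
  by (rule sum.swap_restrict[OF assms assms])

text \<open>
  The operator is symmetric with respect to \<open>m\<close>, so its norm is tested against \<open>y = s S x\<close>, where \<open>S\<close> is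
  the operator. The condition on the weight replaces \<open>1 / m I\<close> by \<open>m I / (P I R I)\<close>, with \<open>P\<close> and \<open>R\<close> the masses of
  \<open>1 / s\<close> and \<open>s\<close> below \<open>I\<close>. Writing \<open>m I\<close> as the geometric mean of \<open>m I / s I\<close> and \<open>m I s I\<close>
  separates the two factors, and each is a Carleson embedding.
\<close>

lemma tree_op_weighted_bound:
  fixes m s x :: "'a set \<Rightarrow> real"
  assumes fin: "finite \<F>" and lam: "laminar \<F>"
    and m: "\<And>I. I \<in> \<F> \<Longrightarrow> 0 < m I" and s: "\<And>I. I \<in> \<F> \<Longrightarrow> 0 < s I"
    and A: "0 \<le> A" "\<And>I. I \<in> \<F> \<Longrightarrow>
      (\<Sum>K\<in>{K\<in>\<F>. K \<subseteq> I}. m K * s K) * (\<Sum>K\<in>{K\<in>\<F>. K \<subseteq> I}. m K / s K) \<le> A * (m I)\<^sup>2"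
    and x: "\<And>I. I \<in> \<F> \<Longrightarrow> 0 \<le> x I"
  shows "(\<Sum>J\<in>\<F>. m J * s J * (tree_op \<F> m x J)\<^sup>2) \<le> (4 * A)\<^sup>2 * (\<Sum>J\<in>\<F>. m J * s J * (x J)\<^sup>2)"
proof -
  define S where "S = tree_op \<F> m x"
  define y where "y J = s J * S J" for J
  define X where "X I = (\<Sum>K\<in>{K\<in>\<F>. K \<subseteq> I}. m K * x K)" for I
  define Y where "Y I = (\<Sum>K\<in>{K\<in>\<F>. K \<subseteq> I}. m K * y K)" for I
  define P where "P I = (\<Sum>K\<in>{K\<in>\<F>. K \<subseteq> I}. m K / s K)" for I
  define R where "R I = (\<Sum>K\<in>{K\<in>\<F>. K \<subseteq> I}. m K * s K)" for I
  define N where "N = (\<Sum>J\<in>\<F>. m J * s J * (x J)\<^sup>2)"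
  define M where "M = (\<Sum>J\<in>\<F>. m J * s J * (S J)\<^sup>2)"
  have S0: "S J \<ge> 0" for J
    unfolding S_def tree_op_def
    by (intro sum_nonneg divide_nonneg_nonneg mult_nonneg_nonneg) (auto simp: x less_imp_le[OF m])
  have XY: "X I \<ge> 0" "Y I \<ge> 0" for I
    unfolding X_def Y_def y_def
    by (auto intro!: sum_nonneg mult_nonneg_nonneg simp: x less_imp_le[OF m] less_imp_le[OF s] S0)
  have PR: "P I > 0" "R I > 0" if "I \<in> \<F>" for I
    unfolding P_def R_def using that fin m s by (auto intro!: sum_pos divide_pos_pos)
  have NM: "N \<ge> 0" "M \<ge> 0"
    unfolding N_def M_def by (auto intro!: sum_nonneg mult_nonneg_nonneg simp: less_imp_le[OF m] less_imp_le[OF s])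
  have "M = (\<Sum>J\<in>\<F>. \<Sum>I\<in>{I\<in>\<F>. J \<subseteq> I}. m J * y J * X I / m I)"
    unfolding M_def
  proof (intro sum.cong refl)
    fix J
    have "(\<Sum>I\<in>{I\<in>\<F>. J \<subseteq> I}. m J * y J * X I / m I) = m J * y J * S J"
      by (simp add: S_def tree_op_def X_def sum_distrib_left)
    then show "m J * s J * (S J)\<^sup>2 = (\<Sum>I\<in>{I\<in>\<F>. J \<subseteq> I}. m J * y J * X I / m I)"
      by (simp add: y_def power2_eq_square)
  qed
  also have "\<dots> = (\<Sum>I\<in>\<F>. X I * Y I / m I)"
    unfolding sum_swap_subset[OF fin]
    by (intro sum.cong refl) (simp add: Y_def sum_distrib_left sum_divide_distrib mult_ac)
  also have "\<dots> \<le> (\<Sum>I\<in>\<F>. A * ((sqrt (m I / s I) * (X I / P I)) * (sqrt (m I * s I) * (Y I / R I))))"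
  proof (rule sum_mono)
    fix I assume I: "I \<in> \<F>"
    have "sqrt (m I / s I) * sqrt (m I * s I) = m I"
      using m[OF I] s[OF I] by (simp flip: real_sqrt_mult)
    then have eq: "A * ((sqrt (m I / s I) * (X I / P I)) * (sqrt (m I * s I) * (Y I / R I)))
        = (X I * Y I) * (A * m I / (P I * R I))"
      by (simp add: field_simps)
    have "R I * P I \<le> A * (m I)\<^sup>2" using A(2)[OF I] by (simp add: P_def R_def)
    then have "1 / m I \<le> A * m I / (P I * R I)"
      using m[OF I] PR[OF I] by (simp add: field_simps power2_eq_square)
    then have "X I * Y I * (1 / m I) \<le> X I * Y I * (A * m I / (P I * R I))"
      using XY[of I] by (intro mult_left_mono) auto
    then show "X I * Y I / m I \<le> A * ((sqrt (m I / s I) * (X I / P I)) * (sqrt (m I * s I) * (Y I / R I)))"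
      unfolding eq by simp
  qed
  also have "\<dots> = A * (\<Sum>I\<in>\<F>. (sqrt (m I / s I) * (X I / P I)) * (sqrt (m I * s I) * (Y I / R I)))"
    by (simp add: sum_distrib_left)
  finally have 1: "M \<le> A * (\<Sum>I\<in>\<F>. (sqrt (m I / s I) * (X I / P I)) * (sqrt (m I * s I) * (Y I / R I)))" .
  have "(\<Sum>I\<in>\<F>. (sqrt (m I / s I) * (X I / P I)) * (sqrt (m I * s I) * (Y I / R I)))\<^sup>2
     \<le> (\<Sum>I\<in>\<F>. (sqrt (m I / s I) * (X I / P I))\<^sup>2) * (\<Sum>I\<in>\<F>. (sqrt (m I * s I) * (Y I / R I))\<^sup>2)"
    by (rule Cauchy_Schwarz_ineq_sum)
  also have "\<dots> \<le> (4 * N) * (4 * M)"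
  proof (intro mult_mono)
    have "(\<Sum>I\<in>\<F>. (sqrt (m I / s I) * (X I / P I))\<^sup>2) = (\<Sum>I\<in>\<F>. (m I / s I) * (X I / P I)\<^sup>2)"
      by (intro sum.cong refl sqrt_mult_square) (auto simp: less_imp_le[OF m] less_imp_le[OF s])
    also have "\<dots> \<le> 4 * (\<Sum>K\<in>\<F>. (m K * x K)\<^sup>2 / (m K / s K))"
      unfolding X_def P_def using m s by (intro carleson_embedding fin lam) auto
    also have "(\<Sum>K\<in>\<F>. (m K * x K)\<^sup>2 / (m K / s K)) = N"
      unfolding N_def using m s by (intro sum.cong refl) (simp add: power2_eq_square mult_ac less_imp_neq[symmetric])
    finally show "(\<Sum>I\<in>\<F>. (sqrt (m I / s I) * (X I / P I))\<^sup>2) \<le> 4 * N" .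
    have "(\<Sum>I\<in>\<F>. (sqrt (m I * s I) * (Y I / R I))\<^sup>2) = (\<Sum>I\<in>\<F>. (m I * s I) * (Y I / R I)\<^sup>2)"
      by (intro sum.cong refl sqrt_mult_square) (auto simp: less_imp_le[OF m] less_imp_le[OF s])
    also have "\<dots> \<le> 4 * (\<Sum>K\<in>\<F>. (m K * y K)\<^sup>2 / (m K * s K))"
      unfolding Y_def R_def using m s by (intro carleson_embedding fin lam) auto
    also have "(\<Sum>K\<in>\<F>. (m K * y K)\<^sup>2 / (m K * s K)) = M"
      unfolding M_def y_def using m s by (intro sum.cong refl) (simp add: power2_eq_square mult_ac less_imp_neq[symmetric])
    finally show "(\<Sum>I\<in>\<F>. (sqrt (m I * s I) * (Y I / R I))\<^sup>2) \<le> 4 * M" .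
  qed (use NM in \<open>auto intro!: sum_nonneg\<close>)
  finally have 2: "(\<Sum>I\<in>\<F>. (sqrt (m I / s I) * (X I / P I)) * (sqrt (m I * s I) * (Y I / R I)))\<^sup>2 \<le> 16 * N * M"
    by simp
  have "M\<^sup>2 \<le> (A * (\<Sum>I\<in>\<F>. (sqrt (m I / s I) * (X I / P I)) * (sqrt (m I * s I) * (Y I / R I))))\<^sup>2"
    using 1 NM by (intro power_mono) auto
  also have "\<dots> \<le> A\<^sup>2 * (16 * N * M)"
    unfolding power_mult_distrib by (intro mult_left_mono 2) auto
  finally have 3: "M * M \<le> (4 * A)\<^sup>2 * N * M" by (simp add: power2_eq_square mult_ac)
  have "M \<le> (4 * A)\<^sup>2 * N"
  proof (cases "M = 0")
    case False
    then have "0 < M" using NM by simp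
    with 3 show ?thesis by (rule mult_right_le_imp_le)
  qed (use NM in auto)
  then show ?thesis unfolding M_def N_def S_def .
qed

text \<open>
  A count of the sets \<open>L\<close> between \<open>J\<close> and \<open>I\<close> is a sum over \<open>L\<close>. Exchanging the order of summation
  turns it into an outer or an inner application of the same operator.
\<close>

lemma tree_op_log_bound:
  fixes m x :: "'a set \<Rightarrow> real"
  assumes fin: "finite \<F>" and m: "\<And>I. I \<in> \<F> \<Longrightarrow> 0 < m I"
    and x: "\<And>I. I \<in> \<F> \<Longrightarrow> 0 \<le> x I"
  defines "n \<equiv> \<lambda>J I. real (card {L\<in>\<F>. J \<subseteq> L \<and> L \<subseteq> I})"
  shows "(\<Sum>I\<in>{I\<in>\<F>. J \<subseteq> I}. (\<Sum>K\<in>{K\<in>\<F>. K \<subseteq> I}. (n J I + n K I) * (m K * x K)) / m I)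
          \<le> 2 * tree_op \<F> m (tree_op \<F> m x) J"
proof -
  define S where "S = tree_op \<F> m x"
  define X where "X I = (\<Sum>K\<in>{K\<in>\<F>. K \<subseteq> I}. m K * x K)" for I
  have S0: "S J \<ge> 0" for J
    unfolding S_def tree_op_def
    by (intro sum_nonneg divide_nonneg_nonneg mult_nonneg_nonneg) (auto simp: x less_imp_le[OF m])
  have X0: "X I \<ge> 0" for I
    unfolding X_def by (auto intro!: sum_nonneg mult_nonneg_nonneg simp: x less_imp_le[OF m])
  have XS: "X L \<le> m L * S L" if "L \<in> \<F>" for L
  proof -
    have "X L / m L \<le> S L"
      unfolding S_def tree_op_def X_def[symmetric]
      using that fin X0 m by (intro member_le_sum) (auto intro!: divide_nonneg_pos)
    then show ?thesis using m[OF that] by (simp add: field_simps)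
  qed
  define G where "G I = (\<Sum>K\<in>{K\<in>\<F>. K \<subseteq> I}. m K * S K)" for I
  have G0: "G I \<ge> 0" for I
    unfolding G_def by (auto intro!: sum_nonneg mult_nonneg_nonneg simp: S0 less_imp_le[OF m])
  have SS: "tree_op \<F> m S J = (\<Sum>I\<in>{I\<in>\<F>. J \<subseteq> I}. G I / m I)"
    by (simp add: tree_op_def G_def)
  have near: "(\<Sum>I\<in>{I\<in>\<F>. J \<subseteq> I}. n J I * X I / m I) \<le> tree_op \<F> m S J"
  proof -
    have "(\<Sum>I\<in>{I\<in>\<F>. J \<subseteq> I}. n J I * X I / m I)
        = (\<Sum>I\<in>{I\<in>\<F>. J \<subseteq> I}. \<Sum>L\<in>{L\<in>{I\<in>\<F>. J \<subseteq> I}. L \<subseteq> I}. X I / m I)"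
      by (intro sum.cong refl) (auto simp: n_def conj_ac)
    also have "\<dots> = (\<Sum>L\<in>{I\<in>\<F>. J \<subseteq> I}. \<Sum>I\<in>{I\<in>{I\<in>\<F>. J \<subseteq> I}. L \<subseteq> I}. X I / m I)"
      using fin by (intro sum_swap_subset[symmetric]) auto
    also have "\<dots> = (\<Sum>L\<in>{I\<in>\<F>. J \<subseteq> I}. S L)"
      unfolding S_def tree_op_def X_def
      by (intro sum.cong refl) auto
    also have "\<dots> \<le> (\<Sum>L\<in>{I\<in>\<F>. J \<subseteq> I}. G L / m L)"
    proof (rule sum_mono)
      fix L assume L: "L \<in> {I\<in>\<F>. J \<subseteq> I}"
      have "m L * S L \<le> G L"
        unfolding G_def using L fin S0 m by (intro member_le_sum) (auto intro!: mult_nonneg_nonneg simp: less_imp_le)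
      then show "S L \<le> G L / m L" using m L by (simp add: field_simps)
    qed
    finally show ?thesis unfolding SS .
  qed
  have far: "(\<Sum>I\<in>{I\<in>\<F>. J \<subseteq> I}. (\<Sum>K\<in>{K\<in>\<F>. K \<subseteq> I}. n K I * (m K * x K)) / m I) \<le> tree_op \<F> m S J"
    unfolding SS
  proof (intro sum_mono divide_right_mono)
    fix I assume I: "I \<in> {I\<in>\<F>. J \<subseteq> I}"
    let ?D = "{K\<in>\<F>. K \<subseteq> I}"
    have "(\<Sum>K\<in>?D. n K I * (m K * x K)) = (\<Sum>K\<in>?D. \<Sum>L\<in>{L\<in>?D. K \<subseteq> L}. m K * x K)"
    proof (intro sum.cong refl)
      fix K
      have "{L\<in>?D. K \<subseteq> L} = {L\<in>\<F>. K \<subseteq> L \<and> L \<subseteq> I}" by auto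
      then show "n K I * (m K * x K) = (\<Sum>L\<in>{L\<in>?D. K \<subseteq> L}. m K * x K)"
        by (simp add: n_def)
    qed
    also have "\<dots> = (\<Sum>L\<in>?D. \<Sum>K\<in>{K\<in>?D. K \<subseteq> L}. m K * x K)"
      using fin by (intro sum_swap_subset) auto
    also have "\<dots> = (\<Sum>L\<in>?D. X L)"
      unfolding X_def by (intro sum.cong refl) auto
    also have "\<dots> \<le> G I"
      unfolding G_def by (intro sum_mono XS) auto
    finally show "(\<Sum>K\<in>?D. n K I * (m K * x K)) \<le> G I" .
    show "0 \<le> m I" using I m by (auto simp: less_imp_le)
  qed
  have "(\<Sum>I\<in>{I\<in>\<F>. J \<subseteq> I}. (\<Sum>K\<in>{K\<in>\<F>. K \<subseteq> I}. (n J I + n K I) * (m K * x K)) / m I)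
     = (\<Sum>I\<in>{I\<in>\<F>. J \<subseteq> I}. n J I * X I / m I)
       + (\<Sum>I\<in>{I\<in>\<F>. J \<subseteq> I}. (\<Sum>K\<in>{K\<in>\<F>. K \<subseteq> I}. n K I * (m K * x K)) / m I)"
    unfolding sum.distrib[symmetric] X_def
    by (intro sum.cong refl) (simp add: distrib_right sum.distrib sum_distrib_left add_divide_distrib)
  with near far show ?thesis by (simp add: S_def)
qed


section \<open>Boxes in the half-plane\<close>

lemma uhp_lebesgue [measurable]: "uhp \<in> sets lebesgue"
  using open_uhp by (simp add: borel_open)

lemma space_dA [simp]: "space dA = uhp"
  by (simp add: dA_def space_restrict_space)

lemma sets_dA_iff: "S \<in> sets dA \<longleftrightarrow> S \<in> sets lebesgue \<and> S \<subseteq> uhp"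
  unfolding dA_def by (subst sets_restrict_space_iff) auto

lemma measure_dA: "S \<in> sets dA \<Longrightarrow> measure dA S = measure lebesgue S"
  unfolding dA_def by (subst measure_restrict_space) (auto simp: sets_restrict_space_iff)

lemma emeasure_dA: "S \<in> sets dA \<Longrightarrow> emeasure dA S = emeasure lebesgue S"
  unfolding dA_def by (subst emeasure_restrict_space) (auto simp: sets_restrict_space_iff)

lemma continuous_on_imp_measurable_dA:
  fixes f :: "complex \<Rightarrow> 'b::{second_countable_topology, t2_space, topological_space}"
  shows "continuous_on uhp f \<Longrightarrow> f \<in> borel_measurable dA"
  unfolding dA_def by (intro continuous_imp_measurable_on_sets_lebesgue) auto

text \<open>
  The boxes in use are half open in different ways. They lie between an open and a
  closed box, which differ by a null set.
\<close>

lemma between_boxes_measurable: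
  fixes S :: "complex set"
  assumes "box p q \<subseteq> S" "S \<subseteq> cbox p q"
  shows "S \<in> lmeasurable" and "measure lebesgue S = measure lborel (cbox p q)"
proof -
  have "negligible (sym_diff (cbox p q) S)"
    by (rule negligible_subset[OF negligible_frontier_interval[of p q]]) (use assms in auto)
  note neg = this
  show "S \<in> lmeasurable"
    by (rule lmeasurable_negligible_symdiff[OF lmeasurable_cbox neg])
  show "measure lebesgue S = measure lborel (cbox p q)"
    using measure_negligible_symdiff[OF lmeasurable_cbox neg] by simp
qed

definition rect :: "real \<Rightarrow> real \<Rightarrow> real \<Rightarrow> real \<Rightarrow> complex set" where
  "rect a b c d = {z. a \<le> Re z \<and> Re z < b \<and> c \<le> Im z \<and> Im z < d}"

lemma measure_cbox_complex:
  assumes "a \<le> b" "c \<le> d"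
  shows "measure lborel (cbox (Complex a c) (Complex b d)) = (b - a) * (d - c)"
  using assms by (subst measure_lborel_cbox_eq) (auto simp: Basis_complex_def inner_complex_def)

lemma rect_lmeasurable: "rect a b c d \<in> lmeasurable"
  and measure_rect: "a \<le> b \<Longrightarrow> c \<le> d \<Longrightarrow> measure lebesgue (rect a b c d) = (b - a) * (d - c)"
proof -
  have "box (Complex a c) (Complex b d) \<subseteq> rect a b c d" "rect a b c d \<subseteq> cbox (Complex a c) (Complex b d)"
    by (auto simp: rect_def in_box_complex_iff in_cbox_complex_iff)
  from between_boxes_measurable[OF this]
  show "rect a b c d \<in> lmeasurable"
    "a \<le> b \<Longrightarrow> c \<le> d \<Longrightarrow> measure lebesgue (rect a b c d) = (b - a) * (d - c)"
    by (auto simp: measure_cbox_complex)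
qed

lemma len_halfopen: "0 \<le> l \<Longrightarrow> len {a..<a + l} = l"
  by (simp add: len_def)

lemma Q_halfopen_lmeasurable:
  assumes "0 < l"
  shows "Q {a..<a + l} \<in> lmeasurable" and "measure lebesgue (Q {a..<a + l}) = l\<^sup>2"
proof -
  have "box (Complex a 0) (Complex (a + l) l) \<subseteq> Q {a..<a + l}"
    "Q {a..<a + l} \<subseteq> cbox (Complex a 0) (Complex (a + l) l)"
    using assms by (auto simp: Q_def len_halfopen in_box_complex_iff in_cbox_complex_iff)
  from between_boxes_measurable[OF this]
  show "Q {a..<a + l} \<in> lmeasurable" "measure lebesgue (Q {a..<a + l}) = l\<^sup>2"
    using assms by (auto simp: measure_cbox_complex power2_eq_square)
qed

lemma Q_subset_uhp: "Q I \<subseteq> uhp"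
  by (auto simp: Q_def uhp_def)

lemma rect_subset_uhp: "0 < c \<Longrightarrow> rect a b c d \<subseteq> uhp"
  by (auto simp: rect_def uhp_def)

lemma dA_finite_of_lmeasurable:
  assumes "S \<in> lmeasurable" "S \<subseteq> uhp"
  shows "S \<in> sets dA" "emeasure dA S < \<infinity>" "measure dA S = measure lebesgue S"
proof -
  show S: "S \<in> sets dA" using assms by (auto simp: sets_dA_iff fmeasurableD)
  show "emeasure dA S < \<infinity>"
    unfolding emeasure_dA[OF S] infinity_ennreal_def less_top[symmetric] using assms(1) by (rule fmeasurableD2)
  show "measure dA S = measure lebesgue S" by (rule measure_dA[OF S])
qed

lemmas Q_dA = dA_finite_of_lmeasurable[OF Q_halfopen_lmeasurable(1) Q_subset_uhp]
lemmas rect_dA = dA_finite_of_lmeasurable[OF rect_lmeasurable rect_subset_uhp]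

section \<open>Square integrable functions and mean oscillation\<close>

lemma Cauchy_Schwarz_integral:
  fixes f g :: "'a \<Rightarrow> real"
  assumes f: "f \<in> borel_measurable M" and g: "g \<in> borel_measurable M"
    and f2: "integrable M (\<lambda>x. (f x)\<^sup>2)" and g2: "integrable M (\<lambda>x. (g x)\<^sup>2)"
  shows "integrable M (\<lambda>x. f x * g x)"
    and "(\<integral>x. \<bar>f x * g x\<bar> \<partial>M)\<^sup>2 \<le> (\<integral>x. (f x)\<^sup>2 \<partial>M) * (\<integral>x. (g x)\<^sup>2 \<partial>M)"
    and "(\<integral>x. f x * g x \<partial>M)\<^sup>2 \<le> (\<integral>x. (f x)\<^sup>2 \<partial>M) * (\<integral>x. (g x)\<^sup>2 \<partial>M)"
proof -
  show int: "integrable M (\<lambda>x. f x * g x)"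
  proof (rule Bochner_Integration.integrable_bound[OF Bochner_Integration.integrable_add[OF f2 g2]])
    show "(\<lambda>x. f x * g x) \<in> borel_measurable M" using f g by measurable
    have "\<bar>u * v\<bar> \<le> u\<^sup>2 + v\<^sup>2" for u v :: real
    proof -
      have "2 * (\<bar>u\<bar> * \<bar>v\<bar>) \<le> u\<^sup>2 + v\<^sup>2"
        using sum_squares_bound[of "\<bar>u\<bar>" "\<bar>v\<bar>"] by simp
      moreover have "0 \<le> \<bar>u\<bar> * \<bar>v\<bar>" by simp
      ultimately show ?thesis by (simp only: abs_mult)
    qed
    then show "AE x in M. norm (f x * g x) \<le> norm ((f x)\<^sup>2 + (g x)\<^sup>2)" by auto
  qed
  then have int': "integrable M (\<lambda>x. \<bar>f x * g x\<bar>)" by simp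
  have "ennreal ((\<integral>x. \<bar>f x * g x\<bar> \<partial>M)\<^sup>2) = (\<integral>\<^sup>+x. ennreal \<bar>f x\<bar> * ennreal \<bar>g x\<bar> \<partial>M)\<^sup>2"
    using nn_integral_eq_integral[OF int'] by (simp add: abs_mult ennreal_mult ennreal_power)
  also have "\<dots> \<le> (\<integral>\<^sup>+x. (ennreal \<bar>f x\<bar>)\<^sup>2 \<partial>M) * (\<integral>\<^sup>+x. (ennreal \<bar>g x\<bar>)\<^sup>2 \<partial>M)"
    using f g by (intro Cauchy_Schwarz_nn_integral) auto
  also have "\<dots> = ennreal ((\<integral>x. (f x)\<^sup>2 \<partial>M) * (\<integral>x. (g x)\<^sup>2 \<partial>M))"
    using nn_integral_eq_integral[OF f2] nn_integral_eq_integral[OF g2]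
    by (simp add: ennreal_power ennreal_mult)
  finally show *: "(\<integral>x. \<bar>f x * g x\<bar> \<partial>M)\<^sup>2 \<le> (\<integral>x. (f x)\<^sup>2 \<partial>M) * (\<integral>x. (g x)\<^sup>2 \<partial>M)"
    by (simp add: ennreal_le_iff)
  have "\<bar>\<integral>x. f x * g x \<partial>M\<bar> \<le> (\<integral>x. \<bar>f x * g x\<bar> \<partial>M)" by simp
  then have "(\<integral>x. f x * g x \<partial>M)\<^sup>2 \<le> (\<integral>x. \<bar>f x * g x\<bar> \<partial>M)\<^sup>2"
    by (simp add: abs_le_square_iff[symmetric])
  with * show "(\<integral>x. f x * g x \<partial>M)\<^sup>2 \<le> (\<integral>x. (f x)\<^sup>2 \<partial>M) * (\<integral>x. (g x)\<^sup>2 \<partial>M)" by simp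
qed

lemma Cauchy_Schwarz_set_integral:
  fixes f g :: "'a \<Rightarrow> real"
  assumes S: "S \<in> sets M" and f: "set_borel_measurable M S f" and g: "set_borel_measurable M S g"
    and f2: "set_integrable M S (\<lambda>x. (f x)\<^sup>2)" and g2: "set_integrable M S (\<lambda>x. (g x)\<^sup>2)"
  shows "set_integrable M S (\<lambda>x. f x * g x)"
    and "(LINT x:S|M. f x * g x)\<^sup>2 \<le> (LINT x:S|M. (f x)\<^sup>2) * (LINT x:S|M. (g x)\<^sup>2)"
proof -
  have eq: "(indicator S x *\<^sub>R f x)\<^sup>2 = indicator S x *\<^sub>R (f x)\<^sup>2"
    "(indicator S x *\<^sub>R g x)\<^sup>2 = indicator S x *\<^sub>R (g x)\<^sup>2"
    "(indicator S x *\<^sub>R f x) * (indicator S x *\<^sub>R g x) = indicator S x *\<^sub>R (f x * g x)" for x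
    by (simp_all add: indicator_def)
  note CS = Cauchy_Schwarz_integral[of "\<lambda>x. indicator S x *\<^sub>R f x" M "\<lambda>x. indicator S x *\<^sub>R g x", unfolded eq]
  show "set_integrable M S (\<lambda>x. f x * g x)"
    "(LINT x:S|M. f x * g x)\<^sup>2 \<le> (LINT x:S|M. (f x)\<^sup>2) * (LINT x:S|M. (g x)\<^sup>2)"
    using f g f2 g2 CS(1,3)
    unfolding set_integrable_def set_lebesgue_integral_def set_borel_measurable_def by auto
qed

text \<open>
  The exponents one and two are treated together. The factor \<open>3 / 2\<close> is less than \<open>2\<close>, which
  makes the recursion over dyadic generations in \<open>carleson_oscillation_from_whitney\<close> contract.
\<close>

lemma power_add_le_one_or_two:
  fixes s t :: real
  assumes "p = 1 \<or> p = (2::nat)" "0 \<le> s" "0 \<le> t"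
  shows "(s + t) ^ p \<le> 3 / 2 * s ^ p + 3 * t ^ p"
proof -
  have "0 \<le> (s - 2 * t)\<^sup>2" by simp
  then have "(s + t)\<^sup>2 \<le> 3 / 2 * s\<^sup>2 + 3 * t\<^sup>2" by (simp add: power2_eq_square algebra_simps)
  with assms show ?thesis by auto
qed

lemma norm_diff_power_le:
  fixes x y c :: complex
  assumes "p = 1 \<or> p = (2::nat)"
  shows "norm (x - y) ^ p \<le> 3 / 2 * norm (x - c) ^ p + 3 * norm (c - y) ^ p"
proof -
  have "norm (x - y) \<le> norm (x - c) + norm (c - y)" by norm
  then have "norm (x - y) ^ p \<le> (norm (x - c) + norm (c - y)) ^ p" by (intro power_mono) auto
  also have "\<dots> \<le> 3 / 2 * norm (x - c) ^ p + 3 * norm (c - y) ^ p"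
    by (intro power_add_le_one_or_two assms) auto
  finally show ?thesis .
qed

lemma set_integrable_const_dA:
  assumes "S \<in> sets dA" "emeasure dA S < \<infinity>"
  shows "set_integrable dA S (\<lambda>z. c :: 'b::{banach, second_countable_topology})"
  unfolding set_integrable_def using assms by (intro integrable_scaleR_left integrable_real_indicator) auto

lemma L2_set_integrable:
  assumes b: "b \<in> L2 dA" and S: "S \<in> sets dA" "emeasure dA S < \<infinity>"
  shows "set_integrable dA S b"
    and "p = 1 \<or> p = (2::nat) \<Longrightarrow> set_integrable dA S (\<lambda>z. norm (b z - c) ^ p)"
proof -
  have [measurable]: "b \<in> borel_measurable dA" using b by (simp add: L2_def)
  have b2: "integrable dA (\<lambda>z. (norm (b z))\<^sup>2)" using b by (simp add: L2_def)
  have S': "S \<in> sets dA" by fact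
  have ind: "integrable dA (indicator S :: complex \<Rightarrow> real)"
    using S by (intro integrable_real_indicator) auto
  have bound: "integrable dA (\<lambda>z. 3 * (norm (b z))\<^sup>2 + K * indicator S z)" for K
    using b2 ind by (intro Bochner_Integration.integrable_add integrable_mult_right) auto
  show "set_integrable dA S b"
    unfolding set_integrable_def
  proof (rule Bochner_Integration.integrable_bound[OF bound[of 1]])
    show "(\<lambda>x. indicat_real S x *\<^sub>R b x) \<in> borel_measurable dA" using S' by measurable
    have "u \<le> 3 * u\<^sup>2 + 1" for u :: real
    proof -
      have "(u - 1/2)\<^sup>2 = u\<^sup>2 - u + 1/4" by (simp add: power2_eq_square algebra_simps)
      with zero_le_power2[of "u - 1/2"] zero_le_power2[of u] show ?thesis by linarith
    qed
    then show "AE x in dA. norm (indicat_real S x *\<^sub>R b x) \<le> norm (3 * (norm (b x))\<^sup>2 + 1 * indicator S x)"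
      by (auto simp: indicator_def)
  qed
  show "set_integrable dA S (\<lambda>z. norm (b z - c) ^ p)" if p: "p = 1 \<or> p = (2::nat)"
    unfolding set_integrable_def
  proof (rule Bochner_Integration.integrable_bound[OF bound[of "3 * (norm c)\<^sup>2 + 3 * norm c + 1"]])
    show "(\<lambda>x. indicat_real S x *\<^sub>R norm (b x - c) ^ p) \<in> borel_measurable dA" using S' by measurable
    have 1: "norm (x - c) ^ p \<le> 3 * (norm x)\<^sup>2 + (3 * (norm c)\<^sup>2 + 3 * norm c + 1)" for x
    proof -
      have "norm (x - c) ^ p \<le> 3 / 2 * norm x ^ p + 3 * norm c ^ p"
        using norm_diff_power_le[OF p, of x c 0] by simp
      moreover have "3 / 2 * u \<le> 3 * u\<^sup>2 + 1" for u :: real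
        using zero_le_power2[of "2 * u - 1/2"] by (simp only: power2_diff) (simp add: power2_eq_square)
      then have "3 / 2 * norm x \<le> 3 * (norm x)\<^sup>2 + 1" .
      moreover note zero_le_power2[of "norm c"] zero_le_power2[of "norm x"] norm_ge_zero[of c]
      ultimately have facts: "norm (x - c) ^ p \<le> 3 / 2 * norm x ^ p + 3 * norm c ^ p"
        "3 / 2 * norm x \<le> 3 * (norm x)\<^sup>2 + 1" "0 \<le> (norm c)\<^sup>2" "0 \<le> (norm x)\<^sup>2" "0 \<le> norm c" by blast+
      show ?thesis
      proof (cases "p = 1")
        case True
        from facts show ?thesis unfolding True power_one_right by linarith
      next
        case False
        with p have p2: "p = 2" by simp
        from facts show ?thesis unfolding p2 by linarith
      qed
    qed
    show "AE x in dA. norm (indicat_real S x *\<^sub>R norm (b x - c) ^ p)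
      \<le> norm (3 * (norm (b x))\<^sup>2 + (3 * (norm c)\<^sup>2 + 3 * norm c + 1) * indicator S x)"
      using 1 by (intro AE_I2) (auto simp: indicator_def abs_of_nonneg)
  qed
qed

lemma set_integral_const_dA:
  assumes "S \<in> sets dA" "emeasure dA S < \<infinity>"
  shows "(LINT z:S|dA. c) = measure dA S * (c::real)"
  using assms by (simp add: set_lebesgue_integral_def sets_dA_iff Int_absorb2)

lemma average_close:
  assumes b: "b \<in> L2 dA" and S: "S \<in> sets dA" "emeasure dA S < \<infinity>" "0 < measure dA S"
    and p: "p = 1 \<or> p = (2::nat)"
  shows "measure dA S * norm (average b S - c) ^ p \<le> (LINT z:S|dA. norm (b z - c) ^ p)"
proof -
  define m where "m = measure dA S"
  have intc: "set_integrable dA S (\<lambda>z. c)" for c :: complex by (rule set_integrable_const_dA[OF S(1,2)])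
  have intr: "set_integrable dA S (\<lambda>z. c)" for c :: real by (rule set_integrable_const_dA[OF S(1,2)])
  note ib = L2_set_integrable[OF b S(1,2)]
  have "(LINT z:S|dA. b z - c) = (LINT z:S|dA. b z) - m *\<^sub>R c"
    using set_integral_diff(2)[OF ib(1) intc, of c] S by (simp add: set_lebesgue_integral_def m_def sets_dA_iff Int_absorb2)
  then have "average b S - c = (LINT z:S|dA. b z - c) /\<^sub>R m"
    using S(3) by (simp add: average_def m_def scaleR_diff_right)
  then have "norm (average b S - c) = norm (LINT z:S|dA. b z - c) / m"
    using S(3) by (simp add: m_def field_simps)
  also have "\<dots> \<le> (LINT z:S|dA. norm (b z - c)) / m"
    using S(3) ib(1) intc by (intro divide_right_mono set_integral_norm_bound set_integral_diff) (auto simp: m_def)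
  finally have 1: "m * norm (average b S - c) \<le> (LINT z:S|dA. norm (b z - c))"
    using S(3) by (simp add: m_def field_simps)
  show ?thesis
  proof (cases "p = 1")
    case True with 1 show ?thesis by (simp add: m_def)
  next
    case False
    then have p2: "p = 2" using p by simp
    have [measurable]: "b \<in> borel_measurable dA" using b by (simp add: L2_def)
    have [measurable]: "S \<in> sets dA" by fact
    have "(LINT z:S|dA. norm (b z - c) * 1)\<^sup>2 \<le> (LINT z:S|dA. (norm (b z - c))\<^sup>2) * (LINT z:S|dA. 1\<^sup>2)"
      using ib(2)[of 2 c] intr
      by (intro Cauchy_Schwarz_set_integral S) (auto simp: set_borel_measurable_def)
    then have "(LINT z:S|dA. norm (b z - c))\<^sup>2 \<le> (LINT z:S|dA. (norm (b z - c))\<^sup>2) * m"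
      using set_integral_const_dA[OF S(1,2), of 1] by (simp add: m_def)
    moreover have "(m * norm (average b S - c))\<^sup>2 \<le> (LINT z:S|dA. norm (b z - c))\<^sup>2"
      using 1 S(3) by (intro power_mono) (auto simp: m_def)
    ultimately have "m * (m * (norm (average b S - c))\<^sup>2) \<le> m * (LINT z:S|dA. (norm (b z - c))\<^sup>2)"
      by (simp add: power2_eq_square mult_ac)
    then show ?thesis using S(3) p2 by (simp add: m_def)
  qed
qed

lemma mean_osc_le:
  assumes b: "b \<in> L2 dA" and S: "S \<in> sets dA" "emeasure dA S < \<infinity>" "0 < measure dA S"
    and p: "p = 1 \<or> p = (2::nat)"
  shows "(LINT z:S|dA. norm (b z - average b S) ^ p) \<le> 9 / 2 * (LINT z:S|dA. norm (b z - c) ^ p)"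
proof -
  note ib = L2_set_integrable(2)[OF b S(1,2) p]
  have intr: "set_integrable dA S (\<lambda>z. c)" for c :: real by (rule set_integrable_const_dA[OF S(1,2)])
  have "(LINT z:S|dA. norm (b z - average b S) ^ p)
     \<le> (LINT z:S|dA. 3 / 2 * norm (b z - c) ^ p + 3 * norm (c - average b S) ^ p)"
    by (intro set_integral_mono ib norm_diff_power_le[OF p] set_integral_add set_integrable_mult_right intr)
  also have "\<dots> = 3 / 2 * (LINT z:S|dA. norm (b z - c) ^ p) + measure dA S * (3 * norm (c - average b S) ^ p)"
    by (subst set_integral_add(2)) (auto intro!: set_integrable_mult_right ib intr simp: set_integral_const_dA[OF S(1,2)])
  also have "\<dots> \<le> 3 / 2 * (LINT z:S|dA. norm (b z - c) ^ p) + 3 * (LINT z:S|dA. norm (b z - c) ^ p)"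
    using average_close[OF b S p, of c] by (simp add: norm_minus_commute)
  finally show ?thesis by simp
qed


section \<open>From Whitney boxes to Carleson boxes\<close>

abbreviation whitney :: "real \<Rightarrow> real \<Rightarrow> complex set" where
  "whitney a l \<equiv> rect a (a + l) (l / 4) l"

lemma set_integral_subset_mono:
  fixes f :: "'a \<Rightarrow> real"
  assumes "set_integrable M B f" "A \<in> sets M" "A \<subseteq> B" "\<And>x. x \<in> B \<Longrightarrow> 0 \<le> f x"
  shows "(LINT x:A|M. f x) \<le> (LINT x:B|M. f x)"
proof -
  have "set_integrable M A f" by (rule set_integrable_subset[OF assms(1-3)])
  then show ?thesis
    using assms unfolding set_lebesgue_integral_def set_integrable_def
    by (intro integral_mono) (auto simp: indicator_def)
qed

text \<open>
  The Carleson box without a strip at the bottom is a Whitney box together with two such truncated boxes of half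
  the side. Passing to the constant \<open>c\<close> of a half costs the factor \<open>3 / 2\<close> and a multiple of \<open>\<tau>\<close>.
  Each half has a quarter of the squared side, so the bound \<open>112 \<tau> l\<^sup>2\<close> reproduces itself because
  \<open>1 + 2 (112 (3/8) + 54/4) = 112\<close>. The strip is then removed by monotone exhaustion.
\<close>

lemma carleson_oscillation_from_whitney:
  fixes b :: "complex \<Rightarrow> complex" and \<tau> :: real
  assumes b: "b \<in> L2 dA" and p: "p = 1 \<or> p = (2::nat)"
    and W: "\<And>a l. 0 < l \<Longrightarrow> \<exists>c. (LINT z:whitney a l|dA. norm (b z - c) ^ p) \<le> \<tau> * l\<^sup>2"
    and l: "0 < l"
  shows "\<exists>c. (LINT z:Q {a..<a + l}|dA. norm (b z - c) ^ p) \<le> 112 * \<tau> * l\<^sup>2"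
proof -
  define c where
    "c a l = (SOME c. (LINT z:whitney a l|dA. norm (b z - c) ^ p) \<le> \<tau> * l\<^sup>2)" for a l
  have c: "(LINT z:whitney a l|dA. norm (b z - c a l) ^ p) \<le> \<tau> * l\<^sup>2" if "0 < l" for a l
    unfolding c_def by (rule someI_ex[OF W[OF that]])
  note int = L2_set_integrable(2)[OF b _ _ p]
  have int_rect: "set_integrable dA (rect a a' h h') (\<lambda>z. norm (b z - c) ^ p)" if "0 < h" for a a' h h' c
    using that by (intro int rect_dA)
  have int_const: "set_integrable dA (rect a a' h h') (\<lambda>z. c)" if "0 < h" for a a' h h' and c :: real
    using that by (intro set_integrable_const_dA rect_dA)
  have const: "(LINT z:rect a a' h h'|dA. k) = (a' - a) * (h' - h) * (k::real)"
    if "0 < h" "h \<le> h'" "a \<le> a'" for a a' h h' k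
    using that rect_dA[OF that(1)] by (subst set_integral_const_dA) (auto simp: measure_rect)
  \<comment> \<open>The Whitney boxes of an interval and of one of its halves overlap in a box of area \<open>l\<^sup>2 / 8\<close>.\<close>
  have step: "norm (c a l - c a' (l / 2)) ^ p \<le> 18 * \<tau>"
    if l: "0 < l" and a': "a' = a \<or> a' = a + l / 2" for a a' l
  proof -
    define S where "S = rect a' (a' + l / 2) (l / 4) (l / 2)"
    define k where "k = norm (c a l - c a' (l / 2)) ^ p"
    have S: "S \<in> sets dA" unfolding S_def using l by (intro rect_dA) auto
    have "l\<^sup>2 / 8 * k = (LINT z:S|dA. k)"
      unfolding S_def using l by (subst const) (auto simp: power2_eq_square)
    also have "\<dots> \<le> (LINT z:S|dA. 3 / 2 * norm (b z - c a l) ^ p + 3 * norm (b z - c a' (l / 2)) ^ p)"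
    proof (rule set_integral_mono)
      show "set_integrable dA S (\<lambda>z. k)" unfolding S_def using l by (intro int_const) auto
      show "set_integrable dA S (\<lambda>z. 3 / 2 * norm (b z - c a l) ^ p + 3 * norm (b z - c a' (l / 2)) ^ p)"
        unfolding S_def using l by (intro set_integral_add set_integrable_mult_right int_rect) auto
      show "k \<le> 3 / 2 * norm (b z - c a l) ^ p + 3 * norm (b z - c a' (l / 2)) ^ p" for z
        unfolding k_def using norm_diff_power_le[OF p, of "c a l" "c a' (l / 2)" "b z"]
        by (simp add: norm_minus_commute)
    qed
    also have "\<dots> = 3 / 2 * (LINT z:S|dA. norm (b z - c a l) ^ p) + 3 * (LINT z:S|dA. norm (b z - c a' (l / 2)) ^ p)"
      unfolding S_def using l by (subst set_integral_add(2)) (auto intro!: set_integrable_mult_right int_rect)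
    also have "(LINT z:S|dA. norm (b z - c a l) ^ p) \<le> (LINT z:whitney a l|dA. norm (b z - c a l) ^ p)"
      using l a' by (intro set_integral_subset_mono S int_rect) (auto simp: S_def rect_def)
    also have "\<dots> \<le> \<tau> * l\<^sup>2" by (rule c[OF l])
    also have "(LINT z:S|dA. norm (b z - c a' (l / 2)) ^ p)
        \<le> (LINT z:rect a' (a' + l / 2) (l / 2 / 4) (l / 2)|dA. norm (b z - c a' (l / 2)) ^ p)"
      using l by (intro set_integral_subset_mono S int_rect) (auto simp: S_def rect_def)
    also have "\<dots> \<le> \<tau> * (l / 2)\<^sup>2" using c[of "l / 2" a'] l by simp
    finally have "l\<^sup>2 * k \<le> l\<^sup>2 * (18 * \<tau>)"
      by (simp add: power2_eq_square algebra_simps)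
    then show ?thesis unfolding k_def using l by simp
  qed
  define G where "G n a l = rect a (a + l) (l * (1 / 2) ^ n) l" for n :: nat and a l
  have trunc: "0 < l \<Longrightarrow> (LINT z:G n a l|dA. norm (b z - c a l) ^ p) \<le> 112 * \<tau> * l\<^sup>2" for n a l
  proof (induction n arbitrary: a l)
    case 0
    have e: "G 0 a l = {}" by (auto simp: G_def rect_def)
    have "0 \<le> (LINT z:whitney a l|dA. norm (b z - c a l) ^ p)"
      unfolding set_lebesgue_integral_def by (intro Bochner_Integration.integral_nonneg) auto
    then have "0 \<le> \<tau> * l\<^sup>2" using c[OF 0] by (rule order_trans)
    then show ?case by (simp add: e set_lebesgue_integral_def)
  next
    case (Suc n)
    note l = Suc.prems
    have half: "(LINT z:G n a' (l / 2)|dA. norm (b z - c a l) ^ p) \<le> (112 * 3 / 8 + 54 / 4) * \<tau> * l\<^sup>2"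
      if a': "a' = a \<or> a' = a + l / 2" for a'
    proof -
      define h where "h = l / 2 * (1 / 2) ^ n"
      have "(1 / 2 :: real) ^ n \<le> 1" by (intro power_le_one) auto
      then have h: "0 < h" "h \<le> l / 2" using l by (auto simp: h_def)
      have \<tau>: "0 \<le> \<tau>" using step[OF l a'] zero_le_power[OF norm_ge_zero] by (smt (verit))
      have "(LINT z:G n a' (l / 2)|dA. norm (b z - c a l) ^ p)
        \<le> (LINT z:G n a' (l / 2)|dA. 3 / 2 * norm (b z - c a' (l / 2)) ^ p + 3 * (18 * \<tau>))"
      proof (rule set_integral_mono)
        show "set_integrable dA (G n a' (l / 2)) (\<lambda>z. norm (b z - c a l) ^ p)"
          unfolding G_def h_def[symmetric] using h by (intro int_rect)
        show "set_integrable dA (G n a' (l / 2)) (\<lambda>z. 3 / 2 * norm (b z - c a' (l / 2)) ^ p + 3 * (18 * \<tau>))"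
          unfolding G_def h_def[symmetric] using h
          by (intro set_integral_add set_integrable_mult_right int_rect int_const)
        show "norm (b z - c a l) ^ p \<le> 3 / 2 * norm (b z - c a' (l / 2)) ^ p + 3 * (18 * \<tau>)" for z
          using norm_diff_power_le[OF p, of "b z" "c a l" "c a' (l / 2)"] step[OF l a']
          by (simp add: norm_minus_commute)
      qed
      also have "\<dots> = 3 / 2 * (LINT z:G n a' (l / 2)|dA. norm (b z - c a' (l / 2)) ^ p)
          + l / 2 * (l / 2 - h) * (3 * (18 * \<tau>))"
        unfolding G_def h_def[symmetric] using h l
        by (subst set_integral_add(2)) (auto intro!: set_integrable_mult_right int_rect int_const simp: const)
      also have "\<dots> \<le> 3 / 2 * (112 * \<tau> * (l / 2)\<^sup>2) + l / 2 * (l / 2) * (3 * (18 * \<tau>))"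
        using Suc.IH[of "l / 2" a'] l h \<tau> by (intro add_mono mult_left_mono mult_right_mono) auto
      also have "\<dots> = (112 * 3 / 8 + 54 / 4) * \<tau> * l\<^sup>2"
        by (simp add: power2_eq_square algebra_simps)
      finally show ?thesis .
    qed
    define T where "T = rect a (a + l) (l / 2) l"
    define A where "A = G n a (l / 2)"
    define B where "B = G n (a + l / 2) (l / 2)"
    have pw: "(1 / 2 :: real) ^ n \<le> 1" by (intro power_le_one) auto
    then have pw': "l * (1 / 2) ^ n \<le> l" using l by simp
    have hpos: "0 < l / 2 * (1 / 2) ^ n" using l by simp
    have "rect a (a + l) (q / 2) l
        = rect a (a + l) (l / 2) l \<union> (rect a (a + l / 2) (q / 2) (l / 2) \<union> rect (a + l / 2) (a + l) (q / 2) (l / 2))"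
      if "q \<le> l" for q
      using l that by (auto simp: rect_def)
    from this[OF pw'] have eq: "G (Suc n) a l = T \<union> (A \<union> B)"
      by (simp add: G_def T_def A_def B_def add.commute)
    have disj: "T \<inter> (A \<union> B) = {}" "A \<inter> B = {}"
      by (auto simp: G_def T_def A_def B_def rect_def)
    have iT: "set_integrable dA T (\<lambda>z. norm (b z - c a l) ^ p)"
      and iA: "set_integrable dA A (\<lambda>z. norm (b z - c a l) ^ p)"
      and iB: "set_integrable dA B (\<lambda>z. norm (b z - c a l) ^ p)"
      unfolding T_def A_def B_def G_def using l hpos by (auto intro!: int_rect)
    have mA: "A \<in> sets dA" "B \<in> sets dA" "T \<in> sets dA"
      unfolding T_def A_def B_def G_def using l hpos by (auto intro!: rect_dA)
    have "(LINT z:G (Suc n) a l|dA. norm (b z - c a l) ^ p)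
       = (LINT z:T|dA. norm (b z - c a l) ^ p) + ((LINT z:A|dA. norm (b z - c a l) ^ p)
         + (LINT z:B|dA. norm (b z - c a l) ^ p))"
      unfolding eq using iT iA iB mA disj
      by (subst set_integral_Un) (auto simp: set_integral_Un intro!: set_integrable_Un)
    also have "(LINT z:T|dA. norm (b z - c a l) ^ p) \<le> (LINT z:whitney a l|dA. norm (b z - c a l) ^ p)"
      using l by (intro set_integral_subset_mono mA int_rect) (auto simp: T_def rect_def)
    also have "\<dots> \<le> \<tau> * l\<^sup>2" by (rule c[OF l])
    also have "(LINT z:A|dA. norm (b z - c a l) ^ p) \<le> (112 * 3 / 8 + 54 / 4) * \<tau> * l\<^sup>2"
      unfolding A_def by (rule half) simp
    also have "(LINT z:B|dA. norm (b z - c a l) ^ p) \<le> (112 * 3 / 8 + 54 / 4) * \<tau> * l\<^sup>2"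
      unfolding B_def by (rule half) simp
    finally show ?case by simp
  qed
  have U: "Q {a..<a + l} = (\<Union>n. G n a l)"
  proof (intro equalityI subsetI)
    fix z assume z: "z \<in> Q {a..<a + l}"
    then have "0 < Im z / l" using l by (simp add: Q_def)
    then obtain n where "(1 / 2) ^ n < Im z / l" using real_arch_pow_inv[of "Im z / l" "1/2"] by auto
    then have "l * (1 / 2) ^ n \<le> Im z" using l by (simp add: field_simps)
    then show "z \<in> (\<Union>n. G n a l)" using z l by (auto simp: G_def rect_def Q_def len_halfopen)
  next
    fix z assume "z \<in> (\<Union>n. G n a l)"
    then obtain n where "z \<in> G n a l" by auto
    moreover from this have "0 < Im z"
      using l less_le_trans[of 0 "l * (1 / 2) ^ n" "Im z"] by (simp add: G_def rect_def)
    ultimately show "z \<in> Q {a..<a + l}" using l by (auto simp: G_def rect_def Q_def len_halfopen)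
  qed
  have inc: "incseq (\<lambda>n. G n a l)"
  proof (rule incseq_SucI)
    show "G n a l \<le> G (Suc n) a l" for n
    proof -
      have "l * (1 / 2) ^ Suc n \<le> l * (1 / 2) ^ n" using l by simp
      then show ?thesis unfolding G_def rect_def using order_trans by blast
    qed
  qed
  have "(\<lambda>n. LINT z:G n a l|dA. norm (b z - c a l) ^ p) \<longlonglongrightarrow> (LINT z:(\<Union>n. G n a l)|dA. norm (b z - c a l) ^ p)"
  proof (rule set_integral_cont_up[OF _ inc])
    show "G n a l \<in> sets dA" for n unfolding G_def using l by (intro rect_dA) auto
    show "set_integrable dA (\<Union>n. G n a l) (\<lambda>z. norm (b z - c a l) ^ p)"
      unfolding U[symmetric] using l by (intro int Q_dA)
  qed
  then have "(LINT z:Q {a..<a + l}|dA. norm (b z - c a l) ^ p) \<le> 112 * \<tau> * l\<^sup>2"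
    unfolding U[symmetric] using trunc[OF l] by (intro LIMSEQ_le_const2) auto
  then show ?thesis by blast
qed


section \<open>The weighted measures\<close>

definition bergman_density :: "real \<Rightarrow> complex \<Rightarrow> real" where
  "bergman_density \<alpha> w = (\<alpha> + 1) / pi * (2 * Im w) powr \<alpha>"

lemma bergman_density_nonneg: "-1 < \<alpha> \<Longrightarrow> 0 \<le> bergman_density \<alpha> w"
  by (simp add: bergman_density_def)

lemma bergman_density_pos: "-1 < \<alpha> \<Longrightarrow> w \<in> uhp \<Longrightarrow> 0 < bergman_density \<alpha> w"
  by (simp add: bergman_density_def uhp_def)

lemma continuous_on_bergman_density: "continuous_on uhp (bergman_density \<alpha>)"
  unfolding bergman_density_def by (intro continuous_intros) (auto simp: uhp_def)

lemma bergman_density_measurable [measurable]: "bergman_density \<alpha> \<in> borel_measurable dA"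
  by (intro continuous_on_imp_measurable_dA continuous_on_bergman_density)

lemma bergman_density_scale:
  assumes "-1 < \<alpha>"
  obtains c C where "0 < c" "0 < C"
    "\<And>l w. 0 < l \<Longrightarrow> l / 4 \<le> Im w \<Longrightarrow> Im w \<le> l \<Longrightarrow>
       c * l powr \<alpha> \<le> bergman_density \<alpha> w \<and> bergman_density \<alpha> w \<le> C * l powr \<alpha>"
proof
  define k where "k = (\<alpha> + 1) / pi"
  have k: "0 < k" using assms by (simp add: k_def)
  show "0 < k * 2 powr (- \<bar>\<alpha>\<bar>)" "0 < k * 2 powr \<bar>\<alpha>\<bar>" using k by auto
  fix l :: real and w assume l: "0 < l" and w: "l / 4 \<le> Im w" "Im w \<le> l"
  define t where "t = 2 * Im w / l"
  have t: "1 / 2 \<le> t" "t \<le> 2" using l w by (auto simp: t_def field_simps)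
  have eq: "bergman_density \<alpha> w = k * t powr \<alpha> * l powr \<alpha>"
  proof -
    have "2 * Im w = t * l" using l by (simp add: t_def)
    then show ?thesis using t l by (simp add: bergman_density_def k_def powr_mult)
  qed
  have "\<bar>ln t\<bar> \<le> ln 2"
  proof -
    have "ln (1/2) \<le> ln t" "ln t \<le> ln 2" using t by auto
    then show ?thesis by (simp add: ln_div)
  qed
  then have "\<bar>\<alpha> * ln t\<bar> \<le> \<bar>\<alpha>\<bar> * ln 2" by (simp add: abs_mult mult_left_mono)
  then have "exp (- (\<bar>\<alpha>\<bar> * ln 2)) \<le> exp (\<alpha> * ln t)" "exp (\<alpha> * ln t) \<le> exp (\<bar>\<alpha>\<bar> * ln 2)"
    by (auto simp: abs_le_iff)
  then have "2 powr (- \<bar>\<alpha>\<bar>) \<le> t powr \<alpha>" "t powr \<alpha> \<le> 2 powr \<bar>\<alpha>\<bar>"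
    using t by (auto simp: powr_def)
  then show "k * 2 powr (- \<bar>\<alpha>\<bar>) * l powr \<alpha> \<le> bergman_density \<alpha> w \<and> bergman_density \<alpha> w \<le> k * 2 powr \<bar>\<alpha>\<bar> * l powr \<alpha>"
    unfolding eq using k by (auto intro!: mult_right_mono mult_left_mono)
qed

lemma dA_wt_eq: "dA_wt \<alpha> = density dA (\<lambda>z. ennreal (bergman_density \<alpha> z))"
  by (simp add: dA_wt_def bergman_density_def)

lemma weighted_eq:
  assumes "-1 < \<alpha>" "weight \<sigma>"
  shows "weighted \<alpha> \<sigma> = density dA (\<lambda>z. ennreal (bergman_density \<alpha> z * \<sigma> z))"
  unfolding weighted_def dA_wt_eq using assms
  by (subst density_density_eq) (auto simp: weight_def ennreal_mult' bergman_density_nonneg)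

lemma sets_weighted [simp]: "sets (weighted \<alpha> \<sigma>) = sets dA"
  by (simp add: weighted_def dA_wt_def)

lemma borel_measurable_weighted [simp]:
  "f \<in> borel_measurable (weighted \<alpha> \<sigma>) \<longleftrightarrow> f \<in> borel_measurable dA"
  by (simp cong: measurable_cong_sets)

lemma weight_density_pos:
  assumes "-1 < \<alpha>" "weight \<sigma>"
  shows "AE z in dA. 0 < bergman_density \<alpha> z * \<sigma> z"
  using assms(2) AE_space[of dA] unfolding weight_def
  by (auto elim!: eventually_elim2 intro!: mult_pos_pos bergman_density_pos assms(1))

lemma AE_weighted:
  assumes "-1 < \<alpha>" "weight \<sigma>"
  shows "(AE z in weighted \<alpha> \<sigma>. P z) \<longleftrightarrow> (AE z in dA. P z)"
proof -
  have [measurable]: "\<sigma> \<in> borel_measurable dA" using assms by (simp add: weight_def)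
  have "(AE z in weighted \<alpha> \<sigma>. P z) \<longleftrightarrow> (AE z in dA. 0 < bergman_density \<alpha> z * \<sigma> z \<longrightarrow> P z)"
    unfolding weighted_eq[OF assms] by (subst AE_density) auto
  also have "\<dots> \<longleftrightarrow> (AE z in dA. P z)"
    using weight_density_pos[OF assms] by (auto elim: eventually_elim2)
  finally show ?thesis .
qed

lemma L2_weighted_iff:
  assumes "-1 < \<alpha>" "weight \<sigma>"
  shows "f \<in> L2 (weighted \<alpha> \<sigma>) \<longleftrightarrow>
     f \<in> borel_measurable dA \<and> integrable dA (\<lambda>z. bergman_density \<alpha> z * \<sigma> z * (norm (f z))\<^sup>2)"
proof -
  have [measurable]: "\<sigma> \<in> borel_measurable dA" using assms by (simp add: weight_def)
  have nn: "AE z in dA. 0 \<le> bergman_density \<alpha> z * \<sigma> z"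
    using weight_density_pos[OF assms] by (auto elim: eventually_mono)
  have "integrable (weighted \<alpha> \<sigma>) (\<lambda>z. (norm (f z))\<^sup>2)
      \<longleftrightarrow> integrable dA (\<lambda>z. bergman_density \<alpha> z * \<sigma> z * (norm (f z))\<^sup>2)"
    if [measurable]: "f \<in> borel_measurable dA"
    unfolding weighted_eq[OF assms] using nn by (subst integrable_density) auto
  then show ?thesis by (auto simp: L2_def)
qed

lemma L2_norm_weighted:
  assumes "-1 < \<alpha>" "weight \<sigma>" and [measurable]: "f \<in> borel_measurable dA"
  shows "(L2_norm (weighted \<alpha> \<sigma>) f)\<^sup>2 = (\<integral>z. bergman_density \<alpha> z * \<sigma> z * (norm (f z))\<^sup>2 \<partial>dA)"
proof -
  have [measurable]: "\<sigma> \<in> borel_measurable dA" using assms by (simp add: weight_def)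
  have nn: "AE z in dA. 0 \<le> bergman_density \<alpha> z * \<sigma> z"
    using weight_density_pos[OF assms(1,2)] by (auto elim: eventually_mono)
  have "(\<integral>z. (norm (f z))\<^sup>2 \<partial>weighted \<alpha> \<sigma>) = (\<integral>z. bergman_density \<alpha> z * \<sigma> z * (norm (f z))\<^sup>2 \<partial>dA)"
    unfolding weighted_eq[OF assms(1,2)] using nn by (subst integral_density) auto
  moreover have "0 \<le> (\<integral>z. (norm (f z))\<^sup>2 \<partial>weighted \<alpha> \<sigma>)" by simp
  ultimately show ?thesis by (simp add: L2_norm_def)
qed

lemma L2_norm_nonneg: "0 \<le> L2_norm M f"
  by (simp add: L2_norm_def)

text \<open>
  The supremum in the definition is over the unit ball. Homogeneity holds only almost everywhere,
  which suffices for the norms.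
\<close>

lemma operator_norm_bounds:
  assumes T: "bounded_operator M T"
  shows "0 \<le> operator_norm M T"
    and "f \<in> L2 M \<Longrightarrow> L2_norm M (T f) \<le> operator_norm M T * L2_norm M f"
proof -
  obtain K where K: "\<And>f. f \<in> L2 M \<Longrightarrow> L2_norm M (T f) \<le> K * L2_norm M f"
    using T unfolding bounded_operator_def by blast
  let ?B = "{f \<in> L2 M. L2_norm M f \<le> 1}"
  have bdd: "bdd_above ((\<lambda>f. L2_norm M (T f)) ` ?B)"
  proof (rule bdd_aboveI2)
    fix f assume f: "f \<in> ?B"
    have "K * L2_norm M f \<le> \<bar>K\<bar> * L2_norm M f" by (intro mult_right_mono L2_norm_nonneg) auto
    also have "\<dots> \<le> \<bar>K\<bar> * 1" using f by (intro mult_left_mono) auto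
    finally show "L2_norm M (T f) \<le> \<bar>K\<bar>" using K[of f] f by simp
  qed
  have le: "L2_norm M (T f) \<le> operator_norm M T" if "f \<in> ?B" for f
    unfolding operator_norm_def by (rule cSUP_upper[OF that bdd])
  have z: "(\<lambda>_. 0) \<in> ?B" by (simp add: L2_def L2_norm_def)
  show nn: "0 \<le> operator_norm M T"
    using le[OF z] L2_norm_nonneg order_trans by blast
  assume f: "f \<in> L2 M"
  show "L2_norm M (T f) \<le> operator_norm M T * L2_norm M f"
  proof (cases "L2_norm M f = 0")
    case True
    then show ?thesis using K[OF f] by simp
  next
    case False
    define n where "n = L2_norm M f"
    have n: "0 < n" using False L2_norm_nonneg[of M f] by (simp add: n_def)
    define c where "c = complex_of_real (1 / n)"
    have [measurable]: "f \<in> borel_measurable M" using f by (simp add: L2_def)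
    have i2: "integrable M (\<lambda>z. (norm (f z))\<^sup>2)" using f by (simp add: L2_def)
    define g where "g = (\<lambda>w. c * f w + 0 * f w)"
    have ng: "(norm (g w))\<^sup>2 = (1 / n)\<^sup>2 * (norm (f w))\<^sup>2" for w
      using n by (simp add: g_def c_def norm_mult norm_divide power_mult_distrib power_divide)
    have "L2_norm M g = sqrt ((1 / n)\<^sup>2 * (\<integral>z. (norm (f z))\<^sup>2 \<partial>M))"
      by (simp only: L2_norm_def ng Bochner_Integration.integral_mult_right_zero)
    also have "\<dots> = 1 / n * n"
      unfolding real_sqrt_mult n_def L2_norm_def using n by (simp add: n_def L2_norm_def)
    finally have gn: "L2_norm M g = 1" using n by simp
    have gB: "g \<in> ?B"
      using gn i2 by (auto simp: L2_def ng) (simp add: g_def)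
    have TfM: "T f \<in> L2 M" using T f by (simp add: bounded_operator_def)
    have [measurable]: "T f \<in> borel_measurable M" using TfM by (simp add: L2_def)
    have TgM: "T g \<in> L2 M" using T gB by (simp add: bounded_operator_def)
    have [measurable]: "T g \<in> borel_measurable M" using TgM by (simp add: L2_def)
    have "AE z in M. T g z = c * T f z + 0 * T f z"
      using T f unfolding bounded_operator_def g_def by blast
    then have "AE z in M. (norm (T g z))\<^sup>2 = (1 / n)\<^sup>2 * (norm (T f z))\<^sup>2"
      using n by (auto elim!: eventually_mono simp: c_def norm_mult norm_divide power_mult_distrib power_divide)
    then have "(\<integral>z. (norm (T g z))\<^sup>2 \<partial>M) = (\<integral>z. (1 / n)\<^sup>2 * (norm (T f z))\<^sup>2 \<partial>M)"
      by (intro integral_cong_AE) auto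
    then have "L2_norm M (T g) = sqrt ((1 / n)\<^sup>2 * (\<integral>z. (norm (T f z))\<^sup>2 \<partial>M))"
      by (simp only: L2_norm_def Bochner_Integration.integral_mult_right_zero)
    also have "\<dots> = 1 / n * L2_norm M (T f)"
      unfolding real_sqrt_mult using n by (simp add: L2_norm_def)
    finally have "L2_norm M (T f) = L2_norm M (T g) * n" using n by simp
    also have "\<dots> \<le> operator_norm M T * n" using le[OF gB] n by (intro mult_right_mono) auto
    finally show ?thesis by (simp add: n_def)
  qed
qed

section \<open>The averages in the weight condition\<close>

lemma weight_inverse: "weight \<sigma> \<Longrightarrow> weight (\<lambda>z. inverse (\<sigma> z))"
  by (auto simp: weight_def)

text \<open>
  The strip of the box between heights \<open>l/2\<^sup>n\<^sup>+\<^sup>1\<close> and \<open>l/2\<^sup>n\<close> has measure comparable to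
  \<open>l powr (2+\<alpha>)\<close> times the \<open>n\<close>-th power of \<open>q = 2 powr (-1-\<alpha>)\<close>. The series converges since \<open>\<alpha> > -1\<close>.
\<close>

lemma dA_wt_Q_bounds:
  assumes \<alpha>: "-1 < \<alpha>"
  obtains C where "0 < C"
    "\<And>a l. 0 < l \<Longrightarrow> 0 < emeasure (dA_wt \<alpha>) (Q {a..<a + l}) \<and>
       emeasure (dA_wt \<alpha>) (Q {a..<a + l}) \<le> ennreal (C * l powr (2 + \<alpha>))"
proof -
  obtain c1 C1 where c1: "0 < c1" "0 < C1" and sc:
    "\<And>l w. 0 < l \<Longrightarrow> l / 4 \<le> Im w \<Longrightarrow> Im w \<le> l \<Longrightarrow>
       c1 * l powr \<alpha> \<le> bergman_density \<alpha> w \<and> bergman_density \<alpha> w \<le> C1 * l powr \<alpha>"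
    using bergman_density_scale[OF \<alpha>] by blast
  define q where "q = (1 / 2 :: real) powr (1 + \<alpha>)"
  have q: "0 < q" "q < 1" using \<alpha> powr_less_mono2[of "1 + \<alpha>" "1/2" 1] by (auto simp: q_def)
  define C where "C = C1 * (1 / (1 - q))"
  have C: "0 < C" using c1 q by (simp add: C_def)
  have em: "emeasure (dA_wt \<alpha>) S = (\<integral>\<^sup>+z. ennreal (bergman_density \<alpha> z) * indicator S z \<partial>dA)"
    if "S \<in> sets dA" for S
    unfolding dA_wt_eq using that by (subst emeasure_density) auto
  have "0 < emeasure (dA_wt \<alpha>) (Q {a..<a + l}) \<and>
       emeasure (dA_wt \<alpha>) (Q {a..<a + l}) \<le> ennreal (C * l powr (2 + \<alpha>))" if l: "0 < l" for a l
  proof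
    define R where "R = whitney a l"
    have R: "R \<in> sets dA" "emeasure dA R < \<infinity>" and mR: "measure dA R = 3 / 4 * l\<^sup>2"
      unfolding R_def using l rect_dA[of "l/4" a "a + l" l] by (auto simp: measure_rect power2_eq_square)
    have eR: "emeasure dA R = ennreal (3 / 4 * l\<^sup>2)"
      using R mR by (simp add: emeasure_eq_ennreal_measure less_top[symmetric])
    have "0 < ennreal (c1 * l powr \<alpha>) * emeasure dA R"
      using c1 l by (simp add: eR ennreal_zero_less_mult_iff)
    also have "\<dots> = (\<integral>\<^sup>+z. ennreal (c1 * l powr \<alpha>) * indicator R z \<partial>dA)"
      using R by (subst nn_integral_cmult_indicator) auto
    also have "\<dots> \<le> (\<integral>\<^sup>+z. ennreal (bergman_density \<alpha> z) * indicator (Q {a..<a + l}) z \<partial>dA)"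
      using sc[OF l] l by (intro nn_integral_mono)
        (auto simp: indicator_def R_def rect_def Q_def len_halfopen intro!: ennreal_leI)
    also have "\<dots> = emeasure (dA_wt \<alpha>) (Q {a..<a + l})"
      using l by (intro em[symmetric] Q_dA)
    finally show "0 < emeasure (dA_wt \<alpha>) (Q {a..<a + l})" .
    define S where "S n = rect a (a + l) (l * (1/2) ^ n / 2) (l * (1/2) ^ n)" for n :: nat
    have S: "S n \<in> sets dA" for n unfolding S_def using l by (intro rect_dA) auto
    have SU: "Q {a..<a + l} \<subseteq> (\<Union>n. S n)"
    proof
      fix z assume z: "z \<in> Q {a..<a + l}"
      define P where "P n \<longleftrightarrow> l * (1/2) ^ n / 2 \<le> Im z" for n :: nat
      have "0 < Im z / l" using l z by (simp add: Q_def)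
      then obtain n where "(1 / 2) ^ n < Im z / l" using real_arch_pow_inv[of "Im z / l" "1/2"] by auto
      then have "l * (1 / 2) ^ n \<le> Im z" using l by (simp add: field_simps)
      moreover have "0 \<le> l * (1 / 2) ^ n" using l by simp
      ultimately have "P n" unfolding P_def by linarith
      define k where "k = (LEAST n. P n)"
      have L: "P k" unfolding k_def using \<open>P n\<close> by (rule LeastI)
      have "Im z < l * (1/2) ^ k"
      proof (cases k)
        case 0 then show ?thesis using z l by (simp add: Q_def len_halfopen)
      next
        case (Suc j)
        then have "\<not> P j" using not_less_Least[of j P] by (simp add: k_def)
        then show ?thesis using Suc by (simp add: P_def)
      qed
      moreover have "l * (1/2) ^ k / 2 \<le> Im z" using L unfolding P_def .
      ultimately have "z \<in> S k" using z l by (simp add: S_def rect_def Q_def len_halfopen)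
      then show "z \<in> (\<Union>n. S n)" by blast
    qed
    have bnd: "emeasure (dA_wt \<alpha>) (S n) \<le> ennreal (C1 * l powr (2 + \<alpha>) * q ^ n)" for n
    proof -
      define h where "h = l * (1/2) ^ n"
      have h: "0 < h" using l by (simp add: h_def)
      have Sh: "S n = rect a (a + l) (h / 2) h" by (simp add: S_def h_def)
      have mS: "emeasure dA (S n) = ennreal (l * (h / 2))"
        using rect_dA[of "h / 2" a "a + l" h] h l
        by (simp add: Sh emeasure_eq_ennreal_measure less_top[symmetric] measure_rect)
      have "emeasure (dA_wt \<alpha>) (S n) \<le> (\<integral>\<^sup>+z. ennreal (C1 * h powr \<alpha>) * indicator (S n) z \<partial>dA)"
        unfolding em[OF S] using sc[OF h] h
        by (intro nn_integral_mono) (auto simp: indicator_def Sh rect_def intro!: ennreal_leI)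
      also have "\<dots> = ennreal (C1 * h powr \<alpha>) * ennreal (l * (h / 2))"
        using S by (subst nn_integral_cmult_indicator) (auto simp: mS)
      also have "\<dots> = ennreal (C1 * h powr \<alpha> * (l * (h / 2)))"
        using c1 h l by (subst ennreal_mult[symmetric]) auto
      also have "C1 * h powr \<alpha> * (l * (h / 2)) \<le> C1 * l powr (2 + \<alpha>) * q ^ n"
      proof -
        have "h powr \<alpha> * h = h powr (1 + \<alpha>)" using h by (simp add: powr_add)
        also have "\<dots> = l powr (1 + \<alpha>) * q ^ n"
        proof -
          have "((1 / 2 :: real) ^ n) powr (1 + \<alpha>) = (1 / 2) powr (real n * (1 + \<alpha>))"
            by (subst powr_realpow[symmetric]) (simp_all add: powr_powr)
          also have "\<dots> = q ^ n"
            using q by (subst powr_realpow[symmetric]) (simp_all add: q_def powr_powr mult.commute)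
          finally show ?thesis using l by (simp add: h_def powr_mult)
        qed
        finally have "C1 * h powr \<alpha> * (l * (h / 2)) = C1 * (l powr (1 + \<alpha>) * l) * q ^ n / 2" by (simp add: mult_ac)
        also have "l powr (1 + \<alpha>) * l = l powr (2 + \<alpha>)"
          using l powr_add[of l "1 + \<alpha>" 1] by simp
        finally show ?thesis using c1 q by simp
      qed
      finally show ?thesis by (simp add: ennreal_leI)
    qed
    have "emeasure (dA_wt \<alpha>) (Q {a..<a + l}) \<le> emeasure (dA_wt \<alpha>) (\<Union>n. S n)"
      using SU S by (intro emeasure_mono) (auto simp: dA_wt_eq)
    also have "\<dots> \<le> (\<Sum>n. emeasure (dA_wt \<alpha>) (S n))"
      using S by (intro emeasure_subadditive_countably) (auto simp: dA_wt_eq)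
    also have "\<dots> \<le> (\<Sum>n. ennreal (C1 * l powr (2 + \<alpha>) * q ^ n))"
      by (intro suminf_le bnd) auto
    also have "\<dots> = ennreal (C * l powr (2 + \<alpha>))"
    proof (rule suminf_ennreal_eq)
      show "0 \<le> C1 * l powr (2 + \<alpha>) * q ^ n" for n using c1 q by simp
      have "(\<lambda>n. C1 * l powr (2 + \<alpha>) * q ^ n) sums (C1 * l powr (2 + \<alpha>) * (1 / (1 - q)))"
        using q by (intro sums_mult geometric_sums) auto
      then show "(\<lambda>n. C1 * l powr (2 + \<alpha>) * q ^ n) sums (C * l powr (2 + \<alpha>))"
        by (simp add: C_def mult_ac)
    qed
    finally show "emeasure (dA_wt \<alpha>) (Q {a..<a + l}) \<le> ennreal (C * l powr (2 + \<alpha>))" .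
  qed
  then show ?thesis by (rule that[OF C])
qed

lemma average_wt_eq:
  assumes "-1 < \<alpha>" "weight \<sigma>" "S \<in> sets dA"
  shows "average_wt \<alpha> \<sigma> S
     = (\<integral>\<^sup>+z. ennreal (indicator S z * (bergman_density \<alpha> z * \<sigma> z)) \<partial>dA) / emeasure (dA_wt \<alpha>) S"
proof -
  have [measurable]: "\<sigma> \<in> borel_measurable dA" "S \<in> sets dA" using assms by (auto simp: weight_def)
  show ?thesis
    unfolding average_wt_def dA_wt_eq
    by (subst nn_integral_density)
       (auto intro!: arg_cong2[of _ _ _ _ "(/)"] nn_integral_cong
         simp: indicator_def ennreal_mult' bergman_density_nonneg[OF assms(1)])
qed

lemma weight_integral_pos:
  assumes "-1 < \<alpha>" "weight \<sigma>" "S \<in> sets dA" "0 < emeasure dA S"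
  shows "0 < (\<integral>\<^sup>+z. ennreal (indicator S z * (bergman_density \<alpha> z * \<sigma> z)) \<partial>dA)"
proof (rule ccontr)
  have [measurable]: "\<sigma> \<in> borel_measurable dA" "S \<in> sets dA" using assms by (auto simp: weight_def)
  assume "\<not> ?thesis"
  then have "(\<integral>\<^sup>+z. ennreal (indicator S z * (bergman_density \<alpha> z * \<sigma> z)) \<partial>dA) = 0" by simp
  then have "AE z in dA. ennreal (indicator S z * (bergman_density \<alpha> z * \<sigma> z)) = 0"
    by (subst (asm) nn_integral_0_iff_AE) auto
  then have "AE z in dA. z \<notin> S"
    using weight_density_pos[OF assms(1,2)] by eventually_elim (auto simp: indicator_def split: if_splits)
  then have "S \<in> null_sets dA" using assms(3) by (simp add: AE_iff_null_sets)
  with assms(4) show False by (auto simp: null_sets_def)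
qed

lemma dyadic_system_interval:
  assumes "dyadic_system \<D>" "I \<in> \<D>"
  obtains a k where "I = {a..<a + 2 powi k}" "len I = 2 powi k" "0 < len I"
proof -
  have "\<forall>I\<in>\<D>. \<exists>a. \<exists>k::int. I = {a..<a + 2 powi k}"
    using assms(1) unfolding dyadic_system_def by (rule conjunct1)
  with assms(2) obtain a and k :: int where I: "I = {a..<a + 2 powi k}" by blast
  then have "len I = 2 powi k" by (simp add: len_halfopen)
  then show ?thesis by (intro that[OF I]) simp_all
qed

lemma adjacent_systems_dyadic:
  assumes "adjacent_dyadic_systems \<D>1 \<D>2"
  shows "dyadic_system \<D>1" "dyadic_system \<D>2"
proof -
  note 1 = assms[unfolded adjacent_dyadic_systems_def]
  show "dyadic_system \<D>1" by (rule conjunct1[OF 1])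
  show "dyadic_system \<D>2" by (rule conjunct1[OF conjunct2[OF 1]])
qed

lemma adjacent_interval:
  assumes "adjacent_dyadic_systems \<D>1 \<D>2" "I \<in> \<D>1 \<union> \<D>2"
  obtains a l where "I = {a..<a + l}" "len I = l" "0 < l"
proof -
  obtain \<D> where "dyadic_system \<D>" "I \<in> \<D>"
    using assms(2) adjacent_systems_dyadic[OF assms(1)] by blast
  from dyadic_system_interval[OF this] obtain a k where "I = {a..<a + 2 powi k}" "len I = 2 powi k" "0 < len I" .
  then show ?thesis by (intro that[of a "2 powi k"]) auto
qed

text \<open>
  The condition on the averages in terms of real integrals. Neither average vanishes, so a finite
  product forces both to be finite, which gives local integrability of \<open>\<sigma>\<close> and \<open>1/\<sigma>\<close> up to the boundary.
\<close>

lemma B2_integral_bound: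
  assumes \<alpha>: "-1 < \<alpha>" and adj: "adjacent_dyadic_systems \<D>1 \<D>2" and \<sigma>: "\<sigma> \<in> B2 \<alpha> (\<D>1 \<union> \<D>2)"
  obtains A where "0 < A"
    "\<And>I. I \<in> \<D>1 \<union> \<D>2 \<Longrightarrow> set_integrable dA (Q I) (\<lambda>z. bergman_density \<alpha> z * \<sigma> z)"
    "\<And>I. I \<in> \<D>1 \<union> \<D>2 \<Longrightarrow> set_integrable dA (Q I) (\<lambda>z. bergman_density \<alpha> z * inverse (\<sigma> z))"
    "\<And>I. I \<in> \<D>1 \<union> \<D>2 \<Longrightarrow>
      (LINT z:Q I|dA. bergman_density \<alpha> z * \<sigma> z) * (LINT z:Q I|dA. bergman_density \<alpha> z * inverse (\<sigma> z))
        \<le> A * (len I powr (2 + \<alpha>))\<^sup>2"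
proof -
  have w: "weight \<sigma>" and w': "weight (\<lambda>z. inverse (\<sigma> z))"
    using \<sigma> weight_inverse by (auto simp: B2_def)
  obtain C where C: "0 < C" and eb:
    "\<And>a l. 0 < l \<Longrightarrow> 0 < emeasure (dA_wt \<alpha>) (Q {a..<a + l}) \<and>
       emeasure (dA_wt \<alpha>) (Q {a..<a + l}) \<le> ennreal (C * l powr (2 + \<alpha>))"
    using dA_wt_Q_bounds[OF \<alpha>] by blast
  define S where "S = (SUP I\<in>\<D>1 \<union> \<D>2. average_wt \<alpha> \<sigma> (Q I) * average_wt \<alpha> (\<lambda>z. inverse (\<sigma> z)) (Q I))"
  have S: "S < \<infinity>" using \<sigma> by (simp add: B2_def S_def)
  define s where "s = enn2real S"
  have Ss: "S = ennreal s" and s: "0 \<le> s" using S by (auto simp: s_def)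
  define A where "A = (s + 1) * C\<^sup>2"
  have main: "set_integrable dA (Q I) (\<lambda>z. bergman_density \<alpha> z * \<sigma> z) \<and>
    set_integrable dA (Q I) (\<lambda>z. bergman_density \<alpha> z * inverse (\<sigma> z)) \<and>
      (LINT z:Q I|dA. bergman_density \<alpha> z * \<sigma> z) * (LINT z:Q I|dA. bergman_density \<alpha> z * inverse (\<sigma> z))
        \<le> A * (len I powr (2 + \<alpha>))\<^sup>2" if I: "I \<in> \<D>1 \<union> \<D>2" for I
  proof -
    obtain a l where Il: "I = {a..<a + l}" "len I = l" "0 < l" using adjacent_interval[OF adj I] .
    have QI: "Q I \<in> sets dA" "emeasure dA (Q I) < \<infinity>" and mQ: "measure dA (Q I) = l\<^sup>2"
      unfolding Il(1) using Q_dA[OF Il(3)] Q_halfopen_lmeasurable(2)[OF Il(3)] by auto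
    have posQ: "0 < emeasure dA (Q I)"
      using mQ Il(3) by (simp add: measure_def enn2real_positive_iff)
    have [measurable]: "\<sigma> \<in> borel_measurable dA" "Q I \<in> sets dA" using w QI by (auto simp: weight_def)
    define e where "e = emeasure (dA_wt \<alpha>) (Q I)"
    define x where "x = (\<integral>\<^sup>+z. ennreal (indicator (Q I) z * (bergman_density \<alpha> z * \<sigma> z)) \<partial>dA)"
    define y where "y = (\<integral>\<^sup>+z. ennreal (indicator (Q I) z * (bergman_density \<alpha> z * inverse (\<sigma> z))) \<partial>dA)"
    have e: "0 < e" "e \<le> ennreal (C * l powr (2 + \<alpha>))" unfolding e_def using eb[OF Il(3), of a] Il by auto
    have et: "e < top" using e(2) by (rule order.strict_trans1) simp
    define r where "r = enn2real e"
    have er: "e = ennreal r" and r: "0 < r" "r \<le> C * l powr (2 + \<alpha>)"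
      using e et C by (auto simp: r_def enn2real_positive_iff enn2real_leI)
    have xy: "0 < x" "0 < y"
      unfolding x_def y_def by (intro weight_integral_pos \<alpha> w w' QI posQ)+
    have prod: "x / e * (y / e) \<le> S"
      unfolding S_def x_def y_def e_def average_wt_eq[OF \<alpha> w QI(1), symmetric] average_wt_eq[OF \<alpha> w' QI(1), symmetric]
      by (rule SUP_upper[OF I])
    have xe: "0 < x / e" "0 < y / e" using xy et by (auto simp: ennreal_zero_less_divide)
    have xt: "x < top"
    proof (rule ccontr)
      assume "\<not> x < top"
      then have "x / e = top" using et by (simp add: less_top[symmetric] ennreal_top_divide)
      then have "x / e * (y / e) = top" using xe by (simp add: ennreal_top_mult less_imp_neq[symmetric] del: divide_ennreal_def ennreal_divide_eq_0_iff)
      with prod S show False by simp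
    qed
    have yt: "y < top"
    proof (rule ccontr)
      assume "\<not> y < top"
      then have "y / e = top" using et by (simp add: less_top[symmetric] ennreal_top_divide)
      then have "x / e * (y / e) = top" using xe by (simp add: ennreal_mult_top less_imp_neq[symmetric] del: divide_ennreal_def ennreal_divide_eq_0_iff)
      with prod S show False by simp
    qed
    have nn: "AE z in dA. 0 \<le> indicator (Q I) z * (bergman_density \<alpha> z * \<sigma> z)"
      using weight_density_pos[OF \<alpha> w] by eventually_elim (auto simp: indicator_def)
    have nn': "AE z in dA. 0 \<le> indicator (Q I) z * (bergman_density \<alpha> z * inverse (\<sigma> z))"
      using weight_density_pos[OF \<alpha> w'] by eventually_elim (auto simp: indicator_def)
    have i1: "integrable dA (\<lambda>z. indicator (Q I) z * (bergman_density \<alpha> z * \<sigma> z))"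
      using xt nn by (intro integrableI_nonneg) (auto simp: x_def)
    have i2: "integrable dA (\<lambda>z. indicator (Q I) z * (bergman_density \<alpha> z * inverse (\<sigma> z)))"
      using yt nn' by (intro integrableI_nonneg) (auto simp: y_def)
    define X where "X = (LINT z:Q I|dA. bergman_density \<alpha> z * \<sigma> z)"
    define Y where "Y = (LINT z:Q I|dA. bergman_density \<alpha> z * inverse (\<sigma> z))"
    have xX: "x = ennreal X" "0 \<le> X"
      unfolding x_def X_def set_lebesgue_integral_def using nn_integral_eq_integral[OF i1 nn] nn
      by (auto intro!: integral_nonneg_AE)
    have yY: "y = ennreal Y" "0 \<le> Y"
      unfolding y_def Y_def set_lebesgue_integral_def using nn_integral_eq_integral[OF i2 nn'] nn'
      by (auto intro!: integral_nonneg_AE)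
    have "ennreal (X / r * (Y / r)) \<le> ennreal s"
      using prod xX yY r unfolding er Ss by (simp add: divide_ennreal ennreal_mult[symmetric])
    then have "X / r * (Y / r) \<le> s" using s by simp
    then have "X * Y \<le> s * r\<^sup>2" using r by (simp add: field_simps power2_eq_square)
    also have "\<dots> \<le> (s + 1) * (C * l powr (2 + \<alpha>))\<^sup>2"
      using r s by (intro mult_mono power_mono) auto
    finally have "X * Y \<le> A * (l powr (2 + \<alpha>))\<^sup>2" by (simp add: A_def power_mult_distrib mult_ac)
    then show ?thesis
      using i1 i2 by (simp add: X_def Y_def set_integrable_def Il(2))
  qed
  have "0 < A" using s C by (simp add: A_def)
  then show ?thesis using main by (intro that[of A]) auto
qed


section \<open>The commutator as an integral operator\<close>

definition bergman_kernel :: "real \<Rightarrow> complex \<Rightarrow> complex \<Rightarrow> complex" where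
  "bergman_kernel \<alpha> z w = 1 / (z - cnj w) powr complex_of_real (2 + \<alpha>)"

lemma Im_diff_cnj_pos: "z \<in> uhp \<Longrightarrow> w \<in> uhp \<Longrightarrow> 0 < Im (z - cnj w)"
  by (simp add: uhp_def)

lemma norm_bergman_kernel:
  "norm (bergman_kernel \<alpha> z w) = norm (z - cnj w) powr (- (2 + \<alpha>))"
  unfolding powr_minus_divide by (simp add: bergman_kernel_def norm_divide norm_powr_real_powr')

lemma continuous_on_bergman_kernel:
  assumes z: "z \<in> uhp"
  shows "continuous_on uhp (bergman_kernel \<alpha> z)"
proof -
  have "Im (z - cnj w) \<noteq> 0" "z - cnj w \<noteq> 0" if "w \<in> uhp" for w
    using Im_diff_cnj_pos[OF z that] by auto
  then show ?thesis
    unfolding bergman_kernel_def by (intro continuous_intros) auto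
qed

text \<open>
  A test function vanishes off a compact subset of the open half-plane, where \<open>\<phi>\<close> is bounded.
\<close>

lemma test_function_integrable:
  assumes f: "f \<in> test_functions" and \<phi>: "continuous_on uhp \<phi>"
    and g: "g \<in> borel_measurable dA"
      "\<And>S. S \<in> sets dA \<Longrightarrow> emeasure dA S < \<infinity> \<Longrightarrow> set_integrable dA S g"
  shows "integrable dA (\<lambda>w. g w * f w * \<phi> w :: complex)"
proof -
  obtain B K where B: "\<And>z. z \<in> uhp \<Longrightarrow> norm (f z) \<le> B" and K: "compact K" "K \<subseteq> uhp"
    and f0: "\<And>z. z \<in> uhp - K \<Longrightarrow> f z = 0" and [measurable]: "f \<in> borel_measurable dA"
    using f unfolding test_functions_def by blast
  have [measurable]: "\<phi> \<in> borel_measurable dA" "g \<in> borel_measurable dA"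
    using \<phi> g continuous_on_imp_measurable_dA by auto
  have "bounded (\<phi> ` K)"
    using K \<phi> by (intro compact_imp_bounded compact_continuous_image continuous_on_subset[OF \<phi>])
  then obtain M where M: "\<And>z. z \<in> K \<Longrightarrow> norm (\<phi> z) \<le> M"
    by (auto simp: bounded_iff)
  note KdA = dA_finite_of_lmeasurable[OF lmeasurable_compact[OF K(1)] K(2)]
  have [measurable]: "K \<in> sets dA" by (rule KdA)
  have "set_integrable dA K g" using g(2) KdA by blast
  then have i: "integrable dA (\<lambda>w. (\<bar>B\<bar> * \<bar>M\<bar>) *\<^sub>R (indicator K w *\<^sub>R g w))"
    unfolding set_integrable_def by (rule integrable_scaleR_right)
  show ?thesis
  proof (rule Bochner_Integration.integrable_bound[OF i])
    show "(\<lambda>w. g w * f w * \<phi> w) \<in> borel_measurable dA" by measurable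
    show "AE w in dA. norm (g w * f w * \<phi> w) \<le> norm ((\<bar>B\<bar> * \<bar>M\<bar>) *\<^sub>R (indicator K w *\<^sub>R g w))"
    proof (rule AE_I2)
      fix w assume w: "w \<in> space dA"
      show "norm (g w * f w * \<phi> w) \<le> norm ((\<bar>B\<bar> * \<bar>M\<bar>) *\<^sub>R (indicator K w *\<^sub>R g w))"
      proof (cases "w \<in> K")
        case True
        have "norm (f w) * norm (\<phi> w) \<le> \<bar>B\<bar> * \<bar>M\<bar>"
          using B[of w] M[OF True] w by (intro mult_mono) auto
        then have "norm (g w) * (norm (f w) * norm (\<phi> w)) \<le> norm (g w) * (\<bar>B\<bar> * \<bar>M\<bar>)"
          by (intro mult_left_mono) auto
        then show ?thesis using True by (simp add: norm_mult mult_ac)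
      next
        case False
        then have "f w = 0" using f0 w by simp
        then show ?thesis by simp
      qed
    qed
  qed
qed

lemma commutator_formula:
  assumes \<alpha>: "-1 < \<alpha>" and b: "b \<in> L2 dA" and f: "f \<in> test_functions" and z: "z \<in> uhp"
  shows "integrable dA (\<lambda>w. (b z - b w) * f w * (of_real (bergman_density \<alpha> w) * bergman_kernel \<alpha> z w))"
    and "norm (commutator \<alpha> b f z) =
      norm (LINT w|dA. (b z - b w) * f w * (of_real (bergman_density \<alpha> w) * bergman_kernel \<alpha> z w))"
proof -
  define \<phi> where "\<phi> w = of_real (bergman_density \<alpha> w) * bergman_kernel \<alpha> z w" for w
  have \<phi>: "continuous_on uhp \<phi>"
    unfolding \<phi>_def by (intro continuous_intros continuous_on_bergman_density continuous_on_bergman_kernel z)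
  have [measurable]: "b \<in> borel_measurable dA" "f \<in> borel_measurable dA"
    using b f by (auto simp: L2_def test_functions_def)
  have [measurable]: "bergman_kernel \<alpha> z \<in> borel_measurable dA"
    by (intro continuous_on_imp_measurable_dA continuous_on_bergman_kernel z)
  have i1: "integrable dA (\<lambda>w. 1 * f w * \<phi> w)"
    by (intro test_function_integrable f \<phi> set_integrable_const_dA) auto
  have i2: "integrable dA (\<lambda>w. b w * f w * \<phi> w)"
    by (intro test_function_integrable f \<phi> L2_set_integrable b) auto
  have eq: "(b z - b w) * f w * \<phi> w = b z * (1 * f w * \<phi> w) - b w * f w * \<phi> w" for w
    by (simp add: algebra_simps)
  show "integrable dA (\<lambda>w. (b z - b w) * f w * (of_real (bergman_density \<alpha> w) * bergman_kernel \<alpha> z w))"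
    unfolding \<phi>_def[symmetric] eq by (intro Bochner_Integration.integrable_diff integrable_mult_right i1 i2)
  have B: "bergman \<alpha> h z = \<i> powr complex_of_real (2 + \<alpha>) * (LINT w|dA. h w * \<phi> w)"
    if [measurable]: "h \<in> borel_measurable dA" for h
  proof -
    have "(LINT w|dA_wt \<alpha>. h w / (z - cnj w) powr complex_of_real (2 + \<alpha>))
        = (LINT w|dA_wt \<alpha>. h w * bergman_kernel \<alpha> z w)"
      by (simp add: bergman_kernel_def)
    also have "\<dots> = (LINT w|dA. bergman_density \<alpha> w *\<^sub>R (h w * bergman_kernel \<alpha> z w))"
      unfolding dA_wt_eq using bergman_density_nonneg[OF \<alpha>] by (subst integral_density) auto
    also have "\<dots> = (LINT w|dA. h w * \<phi> w)"
      by (intro Bochner_Integration.integral_cong) (auto simp: \<phi>_def scaleR_conv_of_real mult_ac)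
    finally show ?thesis by (simp add: bergman_def)
  qed
  have ni: "norm (\<i> powr complex_of_real (2 + \<alpha>)) = 1"
    by (simp add: norm_powr_real_powr')
  have "commutator \<alpha> b f z = \<i> powr complex_of_real (2 + \<alpha>) *
     (b z * (LINT w|dA. 1 * f w * \<phi> w) - (LINT w|dA. b w * f w * \<phi> w))"
    by (simp add: commutator_def B algebra_simps)
  also have "b z * (LINT w|dA. 1 * f w * \<phi> w) - (LINT w|dA. b w * f w * \<phi> w)
     = (LINT w|dA. (b z - b w) * f w * \<phi> w)"
    unfolding eq using i1 i2 by (subst Bochner_Integration.integral_diff) auto
  finally have "norm (commutator \<alpha> b f z)
      = norm (\<i> powr complex_of_real (2 + \<alpha>)) * norm (LINT w|dA. (b z - b w) * f w * \<phi> w)"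
    by (simp only: norm_mult)
  then show "norm (commutator \<alpha> b f z) =
      norm (LINT w|dA. (b z - b w) * f w * (of_real (bergman_density \<alpha> w) * bergman_kernel \<alpha> z w))"
    unfolding ni \<phi>_def by simp
qed

text \<open>
  If \<open>\<zeta>0\<close> is large compared with the difference, \<open>\<zeta> / \<zeta>0\<close> is close to \<open>1\<close>. The principal branch is
  multiplicative here because both arguments lie between \<open>0\<close> and \<open>\<pi>\<close>.
\<close>

lemma kernel_almost_constant:
  fixes s \<epsilon> :: real
  assumes \<epsilon>: "0 < \<epsilon>"
  obtains N :: real where "1 \<le> N"
    "\<And>l \<zeta> \<zeta>0. 0 < l \<Longrightarrow> 0 < Im \<zeta> \<Longrightarrow> 0 < Im \<zeta>0 \<Longrightarrow> norm (\<zeta> - \<zeta>0) \<le> 2 * l \<Longrightarrow> N * l \<le> norm \<zeta>0 \<Longrightarrow>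
       norm (1 / \<zeta> powr of_real s - 1 / \<zeta>0 powr of_real s) \<le> \<epsilon> * norm (1 / \<zeta>0 powr complex_of_real s)"
proof -
  have "isCont (\<lambda>u::complex. u powr of_real (- s)) 1"
    by (intro continuous_intros) auto
  then obtain \<delta> where \<delta>: "0 < \<delta>"
    and near: "\<And>u::complex. dist u 1 < \<delta> \<Longrightarrow> dist (u powr of_real (- s)) (1 powr of_real (- s)) < \<epsilon>"
    unfolding continuous_at_eps_delta using \<epsilon> by blast
  define N where "N = max 1 (4 / \<delta>)"
  have N: "1 \<le> N" "4 / \<delta> \<le> N" by (auto simp: N_def)
  have "norm (1 / \<zeta> powr of_real s - 1 / \<zeta>0 powr of_real s) \<le> \<epsilon> * norm (1 / \<zeta>0 powr complex_of_real s)"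
    if l: "0 < l" and im: "0 < Im \<zeta>" "0 < Im \<zeta>0" and d: "norm (\<zeta> - \<zeta>0) \<le> 2 * l" and n: "N * l \<le> norm \<zeta>0"
    for l \<zeta> \<zeta>0
  proof -
    have nz: "\<zeta> \<noteq> 0" "\<zeta>0 \<noteq> 0" using im by auto
    define u where "u = \<zeta> / \<zeta>0"
    have u0: "u \<noteq> 0" using nz by (simp add: u_def)
    have "norm (u - 1) = norm (\<zeta> - \<zeta>0) / norm \<zeta>0"
      using nz by (simp add: u_def diff_divide_distrib flip: norm_divide)
    also have "\<dots> \<le> 2 * l / (N * l)"
      using d n N l nz by (intro frac_le) auto
    also have "\<dots> = 2 / N" using l by simp
    also have "\<dots> < \<delta>" using N \<delta> by (simp add: field_simps)
    finally have du: "dist u 1 < \<delta>" by (simp add: dist_norm)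
    have "Ln u = Ln \<zeta> - Ln \<zeta>0"
    proof (rule Ln_unique)
      show "exp (Ln \<zeta> - Ln \<zeta>0) = u" using nz by (simp add: exp_diff u_def)
      have "0 < Im (Ln \<zeta>)" "Im (Ln \<zeta>) < pi" "0 < Im (Ln \<zeta>0)" "Im (Ln \<zeta>0) < pi"
        using Im_Ln_pos_lt[OF nz(1)] Im_Ln_pos_lt[OF nz(2)] im by auto
      then show "- pi < Im (Ln \<zeta> - Ln \<zeta>0)" "Im (Ln \<zeta> - Ln \<zeta>0) \<le> pi" by auto
    qed
    then have Lz: "Ln \<zeta> = Ln \<zeta>0 + Ln u" by simp
    have pw: "\<zeta> powr of_real (- s) = \<zeta>0 powr of_real (- s) * u powr of_real (- s)"
      using nz u0 by (simp add: powr_def Lz distrib_left flip: exp_add)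
    have inv: "1 / x powr of_real s = x powr of_real (- s)" for x :: complex
      by (simp add: powr_minus field_simps)
    have "norm (1 / \<zeta> powr of_real s - 1 / \<zeta>0 powr of_real s)
        = norm (\<zeta>0 powr of_real (- s)) * norm (u powr of_real (- s) - 1)"
      unfolding inv pw by (simp add: algebra_simps flip: norm_mult)
    also have "\<dots> \<le> norm (\<zeta>0 powr of_real (- s)) * \<epsilon>"
      using near[OF du] by (intro mult_left_mono) (auto simp: dist_norm)
    finally show ?thesis unfolding inv by (simp add: mult.commute)
  qed
  with N(1) show ?thesis by (rule that)
qed

section \<open>Two distant Whitney boxes\<close>

text \<open>
  Dividing by the density turns integrals against \<open>dA\<^sub>\<alpha>\<close> into integrals against Lebesgue measure.
\<close>

definition box_test :: "real \<Rightarrow> complex set \<Rightarrow> complex \<Rightarrow> complex" where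
  "box_test \<alpha> E w = of_real (indicator E w / bergman_density \<alpha> w)"

lemma box_test_in_test_functions:
  assumes \<alpha>: "-1 < \<alpha>" and c: "0 < c"
  shows "box_test \<alpha> (rect a b c d) \<in> test_functions"
proof -
  define K where "K = cbox (Complex a c) (Complex b d)"
  have K: "compact K" "K \<subseteq> uhp" "rect a b c d \<subseteq> K"
    using c by (auto simp: K_def in_cbox_complex_iff uhp_def rect_def)
  have cont: "continuous_on K (\<lambda>w. 1 / bergman_density \<alpha> w)"
    using K bergman_density_pos[OF \<alpha>]
    by (intro continuous_intros continuous_on_subset[OF continuous_on_bergman_density]) force+
  then have "bounded ((\<lambda>w. 1 / bergman_density \<alpha> w) ` K)"
    using K by (intro compact_imp_bounded compact_continuous_image)
  then obtain B where B: "\<And>w. w \<in> K \<Longrightarrow> norm (1 / bergman_density \<alpha> w) \<le> B"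
    unfolding bounded_iff by blast
  have "norm (box_test \<alpha> (rect a b c d) w) \<le> \<bar>B\<bar>" for w
    using B[of w] K(3) by (cases "w \<in> rect a b c d") (auto simp: box_test_def norm_divide)
  moreover have "\<forall>w\<in>uhp - K. box_test \<alpha> (rect a b c d) w = 0"
    using K(3) by (auto simp: box_test_def indicator_def)
  moreover have "box_test \<alpha> (rect a b c d) \<in> borel_measurable dA"
  proof -
    have [measurable]: "rect a b c d \<in> sets dA" using c by (intro rect_dA)
    show ?thesis unfolding box_test_def by measurable
  qed
  ultimately show ?thesis unfolding test_functions_def using K by blast
qed

text \<open>
  With the kernel replaced by \<open>\<kappa>\<close>, the integral of \<open>(b z - b w) \<kappa>\<close> over \<open>E\<close> is
  \<open>m \<kappa> (b z - average b E)\<close>. The last term accounts for the replacement.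
\<close>

lemma commutator_box_test:
  assumes \<alpha>: "-1 < \<alpha>" and b: "b \<in> L2 dA" and c: "0 < c" and z: "z \<in> uhp"
    and E: "E = rect a a' c d" and m: "m = measure dA E" "0 < m"
    and near: "\<And>w. w \<in> E \<Longrightarrow> norm (bergman_kernel \<alpha> z w - \<kappa>) \<le> \<epsilon> * norm \<kappa>"
  shows "m * norm \<kappa> * norm (b z - average b E)
     \<le> norm (commutator \<alpha> b (box_test \<alpha> E) z) + \<epsilon> * norm \<kappa> * (LINT w:E|dA. norm (b z - b w))"
proof -
  have EdA: "E \<in> sets dA" "emeasure dA E < \<infinity>" unfolding E using rect_dA[OF c] by auto
  have [measurable]: "E \<in> sets dA" by (rule EdA)
  have Eu: "w \<in> uhp" if "w \<in> E" for w using that rect_subset_uhp[OF c] E by blast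
  have ib: "set_integrable dA E b" by (rule L2_set_integrable[OF b EdA])
  have ic: "set_integrable dA E (\<lambda>w. c)" for c :: complex by (rule set_integrable_const_dA[OF EdA])
  have id: "set_integrable dA E (\<lambda>w. b z - b w)" by (intro set_integral_diff ib ic)
  have eq: "(b z - b w) * box_test \<alpha> E w * (of_real (bergman_density \<alpha> w) * bergman_kernel \<alpha> z w)
     = indicator E w *\<^sub>R ((b z - b w) * bergman_kernel \<alpha> z w)" for w
  proof (cases "w \<in> E")
    case True
    then show ?thesis using bergman_density_pos[OF \<alpha> Eu[OF True]] by (simp add: box_test_def)
  qed (simp add: box_test_def)
  note cf = commutator_formula[OF \<alpha> b box_test_in_test_functions[OF \<alpha> c, of a a' d, folded E] z, unfolded eq]
  have ik: "set_integrable dA E (\<lambda>w. (b z - b w) * bergman_kernel \<alpha> z w)"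
    unfolding set_integrable_def by (rule cf)
  have ik': "set_integrable dA E (\<lambda>w. (b z - b w) * \<kappa>)" by (intro set_integrable_mult_left id)
  have "(LINT w:E|dA. b z - b w) = m *\<^sub>R b z - (LINT w:E|dA. b w)"
    using set_integral_diff(2)[OF ic ib] EdA
    by (simp add: set_lebesgue_integral_def m sets_dA_iff Int_absorb2)
  also have "\<dots> = m *\<^sub>R (b z - average b E)"
    using m by (simp add: average_def scaleR_diff_right)
  finally have "(LINT w:E|dA. (b z - b w) * \<kappa>) = m *\<^sub>R (b z - average b E) * \<kappa>"
    by (simp only: set_integral_mult_left)
  then have "m * norm \<kappa> * norm (b z - average b E) = norm (LINT w:E|dA. (b z - b w) * \<kappa>)"
    using m by (simp add: norm_mult mult_ac)
  also have "(LINT w:E|dA. (b z - b w) * \<kappa>) = (LINT w:E|dA. (b z - b w) * bergman_kernel \<alpha> z w)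
      - (LINT w:E|dA. (b z - b w) * bergman_kernel \<alpha> z w - (b z - b w) * \<kappa>)"
    by (simp add: set_integral_diff(2)[OF ik ik'])
  also have "norm \<dots> \<le> norm (LINT w:E|dA. (b z - b w) * bergman_kernel \<alpha> z w)
      + norm (LINT w:E|dA. (b z - b w) * bergman_kernel \<alpha> z w - (b z - b w) * \<kappa>)"
    by (rule norm_triangle_ineq4)
  also have "norm (LINT w:E|dA. (b z - b w) * bergman_kernel \<alpha> z w) = norm (commutator \<alpha> b (box_test \<alpha> E) z)"
    using cf(2) by (simp add: set_lebesgue_integral_def)
  also have "norm (LINT w:E|dA. (b z - b w) * bergman_kernel \<alpha> z w - (b z - b w) * \<kappa>)
      \<le> (LINT w:E|dA. norm ((b z - b w) * bergman_kernel \<alpha> z w - (b z - b w) * \<kappa>))"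
    by (intro set_integral_norm_bound set_integral_diff ik ik')
  also have "\<dots> \<le> (LINT w:E|dA. \<epsilon> * norm \<kappa> * norm (b z - b w))"
  proof (rule set_integral_mono)
    show "set_integrable dA E (\<lambda>w. norm ((b z - b w) * bergman_kernel \<alpha> z w - (b z - b w) * \<kappa>))"
      by (intro set_integrable_norm set_integral_diff ik ik')
    show "set_integrable dA E (\<lambda>w. \<epsilon> * norm \<kappa> * norm (b z - b w))"
      by (intro set_integrable_mult_right set_integrable_norm id)
    fix w assume "w \<in> E"
    have "norm ((b z - b w) * bergman_kernel \<alpha> z w - (b z - b w) * \<kappa>)
       = norm (b z - b w) * norm (bergman_kernel \<alpha> z w - \<kappa>)"
      by (simp add: right_diff_distrib flip: norm_mult)
    also have "\<dots> \<le> norm (b z - b w) * (\<epsilon> * norm \<kappa>)"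
      by (intro mult_left_mono near \<open>w \<in> E\<close>) auto
    finally show "norm ((b z - b w) * bergman_kernel \<alpha> z w - (b z - b w) * \<kappa>) \<le> \<epsilon> * norm \<kappa> * norm (b z - b w)"
      by (simp add: mult_ac)
  qed
  also have "\<dots> = \<epsilon> * norm \<kappa> * (LINT w:E|dA. norm (b z - b w))" by simp
  finally show ?thesis by simp
qed

text \<open>
  Integrating the two pointwise bounds gives \<open>U \<le> 2 \<tau> m + V / 4\<close> and \<open>V \<le> 2 \<tau> m + U / 4\<close> for the
  integrals \<open>U\<close>, \<open>V\<close> of \<open>u\<close>, \<open>v\<close>. These are finite, hence \<open>V \<le> 8/3 \<tau> m\<close>, and the bound for \<open>u\<close> no longer
  involves \<open>v\<close>.
\<close>

lemma mutual_absorption: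
  fixes u v t t' :: "complex \<Rightarrow> real"
  assumes E: "E \<in> sets dA" "emeasure dA E < \<infinity>" "measure dA E = m"
    and E': "E' \<in> sets dA" "emeasure dA E' < \<infinity>" "measure dA E' = m"
    and m: "0 < m" and p: "p = 1 \<or> p = (2::nat)" and \<tau>: "0 \<le> \<tau>"
    and nn: "\<And>z. 0 \<le> u z" "\<And>z. 0 \<le> v z" "\<And>z. 0 \<le> t z" "\<And>z. 0 \<le> t' z"
    and u: "set_integrable dA E u" "set_integrable dA E (\<lambda>z. u z ^ p)" and v: "set_integrable dA E' v"
    and t: "t \<in> borel_measurable dA" "set_integrable dA E (\<lambda>z. t z ^ p)" "(LINT z:E|dA. t z ^ p) \<le> \<tau> ^ p * m"
    and t': "t' \<in> borel_measurable dA" "set_integrable dA E' (\<lambda>z. t' z ^ p)" "(LINT z:E'|dA. t' z ^ p) \<le> \<tau> ^ p * m"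
    and ut: "AE z\<in>E in dA. u z \<le> 2 * t z + (LINT w:E'|dA. v w) / (4 * m)"
    and vt: "AE z\<in>E' in dA. v z \<le> 2 * t' z + (LINT w:E|dA. u w) / (4 * m)"
  shows "(LINT z:E|dA. u z ^ p) \<le> 12 * \<tau> ^ p * m"
proof -
  have first: "set_integrable dA F r" "(LINT z:F|dA. r z) \<le> \<tau> * m"
    if F: "F \<in> sets dA" "emeasure dA F < \<infinity>" "measure dA F = m" and r0: "\<And>z. 0 \<le> r z"
      and rm: "r \<in> borel_measurable dA"
      and r: "set_integrable dA F (\<lambda>z. r z ^ p)" "(LINT z:F|dA. r z ^ p) \<le> \<tau> ^ p * m" for F r
  proof -
    have [measurable]: "r \<in> borel_measurable dA" "F \<in> sets dA" by fact+
    have c1: "set_integrable dA F (\<lambda>z. 1 :: real)" by (rule set_integrable_const_dA[OF F(1,2)])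
    have "set_integrable dA F r \<and> (LINT z:F|dA. r z) \<le> \<tau> * m"
    proof (cases "p = 1")
      case True
      then show ?thesis using r by simp
    next
      case False
      then have p2: "p = 2" using p by simp
      have CS: "set_integrable dA F (\<lambda>z. r z * 1)"
        "(LINT z:F|dA. r z * 1)\<^sup>2 \<le> (LINT z:F|dA. (r z)\<^sup>2) * (LINT z:F|dA. 1\<^sup>2)"
        using r(1) c1 unfolding p2
        by (intro Cauchy_Schwarz_set_integral F; simp add: set_borel_measurable_def)+
      have "(LINT z:F|dA. r z)\<^sup>2 \<le> (LINT z:F|dA. (r z)\<^sup>2) * m"
        using CS(2) F set_integral_const_dA[OF F(1,2), of 1] by simp
      also have "\<dots> \<le> (\<tau>\<^sup>2 * m) * m"
        using r(2) m unfolding p2 by (intro mult_right_mono) auto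
      also have "\<dots> = (\<tau> * m)\<^sup>2" by (simp add: power2_eq_square)
      finally have "(LINT z:F|dA. r z) \<le> \<tau> * m"
        by (rule power2_le_imp_le) (use \<tau> m in simp)
      with CS(1) show ?thesis by simp
    qed
    then show "set_integrable dA F r" "(LINT z:F|dA. r z) \<le> \<tau> * m" by auto
  qed
  note T = first[OF E nn(3) t] and T' = first[OF E' nn(4) t']
  define U where "U = (LINT z:E|dA. u z)"
  define V where "V = (LINT z:E'|dA. v z)"
  have c: "set_integrable dA E (\<lambda>z. c)" "set_integrable dA E' (\<lambda>z. c)" for c :: real
    using E E' by (auto intro: set_integrable_const_dA)
  have "U \<le> (LINT z:E|dA. 2 * t z + V / (4 * m))"
    unfolding U_def using ut T by (intro set_integral_mono_AE u set_integral_add set_integrable_mult_right c) (auto simp: V_def)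
  also have "\<dots> = 2 * (LINT z:E|dA. t z) + m * (V / (4 * m))"
    using T by (subst set_integral_add(2)) (auto intro!: set_integrable_mult_right c simp: set_integral_const_dA[OF E(1,2)] E(3))
  also have "\<dots> \<le> 2 * \<tau> * m + V / 4" using T m by simp
  finally have U: "U \<le> 2 * \<tau> * m + V / 4" .
  have "V \<le> (LINT z:E'|dA. 2 * t' z + U / (4 * m))"
    unfolding V_def using vt T' by (intro set_integral_mono_AE v set_integral_add set_integrable_mult_right c) (auto simp: U_def)
  also have "\<dots> = 2 * (LINT z:E'|dA. t' z) + m * (U / (4 * m))"
    using T' by (subst set_integral_add(2)) (auto intro!: set_integrable_mult_right c simp: set_integral_const_dA[OF E'(1,2)] E'(3))
  also have "\<dots> \<le> 2 * \<tau> * m + U / 4" using T' m by simp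
  finally have "V \<le> 8 / 3 * (\<tau> * m)" using U by simp
  then have V: "V / (4 * m) \<le> 2 / 3 * \<tau>" using m by (simp add: field_simps)
  have pw: "x ^ p \<le> 6 * y ^ p + 2 * \<tau> ^ p" if x: "0 \<le> x" "0 \<le> y" "x \<le> 2 * y + 2 / 3 * \<tau>" for x y :: real
  proof -
    have "x ^ p \<le> (2 * y + 2 / 3 * \<tau>) ^ p" using x by (intro power_mono)
    also have "\<dots> \<le> 3 / 2 * (2 * y) ^ p + 3 * (2 / 3 * \<tau>) ^ p"
      using x \<tau> by (intro power_add_le_one_or_two p) auto
    also have "\<dots> \<le> 6 * y ^ p + 2 * \<tau> ^ p"
      using p x \<tau> by (auto simp: power_mult_distrib power_divide)
    finally show ?thesis .
  qed
  have "(LINT z:E|dA. u z ^ p) \<le> (LINT z:E|dA. 6 * t z ^ p + 2 * \<tau> ^ p)"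
  proof (rule set_integral_mono_AE)
    show "AE z\<in>E in dA. u z ^ p \<le> 6 * t z ^ p + 2 * \<tau> ^ p"
      using ut by eventually_elim (use V nn in \<open>auto intro!: pw simp: V_def\<close>)
  qed (auto intro!: set_integral_add set_integrable_mult_right u t c)
  also have "\<dots> = 6 * (LINT z:E|dA. t z ^ p) + m * (2 * \<tau> ^ p)"
    using t by (subst set_integral_add(2)) (auto intro!: set_integrable_mult_right c simp: set_integral_const_dA[OF E(1,2)] E(3))
  also have "\<dots> \<le> 8 * (\<tau> ^ p * m)" using t(3) by (simp add: mult.commute[of m])
  also have "\<dots> \<le> 12 * (\<tau> ^ p * m)" using \<tau> m by (intro mult_right_mono) auto
  finally show ?thesis by simp
qed


text \<open>
  The pointwise inequality to be absorbed. The tolerance \<open>1 / 32\<close> leaves room for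
  the constant \<open>9 / 2\<close> that exchanges the average over \<open>E'\<close> for the one over \<open>E\<close>.
\<close>

lemma far_box_pair:
  assumes \<alpha>: "-1 < \<alpha>" and N: "1 \<le> N"
    and K: "\<forall>l \<zeta> \<zeta>0. 0 < l \<longrightarrow> 0 < Im \<zeta> \<longrightarrow> 0 < Im \<zeta>0 \<longrightarrow> norm (\<zeta> - \<zeta>0) \<le> 2 * l \<longrightarrow> N * l \<le> norm \<zeta>0 \<longrightarrow>
       norm (1 / \<zeta> powr of_real (2 + \<alpha>) - 1 / \<zeta>0 powr of_real (2 + \<alpha>))
         \<le> 1 / 32 * norm (1 / \<zeta>0 powr complex_of_real (2 + \<alpha>))"
    and b: "b \<in> L2 dA" and l: "0 < l" and a: "\<bar>a - a'\<bar> = N * l"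
  defines "E \<equiv> whitney a l" and "E' \<equiv> whitney a' l"
  defines "m \<equiv> 3 / 4 * l\<^sup>2"
  assumes z: "z \<in> E"
  shows "norm (b z - average b E')
     \<le> 2 * ((4 / 3) * sqrt (N\<^sup>2 + 1) powr (2 + \<alpha>) * l powr \<alpha> * norm (commutator \<alpha> b (box_test \<alpha> E') z))
       + (LINT w:E'|dA. norm (b w - average b E)) / (4 * m)"
proof -
  have l4: "0 < l / 4" using l by simp
  have E': "E' \<in> sets dA" "emeasure dA E' < \<infinity>" "measure dA E' = m"
    unfolding E'_def m_def using l rect_dA[OF l4] by (auto simp: measure_rect power2_eq_square)
  have m: "0 < m" using l by (simp add: m_def)
  have zu: "z \<in> uhp" using z rect_subset_uhp[OF l4] by (auto simp: E_def)
  \<comment> \<open>A representative value of \<open>z - cnj w\<close> on \<open>E \<times> E'\<close>. Its modulus is the same if the boxes are exchanged.\<close>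
  define \<zeta>0 where "\<zeta>0 = Complex (a - a') l"
  have n\<zeta>0: "norm \<zeta>0 = l * sqrt (N\<^sup>2 + 1)"
  proof -
    have "(a - a')\<^sup>2 = (N * l)\<^sup>2" using a by (metis power2_abs)
    then have "norm \<zeta>0 = sqrt (l\<^sup>2 * (N\<^sup>2 + 1))"
      by (simp add: \<zeta>0_def cmod_def power_mult_distrib algebra_simps)
    then show ?thesis using l by (simp add: real_sqrt_mult)
  qed
  have "N \<le> sqrt (N\<^sup>2 + 1)" by (rule real_le_rsqrt) simp
  then have big: "N * l \<le> norm \<zeta>0" unfolding n\<zeta>0 using l by (simp add: mult.commute)
  define \<kappa> where "\<kappa> = 1 / \<zeta>0 powr complex_of_real (2 + \<alpha>)"
  have n\<kappa>: "norm \<kappa> = (l * sqrt (N\<^sup>2 + 1)) powr - (2 + \<alpha>)"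
    unfolding \<kappa>_def powr_minus_divide by (simp add: norm_divide norm_powr_real_powr' n\<zeta>0)
  have near: "norm (bergman_kernel \<alpha> z w - \<kappa>) \<le> 1 / 32 * norm \<kappa>" if w: "w \<in> E'" for w
    unfolding bergman_kernel_def \<kappa>_def
  proof (rule K[rule_format, OF l])
    have wu: "w \<in> uhp" using w rect_subset_uhp[OF l4] by (auto simp: E'_def)
    show "0 < Im (z - cnj w)" by (rule Im_diff_cnj_pos[OF zu wu])
    show "0 < Im \<zeta>0" using l by (simp add: \<zeta>0_def)
    have "norm (z - cnj w - \<zeta>0) \<le> \<bar>Re (z - cnj w - \<zeta>0)\<bar> + \<bar>Im (z - cnj w - \<zeta>0)\<bar>" by (rule cmod_le)
    also have "\<dots> \<le> l + l" using z w by (intro add_mono) (auto simp: E_def E'_def rect_def \<zeta>0_def abs_le_iff)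
    finally show "norm (z - cnj w - \<zeta>0) \<le> 2 * l" by simp
  qed (rule big)
  have E'r: "E' = whitney a' l" by (simp add: E'_def)
  have "m * norm \<kappa> * norm (b z - average b E')
     \<le> norm (commutator \<alpha> b (box_test \<alpha> E') z) + 1 / 32 * norm \<kappa> * (LINT w:E'|dA. norm (b z - b w))"
    using commutator_box_test[OF \<alpha> b l4 zu E'r E'(3)[symmetric] m near] by simp
  also have "(LINT w:E'|dA. norm (b z - b w)) \<le> (LINT w:E'|dA. norm (b z - average b E') + norm (b w - average b E'))"
  proof (rule set_integral_mono)
    have i1: "set_integrable dA E' (\<lambda>w. norm (b w - c) ^ 1)" for c by (rule L2_set_integrable(2)[OF b E'(1,2)]) simp
    show "set_integrable dA E' (\<lambda>w. norm (b z - b w))" using i1[of "b z"] by (simp add: norm_minus_commute)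
    show "set_integrable dA E' (\<lambda>w. norm (b z - average b E') + norm (b w - average b E'))"
      using i1[of "average b E'"] by (intro set_integral_add set_integrable_const_dA E') auto
    show "norm (b z - b w) \<le> norm (b z - average b E') + norm (b w - average b E')" for w
      by (metis norm_minus_commute norm_triangle_sub dist_norm dist_triangle2)
  qed
  also have "\<dots> = m * norm (b z - average b E') + (LINT w:E'|dA. norm (b w - average b E'))"
    using L2_set_integrable(2)[OF b E'(1,2), of 1 "average b E'"]
    by (subst set_integral_add(2)) (auto intro!: set_integrable_const_dA E' simp: set_integral_const_dA[OF E'(1,2)] E'(3))
  also have "(LINT w:E'|dA. norm (b w - average b E')) \<le> 9 / 2 * (LINT w:E'|dA. norm (b w - average b E))"
    using mean_osc_le[OF b E'(1,2), of 1 "average b E"] m E'(3) by simp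
  finally have main: "m * norm \<kappa> * norm (b z - average b E')
     \<le> norm (commutator \<alpha> b (box_test \<alpha> E') z) + 1 / 32 * norm \<kappa> *
        (m * norm (b z - average b E') + 9 / 2 * (LINT w:E'|dA. norm (b w - average b E)))"
    by (simp add: mult_left_mono)
  define U where "U = norm (b z - average b E')"
  define V where "V = (LINT w:E'|dA. norm (b w - average b E))"
  define F where "F = norm (commutator \<alpha> b (box_test \<alpha> E') z)"
  define k where "k = norm \<kappa>"
  have sq: "0 < sqrt (N\<^sup>2 + 1)" by (simp add: add_nonneg_pos)
  have k: "0 < k" unfolding k_def n\<kappa> powr_gt_zero using less_imp_neq[OF mult_pos_pos[OF l sq]] by (rule not_sym)
  have V0: "0 \<le> V" unfolding V_def set_lebesgue_integral_def by (intro Bochner_Integration.integral_nonneg) auto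
  have F0: "0 \<le> F" by (simp add: F_def)
  have "m * k * U \<le> F + 1 / 32 * k * (m * U + 9 / 2 * V)"
    using main by (simp add: U_def V_def F_def k_def)
  then have "U \<le> (F + 1 / 32 * k * (m * U + 9 / 2 * V)) / (m * k)"
    using m k by (simp add: field_simps)
  also have "\<dots> = F / (m * k) + U / 32 + 9 / 64 * (V / m)"
    using m k by (simp add: field_simps)
  finally have "31 * U \<le> 32 * (F / (m * k)) + 9 / 2 * (V / m)" by simp
  moreover have "0 \<le> F / (m * k)" "0 \<le> V / m" using F0 V0 m k by auto
  moreover have "31 * U \<le> 32 * x + 9 / 2 * y \<Longrightarrow> 0 \<le> x \<Longrightarrow> 0 \<le> y \<Longrightarrow> U \<le> 2 * x + y / 4" for x y by linarith
  ultimately have "U \<le> 2 * (F / (m * k)) + V / m / 4" by blast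
  also have "F / (m * k) = (4 / 3) * sqrt (N\<^sup>2 + 1) powr (2 + \<alpha>) * l powr \<alpha> * F"
  proof -
    have "1 / k = l powr (2 + \<alpha>) * sqrt (N\<^sup>2 + 1) powr (2 + \<alpha>)"
      unfolding k_def n\<kappa> powr_minus_divide using l by (simp add: powr_mult)
    moreover have "l powr (2 + \<alpha>) = l\<^sup>2 * l powr \<alpha>" using l by (simp add: powr_add)
    moreover have "F / (m * k) = F * (1 / k) / m" by simp
    ultimately show ?thesis using l by (simp add: m_def)
  qed
  also have "V / m / 4 = V / (4 * m)" by simp
  finally show ?thesis by (simp add: U_def V_def F_def)
qed

text \<open>
  The factor \<open>l powr (-\<alpha>)\<close> is the size of \<open>box_test\<close>. The functions \<open>F\<close> and \<open>F'\<close>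
  are only almost everywhere equal to the commutators, like the values of its extension.
\<close>

lemma far_box_oscillation:
  assumes \<alpha>: "-1 < \<alpha>"
  obtains N \<kappa> :: real where "1 \<le> N" "0 < \<kappa>"
    "\<And>b p a l \<tau> F F'. b \<in> L2 dA \<Longrightarrow> p = 1 \<or> p = (2::nat) \<Longrightarrow> 0 < l \<Longrightarrow> 0 \<le> \<tau> \<Longrightarrow>
       F \<in> borel_measurable dA \<Longrightarrow> F' \<in> borel_measurable dA \<Longrightarrow>
       AE z in dA. F z = commutator \<alpha> b (box_test \<alpha> (whitney (a + N * l) l)) z \<Longrightarrow>
       AE z in dA. F' z = commutator \<alpha> b (box_test \<alpha> (whitney a l)) z \<Longrightarrow>
       set_integrable dA (whitney a l) (\<lambda>z. norm (F z) ^ p) \<Longrightarrow>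
       set_integrable dA (whitney (a + N * l) l) (\<lambda>z. norm (F' z) ^ p) \<Longrightarrow>
       (LINT z:whitney a l|dA. norm (F z) ^ p) \<le> (\<tau> * l powr (- \<alpha>)) ^ p * l\<^sup>2 \<Longrightarrow>
       (LINT z:whitney (a + N * l) l|dA. norm (F' z) ^ p) \<le> (\<tau> * l powr (- \<alpha>)) ^ p * l\<^sup>2 \<Longrightarrow>
       \<exists>c. (LINT z:whitney a l|dA. norm (b z - c) ^ p) \<le> 12 * (\<kappa> * \<tau>) ^ p * l\<^sup>2"
proof -
  obtain N where N: "1 \<le> N" and K0:
    "\<And>l \<zeta> \<zeta>0. 0 < l \<Longrightarrow> 0 < Im \<zeta> \<Longrightarrow> 0 < Im \<zeta>0 \<Longrightarrow> norm (\<zeta> - \<zeta>0) \<le> 2 * l \<Longrightarrow> N * l \<le> norm \<zeta>0 \<Longrightarrow>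
       norm (1 / \<zeta> powr of_real (2 + \<alpha>) - 1 / \<zeta>0 powr of_real (2 + \<alpha>))
         \<le> 1 / 32 * norm (1 / \<zeta>0 powr complex_of_real (2 + \<alpha>))"
    by (rule kernel_almost_constant[of "1 / 32" "2 + \<alpha>"]) auto
  have K: "\<forall>l \<zeta> \<zeta>0. 0 < l \<longrightarrow> 0 < Im \<zeta> \<longrightarrow> 0 < Im \<zeta>0 \<longrightarrow> norm (\<zeta> - \<zeta>0) \<le> 2 * l \<longrightarrow> N * l \<le> norm \<zeta>0 \<longrightarrow>
       norm (1 / \<zeta> powr of_real (2 + \<alpha>) - 1 / \<zeta>0 powr of_real (2 + \<alpha>))
         \<le> 1 / 32 * norm (1 / \<zeta>0 powr complex_of_real (2 + \<alpha>))"
    by (intro allI impI K0)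
  define q where "q = (4 / 3) * sqrt (N\<^sup>2 + 1) powr (2 + \<alpha>)"
  have "0 < sqrt (N\<^sup>2 + 1)" by (simp add: add_nonneg_pos)
  then have q: "0 < q" by (simp add: q_def)
  show ?thesis
  proof (rule that[of N "2 * q"])
    show "1 \<le> N" by fact
    show "0 < 2 * q" using q by simp
    fix b and p :: nat and a l \<tau> :: real and F F' :: "complex \<Rightarrow> complex"
    define E where "E = whitney a l"
    define E' where "E' = whitney (a + N * l) l"
    assume b: "b \<in> L2 dA" and p: "p = 1 \<or> p = (2::nat)" and l: "0 < l" and \<tau>: "0 \<le> \<tau>"
      and [measurable]: "F \<in> borel_measurable dA" "F' \<in> borel_measurable dA"
      and F: "AE z in dA. F z = commutator \<alpha> b (box_test \<alpha> (whitney (a + N * l) l)) z"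
      and F': "AE z in dA. F' z = commutator \<alpha> b (box_test \<alpha> (whitney a l)) z"
      and iF: "set_integrable dA (whitney a l) (\<lambda>z. norm (F z) ^ p)"
      and iF': "set_integrable dA (whitney (a + N * l) l) (\<lambda>z. norm (F' z) ^ p)"
      and bF: "(LINT z:whitney a l|dA. norm (F z) ^ p) \<le> (\<tau> * l powr (- \<alpha>)) ^ p * l\<^sup>2"
      and bF': "(LINT z:whitney (a + N * l) l|dA. norm (F' z) ^ p) \<le> (\<tau> * l powr (- \<alpha>)) ^ p * l\<^sup>2"
    note F = F[folded E'_def] and F' = F'[folded E_def] and iF = iF[folded E_def] and iF' = iF'[folded E'_def]
      and bF = bF[folded E_def] and bF' = bF'[folded E'_def]
    define m where "m = 3 / 4 * l\<^sup>2"
    have m: "0 < m" using l by (simp add: m_def)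
    have l4: "0 < l / 4" using l by simp
    have E: "E \<in> sets dA" "emeasure dA E < \<infinity>" "measure dA E = m"
      unfolding E_def m_def using l rect_dA[OF l4] by (auto simp: measure_rect power2_eq_square)
    have E': "E' \<in> sets dA" "emeasure dA E' < \<infinity>" "measure dA E' = m"
      unfolding E'_def m_def using l rect_dA[OF l4] by (auto simp: measure_rect power2_eq_square)
    define t where "t z = q * l powr \<alpha> * norm (F z)" for z
    define t' where "t' z = q * l powr \<alpha> * norm (F' z)" for z
    have tp: "t z ^ p = (q * l powr \<alpha>) ^ p * norm (F z) ^ p" "t' z ^ p = (q * l powr \<alpha>) ^ p * norm (F' z) ^ p" for z
      by (simp_all add: t_def t'_def power_mult_distrib)
    have bound: "(q * l powr \<alpha>) ^ p * x \<le> (2 * q * \<tau>) ^ p * m" if "x \<le> (\<tau> * l powr (- \<alpha>)) ^ p * l\<^sup>2" for x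
    proof -
      have "(q * l powr \<alpha>) ^ p * x \<le> (q * l powr \<alpha>) ^ p * ((\<tau> * l powr (- \<alpha>)) ^ p * l\<^sup>2)"
        using that q by (intro mult_left_mono) auto
      also have "\<dots> = (q * \<tau>) ^ p * (l powr \<alpha> * l powr (- \<alpha>)) ^ p * l\<^sup>2"
        by (simp add: power_mult_distrib mult_ac)
      also have "l powr \<alpha> * l powr (- \<alpha>) = 1" using l by (simp flip: powr_add)
      also have "(q * \<tau>) ^ p * 1 ^ p * l\<^sup>2 \<le> (q * \<tau>) ^ p * (2 ^ p * m)"
        using p q \<tau> by (auto intro!: mult_left_mono simp: m_def)
      finally show ?thesis by (simp add: power_mult_distrib mult_ac)
    qed
    have AEE: "AE z\<in>E in dA. norm (b z - average b E') \<le> 2 * t z + (LINT w:E'|dA. norm (b w - average b E)) / (4 * m)"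
      using F
    proof eventually_elim
      case (elim z)
      show ?case
        using far_box_pair[OF \<alpha> N K b l, where a = a and a' = "a + N * l" and z = z] l N elim
        by (simp add: E_def[symmetric] E'_def[symmetric] m_def t_def q_def)
    qed
    have AEE': "AE z\<in>E' in dA. norm (b z - average b E) \<le> 2 * t' z + (LINT w:E|dA. norm (b w - average b E')) / (4 * m)"
      using F'
    proof eventually_elim
      case (elim z)
      show ?case
        using far_box_pair[OF \<alpha> N K b l, where a = "a + N * l" and a' = a and z = z] l N elim
        by (simp add: E_def[symmetric] E'_def[symmetric] m_def t'_def q_def)
    qed
    have i1: "set_integrable dA G (\<lambda>w. norm (b w - c))" if "G \<in> sets dA" "emeasure dA G < \<infinity>" for G c
      using L2_set_integrable(2)[OF b that, of 1 c] by simp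
    have "(LINT z:E|dA. norm (b z - average b E') ^ p) \<le> 12 * (2 * q * \<tau>) ^ p * m"
    proof (rule mutual_absorption[OF E E' m p _ _ _ _ _ _ _ _ _ _ _ _ _ _ AEE AEE'])
      show "0 \<le> 2 * q * \<tau>" using q \<tau> by simp
      show "0 \<le> t z" "0 \<le> t' z" for z using q by (simp_all add: t_def t'_def)
      show "set_integrable dA E (\<lambda>z. norm (b z - average b E') ^ p)" by (rule L2_set_integrable(2)[OF b E(1,2) p])
      show "t \<in> borel_measurable dA" "t' \<in> borel_measurable dA" unfolding t_def t'_def by measurable
      show "set_integrable dA E (\<lambda>z. t z ^ p)" "set_integrable dA E' (\<lambda>z. t' z ^ p)"
        unfolding tp by (intro set_integrable_mult_right iF iF')+
      show "(LINT z:E|dA. t z ^ p) \<le> (2 * q * \<tau>) ^ p * m" "(LINT z:E'|dA. t' z ^ p) \<le> (2 * q * \<tau>) ^ p * m"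
        unfolding tp set_integral_mult_right using bound bF bF' by blast+
    qed (use i1 E E' in auto)
    also have "\<dots> \<le> 12 * (2 * q * \<tau>) ^ p * l\<^sup>2"
      using q \<tau> by (intro mult_left_mono) (auto simp: m_def)
    finally show "\<exists>c. (LINT z:whitney a l|dA. norm (b z - c) ^ p) \<le> 12 * (2 * q * \<tau>) ^ p * l\<^sup>2"
      unfolding E_def by blast
  qed
qed

section \<open>Size of the commutator on test boxes\<close>

lemma box_test_image:
  assumes \<alpha>: "-1 < \<alpha>" and \<sigma>: "weight \<sigma>" and T: "commutator_extension \<alpha> \<sigma> b T"
    and l: "0 < l" and c: "0 < c" and E: "E = rect a a' (l / 4) l"
    and lower: "\<And>w. w \<in> E \<Longrightarrow> c * l powr \<alpha> \<le> bergman_density \<alpha> w"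
    and int: "set_integrable dA E (\<lambda>z. bergman_density \<alpha> z * \<sigma> z)"
  defines "F \<equiv> T (box_test \<alpha> E)"
  shows "F \<in> borel_measurable dA"
    and "AE z in dA. F z = commutator \<alpha> b (box_test \<alpha> E) z"
    and "integrable dA (\<lambda>z. bergman_density \<alpha> z * \<sigma> z * (norm (F z))\<^sup>2)"
    and "(\<integral>z. bergman_density \<alpha> z * \<sigma> z * (norm (F z))\<^sup>2 \<partial>dA)
       \<le> (operator_norm (weighted \<alpha> \<sigma>) T)\<^sup>2 * ((c * l powr \<alpha>) powr (-2) * (LINT z:E|dA. bergman_density \<alpha> z * \<sigma> z))"
proof -
  define f where "f = box_test \<alpha> E"
  have l4: "0 < l / 4" using l by simp
  have test: "f \<in> test_functions" unfolding f_def E by (rule box_test_in_test_functions[OF \<alpha> l4])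
  have [measurable]: "f \<in> borel_measurable dA" using test by (simp add: test_functions_def)
  have [measurable]: "\<sigma> \<in> borel_measurable dA" using \<sigma> by (simp add: weight_def)
  have bo: "bounded_operator (weighted \<alpha> \<sigma>) T" using T by (simp add: commutator_extension_def)
  define k where "k = (c * l powr \<alpha>) powr (-2)"
  have cl: "0 < c * l powr \<alpha>" using c l by simp
  have keq: "k = 1 / (c * l powr \<alpha>)\<^sup>2"
    unfolding k_def powr_minus_divide using cl by simp
  have dom: "AE z in dA. norm (bergman_density \<alpha> z * \<sigma> z * (norm (f z))\<^sup>2)
      \<le> k * (indicator E z *\<^sub>R (bergman_density \<alpha> z * \<sigma> z))"
    using weight_density_pos[OF \<alpha> \<sigma>]
  proof eventually_elim
    case (elim z)
    show ?case
    proof (cases "z \<in> E")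
      case True
      have r: "c * l powr \<alpha> \<le> bergman_density \<alpha> z" by (rule lower[OF True])
      have "(norm (f z))\<^sup>2 = 1 / (bergman_density \<alpha> z)\<^sup>2"
        using True by (simp add: f_def box_test_def norm_divide power_divide)
      also have "\<dots> \<le> k"
        unfolding keq using r less_imp_le[OF cl] c l less_le_trans[OF cl r]
        by (intro divide_left_mono power_mono mult_pos_pos zero_less_power) simp_all
      finally have "bergman_density \<alpha> z * \<sigma> z * (norm (f z))\<^sup>2 \<le> bergman_density \<alpha> z * \<sigma> z * k"
        using elim by (intro mult_left_mono) auto
      moreover have "norm (bergman_density \<alpha> z * \<sigma> z * (norm (f z))\<^sup>2) = bergman_density \<alpha> z * \<sigma> z * (norm (f z))\<^sup>2"
        unfolding real_norm_def by (intro abs_of_nonneg mult_nonneg_nonneg[OF less_imp_le[OF elim]]) simp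
      ultimately show ?thesis using True by (simp add: mult.commute)
    qed (simp add: f_def box_test_def)
  qed
  have ik: "integrable dA (\<lambda>z. k * (indicator E z *\<^sub>R (bergman_density \<alpha> z * \<sigma> z)))"
    using int unfolding set_integrable_def by (rule integrable_mult_right)
  have if2: "integrable dA (\<lambda>z. bergman_density \<alpha> z * \<sigma> z * (norm (f z))\<^sup>2)"
    by (rule Bochner_Integration.integrable_bound[OF ik]) (use dom in \<open>auto elim: eventually_mono\<close>)
  then have fL: "f \<in> L2 (weighted \<alpha> \<sigma>)" by (simp add: L2_weighted_iff[OF \<alpha> \<sigma>])
  have TL: "F \<in> L2 (weighted \<alpha> \<sigma>)"
    using bo fL unfolding bounded_operator_def F_def f_def by blast
  then show Fm: "F \<in> borel_measurable dA"
    and "integrable dA (\<lambda>z. bergman_density \<alpha> z * \<sigma> z * (norm (F z))\<^sup>2)"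
    by (simp_all add: L2_weighted_iff[OF \<alpha> \<sigma>])
  show "AE z in dA. F z = commutator \<alpha> b (box_test \<alpha> E) z"
    using T test unfolding commutator_extension_def F_def f_def by blast
  have "(\<integral>z. bergman_density \<alpha> z * \<sigma> z * (norm (F z))\<^sup>2 \<partial>dA) = (L2_norm (weighted \<alpha> \<sigma>) F)\<^sup>2"
    by (rule L2_norm_weighted[OF \<alpha> \<sigma> Fm, symmetric])
  also have "\<dots> \<le> (operator_norm (weighted \<alpha> \<sigma>) T * L2_norm (weighted \<alpha> \<sigma>) f)\<^sup>2"
    unfolding F_def f_def[symmetric]
    by (intro power_mono operator_norm_bounds(2)[OF bo fL] L2_norm_nonneg)
  also have "\<dots> = (operator_norm (weighted \<alpha> \<sigma>) T)\<^sup>2 * (\<integral>z. bergman_density \<alpha> z * \<sigma> z * (norm (f z))\<^sup>2 \<partial>dA)"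
    by (simp add: power_mult_distrib L2_norm_weighted[OF \<alpha> \<sigma>])
  also have "(\<integral>z. bergman_density \<alpha> z * \<sigma> z * (norm (f z))\<^sup>2 \<partial>dA)
      \<le> (\<integral>z. k * (indicator E z *\<^sub>R (bergman_density \<alpha> z * \<sigma> z)) \<partial>dA)"
    using dom by (intro integral_mono_AE if2 ik) (auto elim: eventually_mono)
  also have "\<dots> = k * (LINT z:E|dA. bergman_density \<alpha> z * \<sigma> z)"
    by (simp add: set_lebesgue_integral_def)
  finally show "(\<integral>z. bergman_density \<alpha> z * \<sigma> z * (norm (F z))\<^sup>2 \<partial>dA)
       \<le> (operator_norm (weighted \<alpha> \<sigma>) T)\<^sup>2 * ((c * l powr \<alpha>) powr (-2) * (LINT z:E|dA. bergman_density \<alpha> z * \<sigma> z))"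
    by (simp add: k_def mult_left_mono)
qed

lemma adjacent_cover:
  assumes adj: "adjacent_dyadic_systems \<D>1 \<D>2"
  obtains C where "0 < C"
    "\<And>a l. 0 < l \<Longrightarrow> \<exists>J\<in>\<D>1 \<union> \<D>2. {a..<a + l} \<subseteq> J \<and> l \<le> len J \<and> len J \<le> C * l"
proof -
  note 1 = assms[unfolded adjacent_dyadic_systems_def]
  obtain C where C: "\<forall>I. is_interval I \<and> bounded I \<and> 0 < len I \<longrightarrow>
        (\<exists>J\<in>\<D>1 \<union> \<D>2. I \<subseteq> J \<and> len J \<le> C * len I)"
    using conjunct2[OF conjunct2[OF 1]] by (rule exE)
  have main: "\<exists>J\<in>\<D>1 \<union> \<D>2. {a..<a + l} \<subseteq> J \<and> l \<le> len J \<and> len J \<le> C * l" if l: "0 < l" for a l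
  proof -
    have "is_interval {a..<a + l}" "bounded {a..<a + l}" "0 < len {a..<a + l}"
      using l by (simp_all add: len_halfopen is_interval_1)
    with C obtain J where J: "J \<in> \<D>1 \<union> \<D>2" "{a..<a + l} \<subseteq> J" "len J \<le> C * len {a..<a + l}" by blast
    obtain a' l' where J': "J = {a'..<a' + l'}" "len J = l'" "0 < l'" using adjacent_interval[OF adj J(1)] .
    have "a' \<le> a \<and> a + l \<le> a' + l'"
      using J(2) l unfolding J'(1) by (simp add: atLeastLessThan_subset_iff)
    then have "l \<le> len J" using J' by simp
    with J l show ?thesis by (auto simp: len_halfopen)
  qed
  have "0 < C"
  proof (rule ccontr)
    assume "\<not> 0 < C"
    with main[of 1 0] show False by auto
  qed
  then show ?thesis using main by (rule that)
qed


lemma B2_weight: "\<sigma> \<in> B2 \<alpha> \<D> \<Longrightarrow> weight \<sigma>"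
  by (simp add: B2_def)

lemma rect_subset_Q:
  assumes "{a..<a'} \<subseteq> J" "d \<le> len J" "0 < c"
  shows "rect a a' c d \<subseteq> Q J"
  using assms by (auto simp: rect_def Q_def)

lemma B2_rect_integrable:
  assumes \<alpha>: "-1 < \<alpha>" and adj: "adjacent_dyadic_systems \<D>1 \<D>2" and \<sigma>: "\<sigma> \<in> B2 \<alpha> (\<D>1 \<union> \<D>2)"
    and c: "0 < c"
  shows "set_integrable dA (rect a a' c d) (\<lambda>z. bergman_density \<alpha> z * \<sigma> z)"
proof -
  obtain A where int: "\<And>I. I \<in> \<D>1 \<union> \<D>2 \<Longrightarrow> set_integrable dA (Q I) (\<lambda>z. bergman_density \<alpha> z * \<sigma> z)"
    by (rule B2_integral_bound[OF \<alpha> adj \<sigma>]) (rule that; blast)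
  obtain C where cov: "\<And>a l. 0 < l \<Longrightarrow> \<exists>J\<in>\<D>1 \<union> \<D>2. {a..<a + l} \<subseteq> J \<and> l \<le> len J \<and> len J \<le> C * l"
    by (rule adjacent_cover[OF adj]) (rule that; blast)
  \<comment> \<open>Long enough for the box over it to contain the given box in both directions.\<close>
  define l where "l = max 1 (max (a' - a) d)"
  have l: "0 < l" "a' - a \<le> l" "d \<le> l" by (auto simp: l_def)
  obtain J where J: "J \<in> \<D>1 \<union> \<D>2" "{a..<a + l} \<subseteq> J" "l \<le> len J" using cov[OF l(1)] by blast
  have "rect a a' c d \<subseteq> Q J" using J l c by (intro rect_subset_Q) auto
  then show ?thesis by (rule set_integrable_subset[OF int[OF J(1)] rect_dA(1)[OF c]])
qed

text \<open>
  All densities and all values of the weight on the two boxes are comparable to those at one point,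
  so the weighted bound is an unweighted one. That value of the weight
  cancels. The factor \<open>l powr (-\<alpha>)\<close> is left over from the test function.
\<close>

lemma box_bound_L2:
  assumes \<alpha>: "-1 < \<alpha>" and \<sigma>: "weight \<sigma>" and pos: "\<And>z. z \<in> uhp \<Longrightarrow> 0 < \<sigma> z"
    and reg: "hyperbolically_regular \<sigma>" and N: "1 \<le> N"
    and int: "\<And>a a' c d. 0 < c \<Longrightarrow> set_integrable dA (rect a a' c d) (\<lambda>z. bergman_density \<alpha> z * \<sigma> z)"
  obtains C where "0 < C"
    "\<And>b T a a' l. commutator_extension \<alpha> \<sigma> b T \<Longrightarrow> 0 < l \<Longrightarrow> \<bar>a - a'\<bar> \<le> N * l \<Longrightarrow>
       T (box_test \<alpha> (whitney a' l)) \<in> borel_measurable dA \<and>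
       set_integrable dA (whitney a l) (\<lambda>z. (norm (T (box_test \<alpha> (whitney a' l)) z))\<^sup>2) \<and>
       (LINT z:whitney a l|dA. (norm (T (box_test \<alpha> (whitney a' l)) z))\<^sup>2)
         \<le> (C * operator_norm (weighted \<alpha> \<sigma>) T * l powr (- \<alpha>))\<^sup>2 * l\<^sup>2"
proof -
  obtain c C1 where c: "0 < c" "0 < C1" and sc:
    "\<And>l w. 0 < l \<Longrightarrow> l / 4 \<le> Im w \<Longrightarrow> Im w \<le> l \<Longrightarrow>
       c * l powr \<alpha> \<le> bergman_density \<alpha> w \<and> bergman_density \<alpha> w \<le> C1 * l powr \<alpha>"
    by (rule bergman_density_scale[OF \<alpha>]) (rule that; blast)
  obtain Cs where Cs: "0 < Cs" and Har:
    "\<And>z w. z \<in> uhp \<Longrightarrow> w \<in> uhp \<Longrightarrow> dist z w \<le> (4 * (N + 2)) * min (Im z) (Im w) \<Longrightarrow> \<sigma> z \<le> Cs * \<sigma> w"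
  proof -
    obtain Cs where "0 < Cs" "\<forall>z\<in>uhp. \<forall>w\<in>uhp. dist z w \<le> (4 * (N + 2)) * min (Im z) (Im w) \<longrightarrow> \<sigma> z \<le> Cs * \<sigma> w"
      using reg unfolding hyperbolically_regular_def by blast
    then show ?thesis by (intro that[of Cs]) auto
  qed
  define C where "C = sqrt (Cs\<^sup>2 * C1 / c ^ 3)"
  have C: "0 < C" "C\<^sup>2 = Cs\<^sup>2 * C1 / c ^ 3" using c Cs by (auto simp: C_def)
  have main: "T (box_test \<alpha> (whitney a' l)) \<in> borel_measurable dA \<and>
       set_integrable dA (whitney a l) (\<lambda>z. (norm (T (box_test \<alpha> (whitney a' l)) z))\<^sup>2) \<and>
       (LINT z:whitney a l|dA. (norm (T (box_test \<alpha> (whitney a' l)) z))\<^sup>2)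
         \<le> (C * operator_norm (weighted \<alpha> \<sigma>) T * l powr (- \<alpha>))\<^sup>2 * l\<^sup>2"
    if T: "commutator_extension \<alpha> \<sigma> b T" and l: "0 < l" and a: "\<bar>a - a'\<bar> \<le> N * l" for b T a a' l
  proof -
    define E where "E = whitney a l"
    define E' where "E' = whitney a' l"
    have l4: "0 < l / 4" using l by simp
    have EdA: "E \<in> sets dA" unfolding E_def by (rule rect_dA[OF l4])
    have [measurable]: "E \<in> sets dA" by (rule EdA)
    have E'dA: "E' \<in> sets dA" "emeasure dA E' < \<infinity>" "measure dA E' = 3 / 4 * l\<^sup>2"
      unfolding E'_def using l rect_dA[OF l4] by (auto simp: measure_rect power2_eq_square)
    have u: "z \<in> uhp" if "z \<in> E \<union> E'" for z using that rect_subset_uhp[OF l4] by (auto simp: E_def E'_def)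
    define L where "L = l powr \<alpha>"
    have L: "0 < L" "l powr (- \<alpha>) = 1 / L" using l by (simp_all add: L_def powr_minus_divide)
    define F where "F = T (box_test \<alpha> E')"
    define O' where "O' = operator_norm (weighted \<alpha> \<sigma>) T"
    define X where "X = (\<integral>z. bergman_density \<alpha> z * \<sigma> z * (norm (F z))\<^sup>2 \<partial>dA)"
    have lowE': "c * l powr \<alpha> \<le> bergman_density \<alpha> w" if "w \<in> E'" for w
      using sc[OF l, of w] that by (auto simp: E'_def rect_def)
    note img = box_test_image[OF \<alpha> \<sigma> T l c(1) E'_def lowE' int[OF l4, of a' "a' + l" l, folded E'_def], folded F_def, folded O'_def X_def]
    have [measurable]: "F \<in> borel_measurable dA" by (rule img(1))
    \<comment> \<open>The point of reference for the weight on both boxes.\<close>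
    define w0 where "w0 = Complex a' (l / 2)"
    have w0: "w0 \<in> E'" using l by (simp add: w0_def E'_def rect_def)
    define s where "s = \<sigma> w0"
    have s: "0 < s" using pos[OF u] w0 by (simp add: s_def)
    have close: "dist z w0 \<le> (4 * (N + 2)) * min (Im z) (Im w0)" if z: "z \<in> E \<union> E'" for z
    proof -
      have "0 < N * l" using N l by simp
      then have 1: "\<bar>Re z - Re w0\<bar> \<le> (N + 1) * l"
        using z a l by (auto simp: E_def E'_def rect_def w0_def abs_le_iff algebra_simps)
      have 2: "\<bar>Im z - Im w0\<bar> \<le> l" "l / 4 \<le> min (Im z) (Im w0)"
        using z l by (auto simp: E_def E'_def rect_def w0_def abs_le_iff)
      have "dist z w0 \<le> \<bar>Re (z - w0)\<bar> + \<bar>Im (z - w0)\<bar>" unfolding dist_norm by (rule cmod_le)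
      also have "\<dots> \<le> (4 * (N + 2)) * (l / 4)" using 1 2 by (simp add: algebra_simps)
      also have "\<dots> \<le> (4 * (N + 2)) * min (Im z) (Im w0)" using 2 N by (intro mult_left_mono) auto
      finally show ?thesis .
    qed
    have upper: "bergman_density \<alpha> w * \<sigma> w \<le> C1 * L * (Cs * s)" if w: "w \<in> E'" for w
    proof -
      have "bergman_density \<alpha> w \<le> C1 * L" using sc[OF l, of w] w by (auto simp: E'_def rect_def L_def)
      moreover have "\<sigma> w \<le> Cs * s" unfolding s_def using w w0 u close by (intro Har) auto
      ultimately show ?thesis using c L pos[of w] u[of w] w by (intro mult_mono) auto
    qed
    have "(LINT z:E'|dA. bergman_density \<alpha> z * \<sigma> z) \<le> (LINT z:E'|dA. C1 * L * (Cs * s))"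
      using upper int[OF l4] by (intro set_integral_mono set_integrable_const_dA E'dA) (auto simp: E'_def)
    also have "\<dots> = 3 / 4 * l\<^sup>2 * (C1 * L * (Cs * s))" by (simp add: set_integral_const_dA[OF E'dA(1,2)] E'dA(3))
    also have "\<dots> \<le> l\<^sup>2 * (C1 * L * (Cs * s))" using c L Cs s by (intro mult_right_mono) auto
    finally have Y: "(LINT z:E'|dA. bergman_density \<alpha> z * \<sigma> z) \<le> l\<^sup>2 * (C1 * L * (Cs * s))" .
    have X: "X \<le> O'\<^sup>2 * (1 / (c * L)\<^sup>2 * (l\<^sup>2 * (C1 * L * (Cs * s))))"
    proof -
      have "X \<le> O'\<^sup>2 * ((c * l powr \<alpha>) powr (-2) * (LINT z:E'|dA. bergman_density \<alpha> z * \<sigma> z))" by (rule img(4))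
      also have "(c * l powr \<alpha>) powr (-2) = 1 / (c * L)\<^sup>2"
        unfolding powr_minus_divide L_def[symmetric] using c L by simp
      also have "O'\<^sup>2 * (1 / (c * L)\<^sup>2 * (LINT z:E'|dA. bergman_density \<alpha> z * \<sigma> z))
          \<le> O'\<^sup>2 * (1 / (c * L)\<^sup>2 * (l\<^sup>2 * (C1 * L * (Cs * s))))"
        by (intro mult_left_mono Y) auto
      finally show ?thesis .
    qed
    define k where "k = Cs / (c * L * s)"
    have k: "0 < k" using c L Cs s by (simp add: k_def)
    have lower: "1 \<le> k * (bergman_density \<alpha> z * \<sigma> z)" if z: "z \<in> E" for z
    proof -
      have "c * L \<le> bergman_density \<alpha> z" using sc[OF l, of z] z by (auto simp: E_def rect_def L_def)
      moreover have "s \<le> Cs * \<sigma> z"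
        unfolding s_def using z w0 u close[of z] by (intro Har) (auto simp: dist_commute min.commute)
      ultimately have "c * L * s \<le> bergman_density \<alpha> z * (Cs * \<sigma> z)"
        using c L s bergman_density_nonneg[OF \<alpha>, of z] by (intro mult_mono) auto
      then show ?thesis using c L s by (simp add: k_def field_simps)
    qed
    have ik: "integrable dA (\<lambda>z. k * (bergman_density \<alpha> z * \<sigma> z * (norm (F z))\<^sup>2))"
      by (intro integrable_mult_right img(3))
    have dom: "AE z in dA. norm (indicator E z *\<^sub>R (norm (F z))\<^sup>2) \<le> k * (bergman_density \<alpha> z * \<sigma> z * (norm (F z))\<^sup>2)"
      using weight_density_pos[OF \<alpha> \<sigma>]
    proof eventually_elim
      case (elim z)
      show ?case
      proof (cases "z \<in> E")
        case True
        have "1 * (norm (F z))\<^sup>2 \<le> k * (bergman_density \<alpha> z * \<sigma> z) * (norm (F z))\<^sup>2"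
          by (intro mult_right_mono lower True) auto
        then show ?thesis using True by (simp add: mult_ac)
      next
        case False
        have "0 \<le> k * (bergman_density \<alpha> z * \<sigma> z * (norm (F z))\<^sup>2)"
          using k by (intro mult_nonneg_nonneg[OF less_imp_le[OF k]] mult_nonneg_nonneg[OF less_imp_le[OF elim]]) auto
        then show ?thesis using False by simp
      qed
    qed
    have iF: "set_integrable dA E (\<lambda>z. (norm (F z))\<^sup>2)"
      unfolding set_integrable_def
      by (rule Bochner_Integration.integrable_bound[OF ik]) (use dom in \<open>auto elim!: eventually_mono\<close>)
    have "(LINT z:E|dA. (norm (F z))\<^sup>2) \<le> (\<integral>z. k * (bergman_density \<alpha> z * \<sigma> z * (norm (F z))\<^sup>2) \<partial>dA)"
      unfolding set_lebesgue_integral_def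
      using iF[unfolded set_integrable_def] ik dom by (intro integral_mono_AE) (auto elim!: eventually_mono)
    also have "\<dots> = k * X" by (simp add: X_def)
    also have "\<dots> \<le> k * (O'\<^sup>2 * (1 / (c * L)\<^sup>2 * (l\<^sup>2 * (C1 * L * (Cs * s)))))"
      using k by (intro mult_left_mono X) auto
    also have "\<dots> = O'\<^sup>2 * (Cs\<^sup>2 * C1 / c ^ 3) * (1 / L)\<^sup>2 * l\<^sup>2"
      using c L s by (simp add: k_def power2_eq_square power3_eq_cube field_simps)
    also have "\<dots> = (C * O' * (1 / L))\<^sup>2 * l\<^sup>2"
      by (simp only: power_mult_distrib C(2)) (simp only: mult_ac)
    finally show ?thesis using iF img(1) unfolding L E_def E'_def F_def O'_def by simp
  qed
  show ?thesis by (rule that[OF C(1) main])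
qed

text \<open>
  By Cauchy-Schwarz the mean of \<open>T f\<close> over \<open>E\<close> is at most its weighted norm times the root of the
  integral of \<open>1/\<sigma>\<close> over \<open>E\<close>, while the norm of the test function is the root of the integral of \<open>\<sigma>\<close> over \<open>E'\<close>.
  Both boxes lie over one dyadic interval of comparable length, where the product is controlled.
\<close>

lemma box_bound_L1:
  assumes \<alpha>: "-1 < \<alpha>" and adj: "adjacent_dyadic_systems \<D>1 \<D>2" and B2: "\<sigma> \<in> B2 \<alpha> (\<D>1 \<union> \<D>2)"
    and N: "1 \<le> N"
  obtains C where "0 < C"
    "\<And>b T a a' l. commutator_extension \<alpha> \<sigma> b T \<Longrightarrow> 0 < l \<Longrightarrow> \<bar>a - a'\<bar> \<le> N * l \<Longrightarrow>
       T (box_test \<alpha> (whitney a' l)) \<in> borel_measurable dA \<and>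
       set_integrable dA (whitney a l) (\<lambda>z. norm (T (box_test \<alpha> (whitney a' l)) z)) \<and>
       (LINT z:whitney a l|dA. norm (T (box_test \<alpha> (whitney a' l)) z))
         \<le> C * operator_norm (weighted \<alpha> \<sigma>) T * l powr (- \<alpha>) * l\<^sup>2"
proof -
  have \<sigma>: "weight \<sigma>" by (rule B2_weight[OF B2])
  have [measurable]: "\<sigma> \<in> borel_measurable dA" using \<sigma> by (simp add: weight_def)
  obtain c C1 where c: "0 < c" "0 < C1" and sc:
    "\<And>l w. 0 < l \<Longrightarrow> l / 4 \<le> Im w \<Longrightarrow> Im w \<le> l \<Longrightarrow>
       c * l powr \<alpha> \<le> bergman_density \<alpha> w \<and> bergman_density \<alpha> w \<le> C1 * l powr \<alpha>"
    by (rule bergman_density_scale[OF \<alpha>]) (rule that; blast)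
  obtain A where A: "0 < A" and int1: "\<And>I. I \<in> \<D>1 \<union> \<D>2 \<Longrightarrow> set_integrable dA (Q I) (\<lambda>z. bergman_density \<alpha> z * \<sigma> z)"
    and int2: "\<And>I. I \<in> \<D>1 \<union> \<D>2 \<Longrightarrow> set_integrable dA (Q I) (\<lambda>z. bergman_density \<alpha> z * inverse (\<sigma> z))"
    and A2: "\<And>I. I \<in> \<D>1 \<union> \<D>2 \<Longrightarrow>
      (LINT z:Q I|dA. bergman_density \<alpha> z * \<sigma> z) * (LINT z:Q I|dA. bergman_density \<alpha> z * inverse (\<sigma> z))
        \<le> A * (len I powr (2 + \<alpha>))\<^sup>2"
    by (rule B2_integral_bound[OF \<alpha> adj B2]) (rule that; blast)
  obtain Cc where Cc: "0 < Cc" and cov: "\<And>a l. 0 < l \<Longrightarrow> \<exists>J\<in>\<D>1 \<union> \<D>2. {a..<a + l} \<subseteq> J \<and> l \<le> len J \<and> len J \<le> Cc * l"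
    by (rule adjacent_cover[OF adj]) (rule that; blast)
  define M where "M = (Cc * (N + 1)) powr (2 + \<alpha>)"
  define C where "C = sqrt A * M / c\<^sup>2"
  have M: "0 < M" using Cc N by (simp add: M_def)
  have C: "0 < C" using A M c by (simp add: C_def)
  have main: "T (box_test \<alpha> (whitney a' l)) \<in> borel_measurable dA \<and>
       set_integrable dA (whitney a l) (\<lambda>z. norm (T (box_test \<alpha> (whitney a' l)) z)) \<and>
       (LINT z:whitney a l|dA. norm (T (box_test \<alpha> (whitney a' l)) z))
         \<le> C * operator_norm (weighted \<alpha> \<sigma>) T * l powr (- \<alpha>) * l\<^sup>2"
    if T: "commutator_extension \<alpha> \<sigma> b T" and l: "0 < l" and a: "\<bar>a - a'\<bar> \<le> N * l" for b T a a' l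
  proof -
    define E where "E = whitney a l"
    define E' where "E' = whitney a' l"
    have l4: "0 < l / 4" using l by simp
    have [measurable]: "E \<in> sets dA" "E' \<in> sets dA" unfolding E_def E'_def by (rule rect_dA[OF l4])+
    have Nl: "0 < (N + 1) * l" using N l by simp
    obtain J where J: "J \<in> \<D>1 \<union> \<D>2" "{min a a'..<min a a' + (N + 1) * l} \<subseteq> J" "(N + 1) * l \<le> len J"
      "len J \<le> Cc * ((N + 1) * l)"
      using cov[OF Nl] by blast
    have lJ: "l \<le> len J" 
    proof -
      have "(N + 1) * l = N * l + l" "0 \<le> N * l" using N l by (simp_all add: distrib_right)
      with J(3) show ?thesis by linarith
    qed
    have sub: "E \<subseteq> Q J" "E' \<subseteq> Q J"
    proof -
      have "{a..<a + l} \<subseteq> {min a a'..<min a a' + (N + 1) * l} \<and> {a'..<a' + l} \<subseteq> {min a a'..<min a a' + (N + 1) * l}"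
      proof -
        have "(N + 1) * l = N * l + l" by (simp add: distrib_right)
        with a l have "a + l \<le> min a a' + (N + 1) * l" "a' + l \<le> min a a' + (N + 1) * l"
          by linarith+
        then show ?thesis by auto
      qed
      with J(2) show "E \<subseteq> Q J" "E' \<subseteq> Q J"
        unfolding E_def E'_def using lJ l4 by (intro rect_subset_Q; blast)+
    qed
    define L where "L = l powr \<alpha>"
    have L: "0 < L" "l powr (- \<alpha>) = 1 / L" using l by (simp_all add: L_def powr_minus_divide)
    define F where "F = T (box_test \<alpha> E')"
    define O' where "O' = operator_norm (weighted \<alpha> \<sigma>) T"
    have bo: "bounded_operator (weighted \<alpha> \<sigma>) T" using T by (simp add: commutator_extension_def)
    have O': "0 \<le> O'" unfolding O'_def by (rule operator_norm_bounds(1)[OF bo])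
    define X where "X = (\<integral>z. bergman_density \<alpha> z * \<sigma> z * (norm (F z))\<^sup>2 \<partial>dA)"
    have lowE': "c * l powr \<alpha> \<le> bergman_density \<alpha> w" if "w \<in> E'" for w
      using sc[OF l, of w] that by (auto simp: E'_def rect_def)
    have iE': "set_integrable dA E' (\<lambda>z. bergman_density \<alpha> z * \<sigma> z)"
      by (rule set_integrable_subset[OF int1[OF J(1)] _ sub(2)]) measurable
    note img = box_test_image[OF \<alpha> \<sigma> T l c(1) E'_def lowE' iE', folded F_def, folded O'_def X_def]
    have [measurable]: "F \<in> borel_measurable dA" by (rule img(1))
    define S where "S = (LINT z:Q J|dA. bergman_density \<alpha> z * \<sigma> z)"
    define R where "R = (LINT z:Q J|dA. bergman_density \<alpha> z * inverse (\<sigma> z))"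
    \<comment> \<open>The weight is positive only almost everywhere. The modulus makes the square roots below inverse to each other wherever \<open>W\<close> does not vanish.\<close>
    define W where "W z = \<bar>bergman_density \<alpha> z * \<sigma> z\<bar>" for z
    have [measurable]: "W \<in> borel_measurable dA" unfolding W_def by measurable
    define k where "k = 1 / (c * L)\<^sup>2"
    have cL: "0 < c * L" using c L by simp
    have k: "0 < k" using c L by (simp add: k_def)
    have nnS: "AE z in dA. 0 \<le> bergman_density \<alpha> z * \<sigma> z"
      using weight_density_pos[OF \<alpha> \<sigma>] by eventually_elim simp
    have "(LINT z:E'|dA. bergman_density \<alpha> z * \<sigma> z) \<le> S"
      unfolding S_def set_lebesgue_integral_def
      using nnS sub(2) iE' int1[OF J(1)]
      by (intro integral_mono_AE) (auto simp: set_integrable_def indicator_def elim!: eventually_mono)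
    then have XS: "X \<le> O'\<^sup>2 * (k * S)"
    proof -
      assume *: "(LINT z:E'|dA. bergman_density \<alpha> z * \<sigma> z) \<le> S"
      have "X \<le> O'\<^sup>2 * ((c * l powr \<alpha>) powr (-2) * (LINT z:E'|dA. bergman_density \<alpha> z * \<sigma> z))" by (rule img(4))
      also have "(c * l powr \<alpha>) powr (-2) = k"
        unfolding powr_minus_divide L_def[symmetric] k_def using cL by simp
      also have "O'\<^sup>2 * (k * (LINT z:E'|dA. bergman_density \<alpha> z * \<sigma> z)) \<le> O'\<^sup>2 * (k * S)"
        using * k by (intro mult_left_mono) auto
      finally show ?thesis .
    qed
    define f where "f z = sqrt (W z) * norm (F z)" for z
    define g where "g z = sqrt (inverse (W z))" for z
    have f2: "(f z)\<^sup>2 = W z * (norm (F z))\<^sup>2" and g2: "(g z)\<^sup>2 = inverse (W z)" for z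
      by (simp_all add: f_def g_def W_def power_mult_distrib)
    have if2: "integrable dA (\<lambda>z. (f z)\<^sup>2)" and Xf: "(\<integral>z. (f z)\<^sup>2 \<partial>dA) = X"
    proof -
      have ae: "AE z in dA. (f z)\<^sup>2 = bergman_density \<alpha> z * \<sigma> z * (norm (F z))\<^sup>2"
        using nnS by eventually_elim (simp add: f2 W_def)
      then have ae': "AE z in dA. bergman_density \<alpha> z * \<sigma> z * (norm (F z))\<^sup>2 = (f z)\<^sup>2"
        by eventually_elim (rule sym)
      have fm: "(\<lambda>z. (f z)\<^sup>2) \<in> borel_measurable dA" unfolding f_def by measurable
      show "integrable dA (\<lambda>z. (f z)\<^sup>2)" by (rule integrable_cong_AE_imp[OF img(3) fm ae'])
      show "(\<integral>z. (f z)\<^sup>2 \<partial>dA) = X"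
        unfolding X_def by (rule integral_cong_AE[OF fm borel_measurable_integrable[OF img(3)] ae])
    qed
    have dom: "AE z in dA. norm (indicator E z *\<^sub>R (g z)\<^sup>2) \<le> k * (indicator (Q J) z *\<^sub>R (bergman_density \<alpha> z * inverse (\<sigma> z)))"
      using weight_density_pos[OF \<alpha> \<sigma>] AE_space
    proof eventually_elim
      case (elim z)
      have rho: "0 < bergman_density \<alpha> z" using elim(2) by (intro bergman_density_pos \<alpha>) simp
      then have sg: "0 < \<sigma> z" using elim(1) by (simp add: zero_less_mult_iff)
      show ?case
      proof (cases "z \<in> E")
        case True
        have "c * L \<le> bergman_density \<alpha> z" using sc[OF l, of z] True by (auto simp: E_def rect_def L_def)
        then have "1 / (bergman_density \<alpha> z)\<^sup>2 \<le> k"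
          unfolding k_def using cL rho c L by (intro divide_left_mono power_mono mult_pos_pos zero_less_power) simp_all
        then have "1 / (bergman_density \<alpha> z)\<^sup>2 * (bergman_density \<alpha> z * inverse (\<sigma> z)) \<le> k * (bergman_density \<alpha> z * inverse (\<sigma> z))"
          using rho sg by (intro mult_right_mono) auto
        moreover have "(g z)\<^sup>2 = 1 / (bergman_density \<alpha> z)\<^sup>2 * (bergman_density \<alpha> z * inverse (\<sigma> z))"
          unfolding g2 W_def using rho sg by (simp add: power2_eq_square field_simps)
        ultimately have le: "(g z)\<^sup>2 \<le> k * (bergman_density \<alpha> z * inverse (\<sigma> z))" by (simp only:)
        have "z \<in> Q J" using True sub(1) by (rule subsetD[rotated])
        then show ?thesis using le True by simp
      next
        case False
        then show ?thesis using rho sg k by (simp add: indicator_def)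
      qed
    qed
    have ig: "integrable dA (\<lambda>z. k * (indicator (Q J) z *\<^sub>R (bergman_density \<alpha> z * inverse (\<sigma> z))))"
      using int2[OF J(1)] unfolding set_integrable_def by (rule integrable_mult_right)
    have ig2: "integrable dA (\<lambda>z. indicator E z *\<^sub>R (g z)\<^sup>2)"
    proof (rule Bochner_Integration.integrable_bound[OF ig])
      show "(\<lambda>z. indicat_real E z *\<^sub>R (g z)\<^sup>2) \<in> borel_measurable dA" unfolding g_def by measurable
    qed (use dom in \<open>auto elim!: eventually_mono\<close>)
    have "(\<integral>z. indicator E z *\<^sub>R (g z)\<^sup>2 \<partial>dA) \<le> (\<integral>z. k * (indicator (Q J) z *\<^sub>R (bergman_density \<alpha> z * inverse (\<sigma> z))) \<partial>dA)"
      using dom by (intro integral_mono_AE ig ig2) (auto elim!: eventually_mono)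
    also have "\<dots> = k * R" by (simp add: R_def set_lebesgue_integral_def)
    finally have gR: "(LINT z:E|dA. (g z)\<^sup>2) \<le> k * R" by (simp add: set_lebesgue_integral_def)
    have if2E: "set_integrable dA E (\<lambda>z. (f z)\<^sup>2)"
      unfolding set_integrable_def by (rule integrable_mult_indicator[OF _ if2]) measurable
    have fX: "(LINT z:E|dA. (f z)\<^sup>2) \<le> X"
      unfolding Xf[symmetric] set_lebesgue_integral_def
      using if2E if2 by (intro integral_mono) (auto simp: set_integrable_def indicator_def)
    have CS: "set_integrable dA E (\<lambda>z. f z * g z)"
      "(LINT z:E|dA. f z * g z)\<^sup>2 \<le> (LINT z:E|dA. (f z)\<^sup>2) * (LINT z:E|dA. (g z)\<^sup>2)"
      using ig2 by (intro Cauchy_Schwarz_set_integral if2E; simp add: set_borel_measurable_def set_integrable_def f_def g_def)+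
    have fg: "AE z in dA. indicator E z *\<^sub>R (f z * g z) = indicator E z *\<^sub>R norm (F z)"
      using weight_density_pos[OF \<alpha> \<sigma>]
    proof eventually_elim
      case (elim z)
      then have "0 < W z" by (simp add: W_def)
      then show ?case by (simp add: f_def g_def real_sqrt_inverse)
    qed
    have mF: "(\<lambda>z. indicator E z *\<^sub>R norm (F z)) \<in> borel_measurable dA" "(\<lambda>z. indicator E z *\<^sub>R (f z * g z)) \<in> borel_measurable dA"
      unfolding f_def g_def by measurable
    have fg': "AE z in dA. indicator E z *\<^sub>R norm (F z) = indicator E z *\<^sub>R (f z * g z)"
      using fg by eventually_elim (rule sym)
    have iF: "set_integrable dA E (\<lambda>z. norm (F z))"
      using CS(1) unfolding set_integrable_def by (rule integrable_cong_AE_imp[OF _ mF(1) fg])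
    have eqF: "(LINT z:E|dA. norm (F z)) = (LINT z:E|dA. f z * g z)"
      unfolding set_lebesgue_integral_def by (rule integral_cong_AE[OF mF fg'])
    have X0: "0 \<le> X" unfolding Xf[symmetric] by simp
    have g0: "0 \<le> (LINT z:E|dA. (g z)\<^sup>2)" unfolding set_lebesgue_integral_def by simp
    have "(LINT z:E|dA. norm (F z))\<^sup>2 \<le> X * (k * R)"
      unfolding eqF using fX gR g0 X0 by (intro order_trans[OF CS(2)] mult_mono) auto
    also have "\<dots> \<le> (O'\<^sup>2 * (k * S)) * (k * R)"
      using XS gR g0 by (intro mult_right_mono) auto
    also have "\<dots> = O'\<^sup>2 * k\<^sup>2 * (S * R)" by (simp add: power2_eq_square)
    also have "\<dots> \<le> O'\<^sup>2 * k\<^sup>2 * (A * (len J powr (2 + \<alpha>))\<^sup>2)"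
      unfolding S_def R_def by (intro mult_left_mono A2 J) auto
    also have "\<dots> \<le> O'\<^sup>2 * k\<^sup>2 * (A * (M * (l\<^sup>2 * L))\<^sup>2)"
    proof -
      have "len J powr (2 + \<alpha>) \<le> (Cc * ((N + 1) * l)) powr (2 + \<alpha>)"
        using J(4) lJ l \<alpha> by (intro powr_mono2) auto
      also have "\<dots> = M * l powr (2 + \<alpha>)"
        using Cc N l by (simp add: M_def powr_mult)
      also have "l powr (2 + \<alpha>) = l\<^sup>2 * L" using l by (simp add: powr_add L_def)
      finally show ?thesis using A by (intro mult_left_mono power_mono) auto
    qed
    also have "\<dots> = (O' * k * sqrt A * (M * (l\<^sup>2 * L)))\<^sup>2"
      using A by (simp add: power_mult_distrib)
    finally have "(LINT z:E|dA. norm (F z)) \<le> O' * k * sqrt A * (M * (l\<^sup>2 * L))"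
      by (rule power2_le_imp_le) (use O' k A M L in auto)
    also have "\<dots> = C * O' * (1 / L) * l\<^sup>2"
      using L c by (simp add: C_def k_def power2_eq_square field_simps)
    finally show ?thesis using iF img(1) unfolding L E_def E'_def F_def O'_def by simp
  qed
  show ?thesis by (rule that[OF C main])
qed


section \<open>Lower bounds for the norm of the commutator\<close>

lemma oscillation_from_whitney_boxes:
  assumes b: "b \<in> L2 dA" and p: "p = 1 \<or> p = (2::nat)"
    and W: "\<And>a l. 0 < l \<Longrightarrow> \<exists>c. (LINT z:whitney a l|dA. norm (b z - c) ^ p) \<le> 12 * \<tau> ^ p * l\<^sup>2"
    and l: "0 < l"
  shows "(LINT z:Q {a..<a + l}|dA. norm (b z - average b (Q {a..<a + l})) ^ p) / measure dA (Q {a..<a + l})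
     \<le> 6048 * \<tau> ^ p"
proof -
  have mQ: "measure dA (Q {a..<a + l}) = l\<^sup>2"
    using Q_dA[OF l] Q_halfopen_lmeasurable[OF l] by simp
  obtain c where "(LINT z:Q {a..<a + l}|dA. norm (b z - c) ^ p) \<le> 112 * (12 * \<tau> ^ p) * l\<^sup>2"
    using carleson_oscillation_from_whitney[OF b p W l] by blast
  moreover have "(LINT z:Q {a..<a + l}|dA. norm (b z - average b (Q {a..<a + l})) ^ p)
      \<le> 9 / 2 * (LINT z:Q {a..<a + l}|dA. norm (b z - c) ^ p)"
    using l mQ by (intro mean_osc_le b Q_dA p) auto
  ultimately show ?thesis using l by (simp add: mQ field_simps)
qed

text \<open>
  The common end of both lower bounds, with the size of the commutator on test boxes as a
  hypothesis: distant Whitney boxes give the oscillation on each of them, and the recursion over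
  generations carries it to Carleson boxes.
\<close>

lemma oscillation_le_commutator_norm:
  assumes \<alpha>: "-1 < \<alpha>" and p: "p = 1 \<or> p = (2::nat)"
    and bnd: "\<And>N. 1 \<le> N \<Longrightarrow> \<exists>C>0. \<forall>b T a a' l. commutator_extension \<alpha> \<sigma> b T \<longrightarrow> 0 < l \<longrightarrow> \<bar>a - a'\<bar> \<le> N * l \<longrightarrow>
       T (box_test \<alpha> (whitney a' l)) \<in> borel_measurable dA \<and>
       set_integrable dA (whitney a l) (\<lambda>z. norm (T (box_test \<alpha> (whitney a' l)) z) ^ p) \<and>
       (LINT z:whitney a l|dA. norm (T (box_test \<alpha> (whitney a' l)) z) ^ p)
         \<le> (C * operator_norm (weighted \<alpha> \<sigma>) T * l powr (- \<alpha>)) ^ p * l\<^sup>2"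
  obtains C where "0 < C"
    "\<And>b T a l. b \<in> L2 dA \<Longrightarrow> commutator_extension \<alpha> \<sigma> b T \<Longrightarrow> 0 < l \<Longrightarrow>
       (LINT z:Q {a..<a + l}|dA. norm (b z - average b (Q {a..<a + l})) ^ p) / measure dA (Q {a..<a + l})
         \<le> 6048 * (C * operator_norm (weighted \<alpha> \<sigma>) T) ^ p"
proof -
  obtain N \<kappa> where N: "1 \<le> N" and \<kappa>: "0 < \<kappa>" and far:
    "\<And>b p a l \<tau> F F'. b \<in> L2 dA \<Longrightarrow> p = 1 \<or> p = (2::nat) \<Longrightarrow> 0 < l \<Longrightarrow> 0 \<le> \<tau> \<Longrightarrow>
       F \<in> borel_measurable dA \<Longrightarrow> F' \<in> borel_measurable dA \<Longrightarrow>
       AE z in dA. F z = commutator \<alpha> b (box_test \<alpha> (whitney (a + N * l) l)) z \<Longrightarrow>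
       AE z in dA. F' z = commutator \<alpha> b (box_test \<alpha> (whitney a l)) z \<Longrightarrow>
       set_integrable dA (whitney a l) (\<lambda>z. norm (F z) ^ p) \<Longrightarrow>
       set_integrable dA (whitney (a + N * l) l) (\<lambda>z. norm (F' z) ^ p) \<Longrightarrow>
       (LINT z:whitney a l|dA. norm (F z) ^ p) \<le> (\<tau> * l powr (- \<alpha>)) ^ p * l\<^sup>2 \<Longrightarrow>
       (LINT z:whitney (a + N * l) l|dA. norm (F' z) ^ p) \<le> (\<tau> * l powr (- \<alpha>)) ^ p * l\<^sup>2 \<Longrightarrow>
       \<exists>c. (LINT z:whitney a l|dA. norm (b z - c) ^ p) \<le> 12 * (\<kappa> * \<tau>) ^ p * l\<^sup>2"
    by (rule far_box_oscillation[OF \<alpha>]) (rule that; assumption)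
  obtain C where C: "0 < C" and bnd': "\<forall>b T a a' l. commutator_extension \<alpha> \<sigma> b T \<longrightarrow> 0 < l \<longrightarrow> \<bar>a - a'\<bar> \<le> N * l \<longrightarrow>
       T (box_test \<alpha> (whitney a' l)) \<in> borel_measurable dA \<and>
       set_integrable dA (whitney a l) (\<lambda>z. norm (T (box_test \<alpha> (whitney a' l)) z) ^ p) \<and>
       (LINT z:whitney a l|dA. norm (T (box_test \<alpha> (whitney a' l)) z) ^ p)
         \<le> (C * operator_norm (weighted \<alpha> \<sigma>) T * l powr (- \<alpha>)) ^ p * l\<^sup>2"
    using bnd[OF N] by (elim exE conjE)
  have main: "(LINT z:Q {a0..<a0 + l0}|dA. norm (b z - average b (Q {a0..<a0 + l0})) ^ p) / measure dA (Q {a0..<a0 + l0})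
         \<le> 6048 * ((\<kappa> * C) * operator_norm (weighted \<alpha> \<sigma>) T) ^ p"
    if b: "b \<in> L2 dA" and T: "commutator_extension \<alpha> \<sigma> b T" and l0: "0 < l0" for b T a0 l0
  proof -
    define O' where "O' = operator_norm (weighted \<alpha> \<sigma>) T"
    have bo: "bounded_operator (weighted \<alpha> \<sigma>) T" using T by (simp add: commutator_extension_def)
    have O': "0 \<le> O'" unfolding O'_def by (rule operator_norm_bounds(1)[OF bo])
    have ae: "AE z in dA. T (box_test \<alpha> (rect a a' c d)) z = commutator \<alpha> b (box_test \<alpha> (rect a a' c d)) z"
      if c: "0 < c" for a a' c d
      using T box_test_in_test_functions[OF \<alpha> c] unfolding commutator_extension_def by blast
    have W: "\<exists>c. (LINT z:whitney a l|dA. norm (b z - c) ^ p) \<le> 12 * (\<kappa> * (C * O')) ^ p * l\<^sup>2"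
      if l: "0 < l" for a l
    proof -
      have l4: "0 < l / 4" using l by simp
      have Nl: "\<bar>a - (a + N * l)\<bar> \<le> N * l" "\<bar>a + N * l - a\<bar> \<le> N * l" using N l by auto
      note B = bnd'[rule_format, OF T l Nl(1), folded O'_def] bnd'[rule_format, OF T l Nl(2), folded O'_def]
      have CO: "0 \<le> C * O'" using C O' by simp
      show ?thesis
        using far[OF b p l CO B(1)[THEN conjunct1] B(2)[THEN conjunct1] ae[OF l4] ae[OF l4]
            B(1)[THEN conjunct2, THEN conjunct1] B(2)[THEN conjunct2, THEN conjunct1]
            B(1)[THEN conjunct2, THEN conjunct2] B(2)[THEN conjunct2, THEN conjunct2]] .
    qed
    show ?thesis
      using oscillation_from_whitney_boxes[OF b p W l0, of a0] by (simp add: O'_def mult.assoc)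
  qed
  have "0 < \<kappa> * C" using \<kappa> C by simp
  then show ?thesis using main by (rule that)
qed

lemma mean_osc_le_commutator_norm:
  assumes \<alpha>: "-1 < \<alpha>" and adj: "adjacent_dyadic_systems \<D>1 \<D>2" and B2: "\<sigma> \<in> B2 \<alpha> (\<D>1 \<union> \<D>2)"
  obtains C where "0 < C"
    "\<And>b T I. b \<in> L2 dA \<Longrightarrow> commutator_extension \<alpha> \<sigma> b T \<Longrightarrow> I \<in> \<D>1 \<union> \<D>2 \<Longrightarrow>
       mean_osc b (Q I) \<le> C * operator_norm (weighted \<alpha> \<sigma>) T"
proof -
  have p: "(1::nat) = 1 \<or> (1::nat) = 2" by simp
  have bnd: "\<exists>C>0. \<forall>b T a a' l. commutator_extension \<alpha> \<sigma> b T \<longrightarrow> 0 < l \<longrightarrow> \<bar>a - a'\<bar> \<le> N * l \<longrightarrow>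
       T (box_test \<alpha> (whitney a' l)) \<in> borel_measurable dA \<and>
       set_integrable dA (whitney a l) (\<lambda>z. norm (T (box_test \<alpha> (whitney a' l)) z) ^ 1) \<and>
       (LINT z:whitney a l|dA. norm (T (box_test \<alpha> (whitney a' l)) z) ^ 1)
         \<le> (C * operator_norm (weighted \<alpha> \<sigma>) T * l powr (- \<alpha>)) ^ 1 * l\<^sup>2"
    if N: "1 \<le> N" for N
      unfolding power_one_right
    proof (rule box_bound_L1[OF \<alpha> adj B2 N], intro exI conjI allI impI, assumption)
    qed blast+
  obtain C where C: "0 < C" and osc:
    "\<And>b T a l. b \<in> L2 dA \<Longrightarrow> commutator_extension \<alpha> \<sigma> b T \<Longrightarrow> 0 < l \<Longrightarrow>
       (LINT z:Q {a..<a + l}|dA. norm (b z - average b (Q {a..<a + l})) ^ 1) / measure dA (Q {a..<a + l})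
         \<le> 6048 * (C * operator_norm (weighted \<alpha> \<sigma>) T) ^ 1"
    by (rule oscillation_le_commutator_norm[OF \<alpha> p], erule bnd) (rule that; assumption)
  show ?thesis
  proof (rule that[of "6048 * C"])
    show "0 < 6048 * C" using C by simp
    fix b T I assume b: "b \<in> L2 dA" and T: "commutator_extension \<alpha> \<sigma> b T" and I: "I \<in> \<D>1 \<union> \<D>2"
    obtain a l where Il: "I = {a..<a + l}" "0 < l" using adjacent_interval[OF adj I] .
    show "mean_osc b (Q I) \<le> 6048 * C * operator_norm (weighted \<alpha> \<sigma>) T"
      using osc[OF b T Il(2), of a] unfolding mean_osc_def Il(1) by simp
  qed
qed

lemma mean_osc2_le_commutator_norm:
  assumes \<alpha>: "-1 < \<alpha>" and adj: "adjacent_dyadic_systems \<D>1 \<D>2" and B2: "\<sigma> \<in> B2 \<alpha> (\<D>1 \<union> \<D>2)"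
    and pos: "\<And>z. z \<in> uhp \<Longrightarrow> 0 < \<sigma> z" and reg: "hyperbolically_regular \<sigma>"
  obtains C where "0 < C"
    "\<And>b T I. b \<in> L2 dA \<Longrightarrow> commutator_extension \<alpha> \<sigma> b T \<Longrightarrow> I \<in> \<D>1 \<union> \<D>2 \<Longrightarrow>
       mean_osc2 b (Q I) \<le> C * operator_norm (weighted \<alpha> \<sigma>) T"
proof -
  have p: "(2::nat) = 1 \<or> (2::nat) = 2" by simp
  have bnd: "\<exists>C>0. \<forall>b T a a' l. commutator_extension \<alpha> \<sigma> b T \<longrightarrow> 0 < l \<longrightarrow> \<bar>a - a'\<bar> \<le> N * l \<longrightarrow>
       T (box_test \<alpha> (whitney a' l)) \<in> borel_measurable dA \<and>
       set_integrable dA (whitney a l) (\<lambda>z. norm (T (box_test \<alpha> (whitney a' l)) z) ^ 2) \<and>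
       (LINT z:whitney a l|dA. norm (T (box_test \<alpha> (whitney a' l)) z) ^ 2)
         \<le> (C * operator_norm (weighted \<alpha> \<sigma>) T * l powr (- \<alpha>)) ^ 2 * l\<^sup>2"
    if N: "1 \<le> N" for N
    proof (rule box_bound_L2[OF \<alpha> B2_weight[OF B2] pos reg N B2_rect_integrable[OF \<alpha> adj B2]], assumption, assumption,
        intro exI conjI allI impI, assumption)
    qed blast+
  obtain C where C: "0 < C" and osc:
    "\<And>b T a l. b \<in> L2 dA \<Longrightarrow> commutator_extension \<alpha> \<sigma> b T \<Longrightarrow> 0 < l \<Longrightarrow>
       (LINT z:Q {a..<a + l}|dA. norm (b z - average b (Q {a..<a + l})) ^ 2) / measure dA (Q {a..<a + l})
         \<le> 6048 * (C * operator_norm (weighted \<alpha> \<sigma>) T) ^ 2"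
    by (rule oscillation_le_commutator_norm[OF \<alpha> p], erule bnd) (rule that; assumption)
  show ?thesis
  proof (rule that[of "78 * C"])
    show "0 < 78 * C" using C by simp
    fix b T I assume b: "b \<in> L2 dA" and T: "commutator_extension \<alpha> \<sigma> b T" and I: "I \<in> \<D>1 \<union> \<D>2"
    obtain a l where Il: "I = {a..<a + l}" "0 < l" using adjacent_interval[OF adj I] .
    have bo: "bounded_operator (weighted \<alpha> \<sigma>) T" using T by (simp add: commutator_extension_def)
    define O' where "O' = operator_norm (weighted \<alpha> \<sigma>) T"
    have O': "0 \<le> O'" unfolding O'_def by (rule operator_norm_bounds(1)[OF bo])
    have "(mean_osc2 b (Q I))\<^sup>2 \<le> 6048 * (C * O')\<^sup>2"
    proof -
      have "0 \<le> (LINT z:Q I|dA. norm (b z - average b (Q I)) ^ 2) / measure dA (Q I)"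
        unfolding set_lebesgue_integral_def by simp
      then show ?thesis
        using osc[OF b T Il(2), of a] unfolding mean_osc2_def Il(1) O'_def by simp
    qed
    also have "\<dots> \<le> (78 * (C * O'))\<^sup>2" unfolding power_mult_distrib by (intro mult_right_mono) auto
    finally have "mean_osc2 b (Q I) \<le> 78 * (C * O')"
      by (rule power2_le_imp_le) (use C O' in simp)
    then show "mean_osc2 b (Q I) \<le> 78 * C * operator_norm (weighted \<alpha> \<sigma>) T" by (simp add: O'_def)
  qed
qed


section \<open>Geometry of a dyadic system\<close>

definition tile :: "real set \<Rightarrow> complex set" where
  "tile I = {z. Re z \<in> I \<and> len I / 2 \<le> Im z \<and> Im z < len I}"

lemma tile_halfopen: "0 \<le> l \<Longrightarrow> tile {a..<a + l} = rect a (a + l) (l / 2) l"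
  by (auto simp: tile_def rect_def len_halfopen)

lemma tile_subset_Q: "0 < len I \<Longrightarrow> tile I \<subseteq> Q I"
  by (auto simp: tile_def Q_def)

lemma dyadic_pos: "dyadic_system \<D> \<Longrightarrow> I \<in> \<D> \<Longrightarrow> 0 < len I"
  by (rule dyadic_system_interval)

lemma dyadic_nested:
  assumes "dyadic_system \<D>" "I \<in> \<D>" "J \<in> \<D>"
  shows "I \<subseteq> J \<or> J \<subseteq> I \<or> I \<inter> J = {}"
proof -
  note 1 = assms(1)[unfolded dyadic_system_def, THEN conjunct2, THEN conjunct2]
  show ?thesis using 1 assms(2,3) by (simp only: Ball_def)
qed

lemma dyadic_len_mono:
  assumes D: "dyadic_system \<D>" and I: "I \<in> \<D>" and J: "J \<in> \<D>" and sub: "I \<subseteq> J"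
  shows "len I \<le> len J"
proof -
  obtain a k where a: "I = {a..<a + 2 powi k}" "len I = 2 powi k" "0 < len I" by (rule dyadic_system_interval[OF D I])
  obtain c m where c: "J = {c..<c + 2 powi m}" "len J = 2 powi m" "0 < len J" by (rule dyadic_system_interval[OF D J])
  have "a < a + 2 powi k" using a by simp
  then have "c \<le> a \<and> a + 2 powi k \<le> c + 2 powi m"
    using atLeastLessThan_subset_iff[OF sub[unfolded a(1) c(1)]] by linarith
  then show ?thesis unfolding a(2) c(2) by linarith
qed

lemma dyadic_eq:
  assumes D: "dyadic_system \<D>" and I: "I \<in> \<D>" and J: "J \<in> \<D>" and sub: "I \<subseteq> J" and len: "len I = len J"
  shows "I = J"
proof -
  obtain a k where a: "I = {a..<a + 2 powi k}" "len I = 2 powi k" "0 < len I" by (rule dyadic_system_interval[OF D I])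
  obtain c m where c: "J = {c..<c + 2 powi m}" "len J = 2 powi m" "0 < len J" by (rule dyadic_system_interval[OF D J])
  have "a < a + 2 powi k" using a by simp
  then have "c \<le> a \<and> a + 2 powi k \<le> c + 2 powi m"
    using atLeastLessThan_subset_iff[OF sub[unfolded a(1) c(1)]] by linarith
  then have "a = c" using len a(2) c(2) by linarith
  then show ?thesis using len a c by simp
qed

lemma dyadic_subset_of_len_le:
  assumes D: "dyadic_system \<D>" and I: "I \<in> \<D>" and J: "J \<in> \<D>"
    and x: "x \<in> I" "x \<in> J" and len: "len I \<le> len J"
  shows "I \<subseteq> J"
proof -
  from dyadic_nested[OF D I J] x consider "I \<subseteq> J" | "J \<subseteq> I" by blast
  then show ?thesis
  proof cases
    case 2
    then have "len J = len I" using dyadic_len_mono[OF D J I] len by simp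
    then show ?thesis using dyadic_eq[OF D J I 2] by simp
  qed
qed

lemma dyadic_cover:
  assumes D: "dyadic_system \<D>"
  obtains I where "I \<in> \<D>" "len I = 2 powi k" "x \<in> I"
proof -
  have "\<forall>k::int. partition_on UNIV {I\<in>\<D>. len I = 2 powi k}"
    using D[unfolded dyadic_system_def, THEN conjunct2] by (rule conjunct1)
  then have "partition_on UNIV {I\<in>\<D>. len I = 2 powi k}" by (rule spec)
  then have "\<Union>{I\<in>\<D>. len I = 2 powi k} = UNIV" by (simp add: partition_on_def)
  then have "x \<in> \<Union>{I\<in>\<D>. len I = 2 powi k}" by simp
  then show ?thesis using that by blast
qed

lemma dyadic_tile_cover:
  assumes D: "dyadic_system \<D>" and z: "z \<in> uhp"
  obtains J where "J \<in> \<D>" "z \<in> tile J"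
proof -
  have y: "0 < Im z" using z by (simp add: uhp_def)
  define k where "k = \<lfloor>log 2 (Im z)\<rfloor>"
  have "2 powr (of_int k) \<le> Im z" "Im z < 2 powr (of_int k + 1)"
    using y by (auto simp: k_def le_log_iff[symmetric] log_less_iff[symmetric])
  moreover have "(2::real) powr (of_int k + 1) = 2 powi (k + 1)" "(2::real) powr (of_int k) = 2 powi (k + 1) / 2"
    using powr_real_of_int'[of 2 "k + 1"] powr_real_of_int'[of 2 k] by (simp_all add: power_int_add)
  ultimately have k: "2 powi (k + 1) / 2 \<le> Im z" "Im z < 2 powi (k + 1)" by simp_all
  obtain J where J: "J \<in> \<D>" "len J = 2 powi (k + 1)" "Re z \<in> J" by (rule dyadic_cover[OF D])
  show ?thesis by (rule that[OF J(1)]) (use J k in \<open>simp add: tile_def\<close>)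
qed

lemma dyadic_double_le:
  assumes D: "dyadic_system \<D>" and I: "I \<in> \<D>" and J: "J \<in> \<D>" and less: "len J < len I"
  shows "2 * len J \<le> len I"
proof -
  obtain a k where a: "I = {a..<a + 2 powi k}" "len I = 2 powi k" "0 < len I" by (rule dyadic_system_interval[OF D I])
  obtain c m where c: "J = {c..<c + 2 powi m}" "len J = 2 powi m" "0 < len J" by (rule dyadic_system_interval[OF D J])
  have "m < k"
  proof (rule ccontr)
    assume "\<not> m < k"
    then have "(2::real) powi k \<le> 2 powi m" by (intro power_int_increasing) auto
    with less a c show False by simp
  qed
  then have "(2::real) powi (m + 1) \<le> 2 powi k" by (intro power_int_increasing) auto
  then show ?thesis unfolding a(2) c(2) by (simp add: power_int_add)
qed

lemma tile_in_Q_iff: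
  assumes D: "dyadic_system \<D>" and I: "I \<in> \<D>" and J: "J \<in> \<D>" and z: "z \<in> tile J"
  shows "z \<in> Q I \<longleftrightarrow> J \<subseteq> I"
proof
  assume zI: "z \<in> Q I"
  have "len J \<le> len I"
  proof (rule ccontr)
    assume "\<not> len J \<le> len I"
    then have "2 * len I \<le> len J" by (intro dyadic_double_le[OF D J I]) simp
    with z zI show False by (simp add: tile_def Q_def)
  qed
  then show "J \<subseteq> I" using z zI by (intro dyadic_subset_of_len_le[OF D J I, of "Re z"]) (auto simp: tile_def Q_def)
next
  assume sub: "J \<subseteq> I"
  have "0 < len J" by (rule dyadic_pos[OF D J])
  then show "z \<in> Q I" using z sub dyadic_len_mono[OF D J I sub] by (auto simp: tile_def Q_def)
qed

lemma tile_unique: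
  assumes D: "dyadic_system \<D>" and I: "I \<in> \<D>" and J: "J \<in> \<D>" and z: "z \<in> tile I" "z \<in> tile J"
  shows "I = J"
proof
  have "z \<in> Q I" "z \<in> Q J" using z tile_subset_Q[OF dyadic_pos[OF D I]] tile_subset_Q[OF dyadic_pos[OF D J]] by auto
  then show "I \<subseteq> J" "J \<subseteq> I"
    using tile_in_Q_iff[OF D J I z(1)] tile_in_Q_iff[OF D I J z(2)] by simp_all
qed

lemma dyadic_parent:
  assumes D: "dyadic_system \<D>" and J: "J \<in> \<D>"
  obtains P where "P \<in> \<D>" "J \<subseteq> P" "len P = 2 * len J"
proof -
  obtain c m where c: "J = {c..<c + 2 powi m}" "len J = 2 powi m" "0 < len J" by (rule dyadic_system_interval[OF D J])
  obtain P where P: "P \<in> \<D>" "len P = 2 powi (m + 1)" "c \<in> P" by (rule dyadic_cover[OF D])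
  have len: "len P = 2 * len J" using P(2) c(2) by (simp add: power_int_add)
  have "c \<in> J" using c by simp
  then have "J \<subseteq> P" using P len c(3) by (intro dyadic_subset_of_len_le[OF D J P(1), of c]) auto
  then show ?thesis using P(1) len by (intro that)
qed

lemma dyadic_laminar:
  assumes D: "dyadic_system \<D>" and "\<F> \<subseteq> \<D>"
  shows "laminar \<F>"
  unfolding laminar_def
proof (intro conjI ballI)
  show "{} \<notin> \<F>"
  proof
    assume "{} \<in> \<F>"
    then have "0 < len {}" using assms by (intro dyadic_pos[OF D]) auto
    then show False by (simp add: len_def)
  qed
  fix I J assume "I \<in> \<F>" "J \<in> \<F>"
  then show "I \<subseteq> J \<or> J \<subseteq> I \<or> I \<inter> J = {}" using assms(2) by (intro dyadic_nested[OF D]) auto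
qed

text \<open>
  A finite part of the system that is closed under intermediate intervals. As \<open>m\<close> grows it
  exhausts the system.
\<close>

definition dyadic_window :: "real set set \<Rightarrow> nat \<Rightarrow> real set set" where
  "dyadic_window \<D> m = {L\<in>\<D>. 2 powi (- int m) \<le> len L \<and> len L \<le> 2 powi (int m) \<and> L \<inter> {-(2^m)..2^m} \<noteq> {}}"

lemma dyadic_window_convex:
  assumes D: "dyadic_system \<D>" and "J \<in> dyadic_window \<D> m" "I \<in> dyadic_window \<D> m" "L \<in> \<D>" "J \<subseteq> L" "L \<subseteq> I"
  shows "L \<in> dyadic_window \<D> m"
  using assms dyadic_len_mono[OF D, of J L] dyadic_len_mono[OF D, of L I]
  unfolding dyadic_window_def by fastforce

text \<open>
  An interval of the window is determined by its generation and by the integer part of its left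
  end point in units of its length: two intervals with the same data overlap.
\<close>

lemma finite_dyadic_window:
  assumes D: "dyadic_system \<D>"
  shows "finite (dyadic_window \<D> m)"
proof -
  define B where "B = (2::real) ^ m"
  have B: "1 \<le> B" by (simp add: B_def)
  define key where "key L = (\<lfloor>log 2 (len L)\<rfloor>, \<lfloor>Inf L / len L\<rfloor>)" for L
  have "inj_on key (dyadic_window \<D> m)"
  proof (rule inj_onI)
    fix I J assume I: "I \<in> dyadic_window \<D> m" and J: "J \<in> dyadic_window \<D> m" and eq: "key I = key J"
    have ID: "I \<in> \<D>" "J \<in> \<D>" using I J by (auto simp: dyadic_window_def)
    obtain a k where a: "I = {a..<a + 2 powi k}" "len I = 2 powi k" "0 < len I" by (rule dyadic_system_interval[OF D ID(1)])
    obtain c j where c: "J = {c..<c + 2 powi j}" "len J = 2 powi j" "0 < len J" by (rule dyadic_system_interval[OF D ID(2)])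
    have lg: "log 2 (2 powi i) = of_int i" for i :: int
      using powr_real_of_int'[of 2 i] log_powr_cancel[of 2 "of_int i"] by simp
    have "k = j" using eq by (simp add: key_def a(2) c(2) lg)
    define l where "l = (2::real) powi k"
    have l: "0 < l" using a by (simp add: l_def)
    have IJ: "I = {a..<a + l}" "J = {c..<c + l}" "len I = l" "len J = l" using a c \<open>k = j\<close> by (simp_all add: l_def)
    have inf: "Inf I = a" "Inf J = c" using l by (simp_all add: IJ)
    have "\<lfloor>a / l\<rfloor> = \<lfloor>c / l\<rfloor>" using eq by (simp add: key_def inf IJ(3,4))
    then have "\<bar>a / l - c / l\<bar> < 1" by linarith
    then have "\<bar>a - c\<bar> < l" using l by (simp add: field_simps abs_less_iff)
    then have "max a c \<in> I" "max a c \<in> J" using l unfolding IJ(1,2) by auto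
    then have "I \<subseteq> J" by (intro dyadic_subset_of_len_le[OF D ID]) (auto simp: IJ(3,4))
    then show "I = J" by (intro dyadic_eq[OF D ID]) (auto simp: IJ(3,4))
  qed
  moreover have "key ` dyadic_window \<D> m \<subseteq> {- int m..int m} \<times> {- \<lceil>2 * B * B\<rceil> - 1..\<lceil>2 * B * B\<rceil>}"
  proof
    fix q assume "q \<in> key ` dyadic_window \<D> m"
    then obtain L where L: "L \<in> dyadic_window \<D> m" and q: "q = key L" by auto
    have LD: "L \<in> \<D>" using L by (auto simp: dyadic_window_def)
    obtain a k where a: "L = {a..<a + 2 powi k}" "len L = 2 powi k" "0 < len L" by (rule dyadic_system_interval[OF D LD])
    have lg: "log 2 (2 powi i) = of_int i" for i :: int
      using powr_real_of_int'[of 2 i] log_powr_cancel[of 2 "of_int i"] by simp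
    have b: "2 powi (- int m) \<le> len L" "len L \<le> 2 powi (int m)" "L \<inter> {-B..B} \<noteq> {}"
      using L by (auto simp: dyadic_window_def B_def)
    have "log 2 (2 powi (- int m)) \<le> log 2 (len L)" "log 2 (len L) \<le> log 2 (2 powi (int m))"
      using b(1,2) a(3) by (auto intro!: log_mono simp del: power_int_of_nat)
    then have 1: "- int m \<le> k" "k \<le> int m" unfolding a(2) lg by linarith+
    define l where "l = len L"
    have l: "0 < l" "1 / B \<le> l" "l \<le> B" using a b by (simp_all add: l_def B_def power_int_minus inverse_eq_divide)
    have inf: "Inf L = a" using a by simp
    have "- B - l \<le> a" "a \<le> B" using b(3) a by (auto simp: l_def)
    then have aB: "\<bar>a\<bar> \<le> 2 * B" using l by linarith
    have "\<bar>a / l\<bar> = \<bar>a\<bar> * (1 / l)" using l by simp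
    also have "\<dots> \<le> (2 * B) * B"
      using aB l B by (intro mult_mono) (auto simp: field_simps)
    finally have "\<bar>a / l\<bar> \<le> 2 * B * B" .
    then have "- \<lceil>2 * B * B\<rceil> - 1 \<le> \<lfloor>a / l\<rfloor>" "\<lfloor>a / l\<rfloor> \<le> \<lceil>2 * B * B\<rceil>" by linarith+
    then show "q \<in> {- int m..int m} \<times> {- \<lceil>2 * B * B\<rceil> - 1..\<lceil>2 * B * B\<rceil>}"
      using 1 by (simp add: q key_def inf a(2) lg l_def)
  qed
  ultimately show ?thesis by (rule inj_on_finite) auto
qed

section \<open>Averages along a dyadic system\<close>

lemma dyadic_Q_dA:
  assumes D: "dyadic_system \<D>" and I: "I \<in> \<D>"
  shows "Q I \<in> sets dA" "emeasure dA (Q I) < \<infinity>" "measure dA (Q I) = (len I)\<^sup>2"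
    and "tile I \<in> sets dA" "emeasure dA (tile I) < \<infinity>" "measure dA (tile I) = (len I)\<^sup>2 / 2"
proof -
  obtain a k where a: "I = {a..<a + 2 powi k}" "len I = 2 powi k" "0 < len I" by (rule dyadic_system_interval[OF D I])
  define l where "l = (2::real) powi k"
  have l: "0 < l" "I = {a..<a + l}" "len I = l" using a by (simp_all add: l_def)
  have t: "tile I = rect a (a + l) (l / 2) l" unfolding l(2) using l(1) by (simp add: tile_halfopen)
  have l2: "0 < l / 2" using l by simp
  show "Q I \<in> sets dA" "emeasure dA (Q I) < \<infinity>" "measure dA (Q I) = (len I)\<^sup>2"
    unfolding l(3) unfolding l(2) using Q_dA[OF l(1)] Q_halfopen_lmeasurable(2)[OF l(1)] by simp_all
  show "tile I \<in> sets dA" "emeasure dA (tile I) < \<infinity>" "measure dA (tile I) = (len I)\<^sup>2 / 2"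
    unfolding t l(3) using rect_dA[OF l2] l by (simp_all add: measure_rect power2_eq_square)
qed

lemma average_parent:
  assumes D: "dyadic_system \<D>" and b: "b \<in> L2 dA" and \<beta>: "0 \<le> \<beta>"
    and osc: "\<And>I. I \<in> \<D> \<Longrightarrow> (LINT z:Q I|dA. (norm (b z - average b (Q I)))\<^sup>2) \<le> \<beta>\<^sup>2 * (len I)\<^sup>2"
    and J: "J \<in> \<D>" and P: "P \<in> \<D>" "J \<subseteq> P" "len P = 2 * len J"
  shows "norm (average b (Q J) - average b (Q P)) \<le> 2 * \<beta>"
proof -
  note J' = dyadic_Q_dA[OF D J] and P' = dyadic_Q_dA[OF D P(1)]
  have pos: "0 < len J" by (rule dyadic_pos[OF D J])
  have sub: "Q J \<subseteq> Q P" using P pos by (auto simp: Q_def)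
  have "(len J)\<^sup>2 * (norm (average b (Q J) - average b (Q P)))\<^sup>2 \<le> (LINT z:Q J|dA. (norm (b z - average b (Q P)))\<^sup>2)"
    using average_close[OF b J'(1,2), of 2 "average b (Q P)"] pos by (simp add: J'(3))
  also have "\<dots> \<le> (LINT z:Q P|dA. (norm (b z - average b (Q P)))\<^sup>2)"
    using L2_set_integrable(2)[OF b P'(1,2), of 2] by (intro set_integral_subset_mono J' sub) auto
  also have "\<dots> \<le> \<beta>\<^sup>2 * (2 * len J)\<^sup>2" using osc[OF P(1)] P(3) by simp
  also have "\<dots> = (len J)\<^sup>2 * (2 * \<beta>)\<^sup>2" by (simp add: power_mult_distrib)
  finally have "(norm (average b (Q J) - average b (Q P)))\<^sup>2 \<le> (2 * \<beta>)\<^sup>2" using pos by simp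
  then show ?thesis by (rule power2_le_imp_le) (use \<beta> in simp)
qed

text \<open>
  Climb from \<open>J\<close> to \<open>I\<close> through the parents. Each step costs \<open>2 \<beta>\<close> and uses up one of the intervals that are counted.
\<close>

lemma average_telescope:
  assumes D: "dyadic_system \<D>" and b: "b \<in> L2 dA" and \<beta>: "0 \<le> \<beta>"
    and osc: "\<And>I. I \<in> \<D> \<Longrightarrow> (LINT z:Q I|dA. (norm (b z - average b (Q I)))\<^sup>2) \<le> \<beta>\<^sup>2 * (len I)\<^sup>2"
    and F: "finite \<F>" "\<F> \<subseteq> \<D>"
    and conv: "\<And>J L I. J \<in> \<F> \<Longrightarrow> I \<in> \<F> \<Longrightarrow> L \<in> \<D> \<Longrightarrow> J \<subseteq> L \<Longrightarrow> L \<subseteq> I \<Longrightarrow> L \<in> \<F>"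
    and IJ: "J \<in> \<F>" "I \<in> \<F>" "J \<subseteq> I"
  shows "norm (average b (Q J) - average b (Q I)) \<le> 2 * \<beta> * real (card {L\<in>\<F>. J \<subseteq> L \<and> L \<subseteq> I})"
  using IJ
proof (induction "card {L\<in>\<F>. J \<subseteq> L \<and> L \<subseteq> I}" arbitrary: J rule: less_induct)
  case less
  show ?case
  proof (cases "J = I")
    case True
    then show ?thesis using \<beta> by simp
  next
    case False
    have JD: "J \<in> \<D>" and ID: "I \<in> \<D>" using less.prems F by auto
    obtain P where P: "P \<in> \<D>" "J \<subseteq> P" "len P = 2 * len J" by (rule dyadic_parent[OF D JD])
    have pos: "0 < len J" by (rule dyadic_pos[OF D JD])
    have "len J < len I"
      using dyadic_len_mono[OF D JD ID less.prems(3)] dyadic_eq[OF D JD ID less.prems(3)] False by fastforce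
    then have lP: "len P \<le> len I" using dyadic_double_le[OF D ID JD] P by simp
    obtain x where x: "x \<in> J"
    proof -
      obtain c m where "J = {c..<c + 2 powi m}" "len J = 2 powi m" "0 < len J" by (rule dyadic_system_interval[OF D JD])
      then show ?thesis by (intro that[of c]) auto
    qed
    have PI: "P \<subseteq> I" using x P(2) less.prems(3) lP by (intro dyadic_subset_of_len_le[OF D P(1) ID, of x]) auto
    have PF: "P \<in> \<F>" by (rule conv[OF less.prems(1,2) P(1,2) PI])
    have neq: "\<not> P \<subseteq> J" using dyadic_len_mono[OF D P(1) JD] P(3) pos by auto
    define S where "S = {L\<in>\<F>. J \<subseteq> L \<and> L \<subseteq> I}"
    define S' where "S' = {L\<in>\<F>. P \<subseteq> L \<and> L \<subseteq> I}"
    have "insert J S' \<subseteq> S" "J \<notin> S'" "finite S" using P(2) less.prems neq F by (auto simp: S_def S'_def)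
    then have card: "Suc (card S') \<le> card S"
      by (metis card_insert_disjoint card_mono finite_insert finite_subset)
    have "norm (average b (Q P) - average b (Q I)) \<le> 2 * \<beta> * real (card S')"
      unfolding S'_def using card PF PI less.prems by (intro less.hyps) (auto simp: S_def S'_def)
    moreover have "norm (average b (Q J) - average b (Q P)) \<le> 2 * \<beta>"
      by (rule average_parent[OF D b \<beta> osc JD P])
    moreover have "norm (average b (Q J) - average b (Q I))
        \<le> norm (average b (Q J) - average b (Q P)) + norm (average b (Q P) - average b (Q I))"
      by (metis norm_triangle_ineq diff_add_cancel add_diff_eq)
    ultimately have "norm (average b (Q J) - average b (Q I)) \<le> 2 * \<beta> * real (Suc (card S'))"
      by (simp add: algebra_simps)
    also have "\<dots> \<le> 2 * \<beta> * real (card S)" using card \<beta> by (intro mult_left_mono) auto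
    finally show ?thesis by (simp add: S_def)
  qed
qed

section \<open>The kernel and dyadic intervals\<close>

text \<open>
  An interval of twice the length \<open>|z - cnj w|\<close> contains both real parts, and this length exceeds
  both heights.
\<close>

lemma kernel_dyadic_bound:
  assumes \<alpha>: "-1 < \<alpha>" and adj: "adjacent_dyadic_systems \<D>1 \<D>2"
  obtains C where "0 < C"
    "\<And>z w. z \<in> uhp \<Longrightarrow> w \<in> uhp \<Longrightarrow> \<exists>I\<in>\<D>1 \<union> \<D>2. z \<in> Q I \<and> w \<in> Q I \<and>
       2 * norm (z - cnj w) \<le> len I \<and> len I \<le> C * norm (z - cnj w) \<and>
       norm (bergman_kernel \<alpha> z w) \<le> C powr (2 + \<alpha>) * (1 / len I powr (2 + \<alpha>))"
proof -
  obtain C0 where C0: "0 < C0" and cov: "\<And>a l. 0 < l \<Longrightarrow> \<exists>J\<in>\<D>1 \<union> \<D>2. {a..<a + l} \<subseteq> J \<and> l \<le> len J \<and> len J \<le> C0 * l"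
    by (rule adjacent_cover[OF adj]) (rule that; assumption)
  define C where "C = 2 * C0"
  have C: "0 < C" using C0 by (simp add: C_def)
  have main: "\<exists>I\<in>\<D>1 \<union> \<D>2. z \<in> Q I \<and> w \<in> Q I \<and>
       2 * norm (z - cnj w) \<le> len I \<and> len I \<le> C * norm (z - cnj w) \<and>
       norm (bergman_kernel \<alpha> z w) \<le> C powr (2 + \<alpha>) * (1 / len I powr (2 + \<alpha>))"
    if z: "z \<in> uhp" and w: "w \<in> uhp" for z w
  proof -
    define d where "d = norm (z - cnj w)"
    have im: "Im z + Im w \<le> d" using abs_Im_le_cmod[of "z - cnj w"] by (simp add: d_def)
    have re: "\<bar>Re z - Re w\<bar> \<le> d" using abs_Re_le_cmod[of "z - cnj w"] by (simp add: d_def)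
    have pz: "0 < Im z" "0 < Im w" using z w by (simp_all add: uhp_def)
    have d: "0 < d" using im pz by linarith
    define x where "x = min (Re z) (Re w)"
    have d2: "0 < 2 * d" using d by simp
    obtain I where I: "I \<in> \<D>1 \<union> \<D>2" "{x..<x + 2 * d} \<subseteq> I" "2 * d \<le> len I" "len I \<le> C0 * (2 * d)"
      using cov[OF d2] by blast
    have "x \<le> Re z \<and> Re z < x + 2 * d" "x \<le> Re w \<and> Re w < x + 2 * d"
      using re d unfolding x_def by linarith+
    then have xI: "Re z \<in> I" "Re w \<in> I" using I(2) by (auto simp: subset_iff)
    have lC: "len I \<le> C * d" using I(4) by (simp add: C_def)
    have "len I / C \<le> d" using lC C by (simp add: field_simps)
    moreover have "0 < len I / C" using I(3) d C by simp
    ultimately have "d powr (- (2 + \<alpha>)) \<le> (len I / C) powr (- (2 + \<alpha>))"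
      using \<alpha> by (intro powr_mono2') auto
    also have "\<dots> = C powr (2 + \<alpha>) * (1 / len I powr (2 + \<alpha>))"
      unfolding powr_minus_divide using I(3) d C by (simp add: powr_divide)
    finally have "norm (bergman_kernel \<alpha> z w) \<le> C powr (2 + \<alpha>) * (1 / len I powr (2 + \<alpha>))"
      unfolding norm_bergman_kernel d_def .
    moreover have "z \<in> Q I" "w \<in> Q I" using xI im pz I(3) d by (simp_all add: Q_def)
    ultimately show ?thesis using I(1,3) lC unfolding d_def by blast
  qed
  show ?thesis by (rule that[OF C main])
qed


section \<open>The commutator estimate in one dyadic system\<close>

text \<open>
  The data of the upper bound: a finite family \<open>\<F>\<close> of intervals of one dyadic system whose tiles
  cover the region \<open>E\<close>, and a function \<open>b\<close> whose oscillation in square mean on every \<open>Q I\<close> is at most \<open>\<beta>\<close>.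
\<close>

locale dyadic_commutator =
  fixes \<alpha> :: real and \<D> \<F> :: "real set set" and E :: "complex set"
    and b f :: "complex \<Rightarrow> complex" and \<beta> c C1 :: real
  assumes \<alpha>: "-1 < \<alpha>" and D: "dyadic_system \<D>"
    and fin: "finite \<F>" and FD: "\<F> \<subseteq> \<D>"
    and conv: "\<And>J L I. J \<in> \<F> \<Longrightarrow> I \<in> \<F> \<Longrightarrow> L \<in> \<D> \<Longrightarrow> J \<subseteq> L \<Longrightarrow> L \<subseteq> I \<Longrightarrow> L \<in> \<F>"
    and E: "E \<in> sets dA" "emeasure dA E < \<infinity>" and cover: "E \<subseteq> (\<Union>J\<in>\<F>. tile J)"
    and b: "b \<in> L2 dA" and f: "f \<in> borel_measurable dA" and f_bdd: "\<exists>B. \<forall>z\<in>uhp. norm (f z) \<le> B"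
    and \<beta>: "0 \<le> \<beta>"
    and osc: "\<And>I. I \<in> \<D> \<Longrightarrow> (LINT z:Q I|dA. (norm (b z - average b (Q I)))\<^sup>2) \<le> \<beta>\<^sup>2 * (len I)\<^sup>2"
    and c: "0 < c" "0 < C1"
    and sc: "\<And>l w. 0 < l \<Longrightarrow> l / 4 \<le> Im w \<Longrightarrow> Im w \<le> l \<Longrightarrow>
       c * l powr \<alpha> \<le> bergman_density \<alpha> w \<and> bergman_density \<alpha> w \<le> C1 * l powr \<alpha>"
begin

abbreviation m where "m J \<equiv> len J powr (2 + \<alpha>)"

text \<open>
  The number \<open>x J\<close> is up to a constant factor the square mean of \<open>f\<close> over the tile of \<open>J\<close>, \<open>n J I\<close> counts
  the generations from \<open>J\<close> to \<open>I\<close>, and \<open>h z w\<close> is the integrand of the commutator without the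
  kernel.
\<close>

definition S where "S J = tile J \<inter> E"

definition \<Phi> where "\<Phi> J = sqrt (LINT w:S J|dA. (norm (f w))\<^sup>2)"

definition x where "x J = \<Phi> J / len J"

definition n where "n J I = real (card {L\<in>\<F>. J \<subseteq> L \<and> L \<subseteq> I})"

definition h where "h z w = norm (b z - b w) * norm (f w) * bergman_density \<alpha> w"

definition g where "g J z = norm (b z - average b (Q J))"

lemma [measurable]: "b \<in> borel_measurable dA" "f \<in> borel_measurable dA" "E \<in> sets dA"
  using b f E by (auto simp: L2_def)

lemma pos: "J \<in> \<F> \<Longrightarrow> 0 < len J"
  using FD by (intro dyadic_pos[OF D]) auto

lemma m_pos: "J \<in> \<F> \<Longrightarrow> 0 < m J"
  using pos by fastforce

lemma m_eq: "J \<in> \<F> \<Longrightarrow> m J = (len J)\<^sup>2 * len J powr \<alpha>"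
  using pos[of J] by (simp add: powr_add)

lemma S_dA:
  assumes J: "J \<in> \<F>"
  shows "S J \<in> sets dA" "emeasure dA (S J) < \<infinity>" "measure dA (S J) \<le> (len J)\<^sup>2"
proof -
  note T = dyadic_Q_dA[OF D subsetD[OF FD J]]
  show s: "S J \<in> sets dA" unfolding S_def using T E by auto
  have le: "emeasure dA (S J) \<le> emeasure dA (tile J)" unfolding S_def by (rule emeasure_mono[OF _ T(4)]) auto
  then show "emeasure dA (S J) < \<infinity>" using T(5) by (rule order.strict_trans1)
  have "measure dA (S J) \<le> measure dA (tile J)"
    unfolding S_def using T E by (intro measure_mono_fmeasurable) (auto simp: fmeasurable_def)
  then show "measure dA (S J) \<le> (len J)\<^sup>2" using T(6) zero_le_power2[of "len J"] by linarith
qed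

lemma S_disjoint: "J \<in> \<F> \<Longrightarrow> K \<in> \<F> \<Longrightarrow> J \<noteq> K \<Longrightarrow> S J \<inter> S K = {}"
  using tile_unique[OF D] FD unfolding S_def by blast

lemma density_S:
  assumes "J \<in> \<F>" "w \<in> tile J"
  shows "c * len J powr \<alpha> \<le> bergman_density \<alpha> w" "bergman_density \<alpha> w \<le> C1 * len J powr \<alpha>"
  using sc[of "len J" w] pos[OF assms(1)] assms(2) by (auto simp: tile_def)

lemma \<Phi>_nonneg: "0 \<le> \<Phi> J" and x_nonneg: "J \<in> \<F> \<Longrightarrow> 0 \<le> x J"
proof -
  show "0 \<le> \<Phi> J" unfolding \<Phi>_def set_lebesgue_integral_def by simp
  then show "J \<in> \<F> \<Longrightarrow> 0 \<le> x J" unfolding x_def using pos[of J] by simp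
qed

lemma bounded_set_integrable:
  assumes T: "T \<in> sets dA" "emeasure dA T < \<infinity>" and u: "u \<in> borel_measurable dA" "\<And>z. z \<in> uhp \<Longrightarrow> norm (u z :: real) \<le> K"
  shows "set_integrable dA T u"
proof -
  have [measurable]: "u \<in> borel_measurable dA" "T \<in> sets dA" by fact+
  have "set_integrable dA T (\<lambda>z. \<bar>K\<bar>)" by (rule set_integrable_const_dA[OF T])
  then show ?thesis
    unfolding set_integrable_def
  proof (rule Bochner_Integration.integrable_bound)
    show "AE z in dA. norm (indicat_real T z *\<^sub>R u z) \<le> norm (indicat_real T z *\<^sub>R \<bar>K\<bar>)"
      using u(2) by (intro AE_I2) (fastforce simp: indicator_def)
  qed measurable
qed

lemma f_integrable:
  assumes T: "T \<in> sets dA" "emeasure dA T < \<infinity>"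
  shows "set_integrable dA T (\<lambda>w. norm (f w))" "set_integrable dA T (\<lambda>w. (norm (f w))\<^sup>2)"
proof -
  obtain B where B: "\<And>z. z \<in> uhp \<Longrightarrow> norm (f z) \<le> B" using f_bdd by blast
  show "set_integrable dA T (\<lambda>w. norm (f w))" by (rule bounded_set_integrable[OF T, where K = B]) (use B in auto)
  show "set_integrable dA T (\<lambda>w. (norm (f w))\<^sup>2)"
    by (rule bounded_set_integrable[OF T, where K = "B\<^sup>2"]) (use B in \<open>auto intro!: power_mono\<close>)
qed

lemma \<Phi>_sq: "(\<Phi> J)\<^sup>2 = (LINT w:S J|dA. (norm (f w))\<^sup>2)"
proof -
  have "0 \<le> (LINT w:S J|dA. (norm (f w))\<^sup>2)" unfolding set_lebesgue_integral_def by simp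
  then show ?thesis by (simp add: \<Phi>_def)
qed

lemma g_sq:
  assumes J: "J \<in> \<F>"
  shows "set_integrable dA (S J) (\<lambda>w. (g J w)\<^sup>2)" and "(LINT w:S J|dA. (g J w)\<^sup>2) \<le> \<beta>\<^sup>2 * (len J)\<^sup>2"
proof -
  have JD: "J \<in> \<D>" using J FD by auto
  note QJ = dyadic_Q_dA[OF D JD]
  have g2Q: "set_integrable dA (Q J) (\<lambda>w. (g J w)\<^sup>2)"
    unfolding g_def by (rule L2_set_integrable(2)[OF b QJ(1,2)]) simp
  have SQ: "S J \<subseteq> Q J" using tile_subset_Q[OF pos[OF J]] by (auto simp: S_def)
  show "set_integrable dA (S J) (\<lambda>w. (g J w)\<^sup>2)" by (rule set_integrable_subset[OF g2Q S_dA(1)[OF J] SQ])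
  have "(LINT w:S J|dA. (g J w)\<^sup>2) \<le> (LINT w:Q J|dA. (g J w)\<^sup>2)"
    by (rule set_integral_subset_mono[OF g2Q S_dA(1)[OF J] SQ]) simp
  also have "\<dots> \<le> \<beta>\<^sup>2 * (len J)\<^sup>2" unfolding g_def by (rule osc[OF JD])
  finally show "(LINT w:S J|dA. (g J w)\<^sup>2) \<le> \<beta>\<^sup>2 * (len J)\<^sup>2" .
qed

lemma f_tile:
  assumes J: "J \<in> \<F>"
  shows "(LINT w:S J|dA. norm (f w)) \<le> len J * \<Phi> J"
    and "set_integrable dA (S J) (\<lambda>w. g J w * norm (f w))"
    and "(LINT w:S J|dA. g J w * norm (f w)) \<le> \<beta> * len J * \<Phi> J"
proof -
  note SJ = S_dA[OF J] and fi = f_integrable[OF S_dA(1,2)[OF J]]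
  have [measurable]: "S J \<in> sets dA" by (rule SJ)
  have l: "0 < len J" by (rule pos[OF J])
  have one: "set_integrable dA (S J) (\<lambda>w. 1 :: real)" by (rule set_integrable_const_dA[OF SJ(1,2)])
  have m1: "set_borel_measurable dA (S J) (\<lambda>w. norm (f w))" "set_borel_measurable dA (S J) (\<lambda>w. 1::real)"
    "set_borel_measurable dA (S J) (g J)"
    unfolding set_borel_measurable_def g_def by measurable
  have "(LINT w:S J|dA. norm (f w) * 1)\<^sup>2 \<le> (LINT w:S J|dA. (norm (f w))\<^sup>2) * (LINT w:S J|dA. 1\<^sup>2)"
    using one by (intro Cauchy_Schwarz_set_integral SJ m1 fi) auto
  also have "\<dots> = (\<Phi> J)\<^sup>2 * measure dA (S J)"
    using set_integral_const_dA[OF SJ(1,2), of 1] by (simp add: \<Phi>_sq)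
  also have "\<dots> \<le> (\<Phi> J)\<^sup>2 * (len J)\<^sup>2" by (intro mult_left_mono SJ(3)) auto
  finally have "(LINT w:S J|dA. norm (f w))\<^sup>2 \<le> (len J * \<Phi> J)\<^sup>2" by (simp add: power_mult_distrib mult.commute)
  then show "(LINT w:S J|dA. norm (f w)) \<le> len J * \<Phi> J"
    by (rule power2_le_imp_le) (use l \<Phi>_nonneg in simp)
  note CS = Cauchy_Schwarz_set_integral[OF SJ(1) m1(3) m1(1) g_sq(1)[OF J] fi(2)]
  show "set_integrable dA (S J) (\<lambda>w. g J w * norm (f w))" by (rule CS(1))
  have "(LINT w:S J|dA. g J w * norm (f w))\<^sup>2 \<le> (LINT w:S J|dA. (g J w)\<^sup>2) * (\<Phi> J)\<^sup>2"
    using CS(2) by (simp add: \<Phi>_sq)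
  also have "\<dots> \<le> \<beta>\<^sup>2 * (len J)\<^sup>2 * (\<Phi> J)\<^sup>2" by (intro mult_right_mono g_sq(2)[OF J]) auto
  also have "\<dots> = (\<beta> * len J * \<Phi> J)\<^sup>2" by (simp add: power_mult_distrib)
  finally show "(LINT w:S J|dA. g J w * norm (f w)) \<le> \<beta> * len J * \<Phi> J"
    by (rule power2_le_imp_le) (use l \<Phi>_nonneg \<beta> in simp)
qed

lemma n_ge_1: "J \<in> \<F> \<Longrightarrow> I \<in> \<F> \<Longrightarrow> J \<subseteq> I \<Longrightarrow> 1 \<le> n J I"
proof -
  assume "J \<in> \<F>" "I \<in> \<F>" "J \<subseteq> I"
  then have "card {L\<in>\<F>. J \<subseteq> L \<and> L \<subseteq> I} \<noteq> 0" using fin by auto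
  then show ?thesis unfolding n_def by linarith
qed

text \<open>
  The difference \<open>b z - b w\<close> is split through the averages over \<open>Q J\<close>, \<open>Q I\<close> and \<open>Q K\<close>. The part
  with the oscillation of \<open>b\<close> at \<open>w\<close> is paired with \<open>f\<close> by Cauchy-Schwarz, so that only square means occur.
\<close>

lemma h_tile:
  assumes J: "J \<in> \<F>" and K: "K \<in> \<F>" and I: "I \<in> \<F>" and sub: "J \<subseteq> I" "K \<subseteq> I"
  shows "set_integrable dA (S K) (h z)"
    and "(LINT w:S K|dA. h z w) \<le> C1 * ((g J z + 3 * \<beta> * (n J I + n K I)) * (m K * x K))"
proof -
  note SK = S_dA[OF K] and fi = f_integrable[OF S_dA(1,2)[OF K]] and ft = f_tile[OF K]
  have l: "0 < len K" by (rule pos[OF K])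
  define \<kappa> where "\<kappa> = g J z + 2 * \<beta> * (n J I + n K I)"
  have nn: "0 \<le> n J I" "0 \<le> n K I" by (simp_all add: n_def)
  have \<kappa>: "0 \<le> \<kappa>" using \<beta> nn by (simp add: \<kappa>_def g_def)
  define M where "M w = C1 * len K powr \<alpha> * (\<kappa> * norm (f w) + g K w * norm (f w))" for w
  have le: "h z w \<le> M w" if w: "w \<in> S K" for w
  proof -
    have tele: "norm (average b (Q J) - average b (Q I)) \<le> 2 * \<beta> * n J I"
      "norm (average b (Q K) - average b (Q I)) \<le> 2 * \<beta> * n K I"
      unfolding n_def by (intro average_telescope[OF D b \<beta> osc fin FD conv] J K I sub; assumption)+
    have "norm (b z - b w) \<le> norm (b z - average b (Q J)) + norm (average b (Q J) - average b (Q I))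
        + norm (average b (Q K) - average b (Q I)) + norm (b w - average b (Q K))"
      by norm
    also have "\<dots> \<le> \<kappa> + g K w" using tele by (simp add: \<kappa>_def g_def algebra_simps)
    finally have 1: "norm (b z - b w) * norm (f w) \<le> (\<kappa> + g K w) * norm (f w)" by (intro mult_right_mono) auto
    have wT: "w \<in> tile K" using w by (simp add: S_def)
    have "h z w \<le> ((\<kappa> + g K w) * norm (f w)) * (C1 * len K powr \<alpha>)"
      unfolding h_def using bergman_density_nonneg[OF \<alpha>, of w] \<kappa>
      by (intro mult_mono[OF 1 density_S(2)[OF K wT]]) (auto simp: g_def)
    also have "\<dots> = M w" by (simp add: M_def algebra_simps)
    finally show ?thesis .
  qed
  have iM: "set_integrable dA (S K) M"
    unfolding M_def by (intro set_integrable_mult_right set_integral_add fi ft)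
  have h0: "0 \<le> h z w" for w unfolding h_def using bergman_density_nonneg[OF \<alpha>] by simp
  have [measurable]: "S K \<in> sets dA" by (rule SK)
  show ih: "set_integrable dA (S K) (h z)"
    using iM unfolding set_integrable_def
  proof (rule Bochner_Integration.integrable_bound)
    show "(\<lambda>w. indicat_real (S K) w *\<^sub>R h z w) \<in> borel_measurable dA" unfolding h_def by measurable
    show "AE w in dA. norm (indicat_real (S K) w *\<^sub>R h z w) \<le> norm (indicat_real (S K) w *\<^sub>R M w)"
      using le h0 by (intro AE_I2) (fastforce simp: indicator_def)
  qed
  have "(LINT w:S K|dA. h z w) \<le> (LINT w:S K|dA. M w)" by (intro set_integral_mono ih iM le)
  also have "\<dots> = C1 * len K powr \<alpha> * (\<kappa> * (LINT w:S K|dA. norm (f w)) + (LINT w:S K|dA. g K w * norm (f w)))"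
    unfolding M_def set_integral_mult_right
    using fi ft by (subst set_integral_add(2)) (auto intro: set_integrable_mult_right)
  also have "\<dots> \<le> C1 * len K powr \<alpha> * (\<kappa> * (len K * \<Phi> K) + \<beta> * len K * \<Phi> K)"
    using c \<kappa> ft by (intro mult_left_mono add_mono) auto
  also have "\<dots> = C1 * ((\<kappa> + \<beta>) * (m K * x K))"
    unfolding m_eq[OF K] x_def using l by (simp add: power2_eq_square algebra_simps)
  also have "\<dots> \<le> C1 * ((g J z + 3 * \<beta> * (n J I + n K I)) * (m K * x K))"
  proof -
    have "\<beta> * 1 \<le> \<beta> * (n J I + n K I)" using n_ge_1[OF J I sub(1)] nn \<beta> by (intro mult_left_mono) auto
    then have "\<kappa> + \<beta> \<le> g J z + 3 * \<beta> * (n J I + n K I)" by (simp add: \<kappa>_def algebra_simps)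
    then show ?thesis using c x_nonneg[OF K] by (intro mult_left_mono mult_right_mono) auto
  qed
  finally show "(LINT w:S K|dA. h z w) \<le> C1 * ((g J z + 3 * \<beta> * (n J I + n K I)) * (m K * x K))" .
qed

lemma h_box:
  assumes J: "J \<in> \<F>" and I: "I \<in> \<F>" and sub: "J \<subseteq> I"
  shows "set_integrable dA (E \<inter> Q I) (h z)"
    and "(LINT w:E \<inter> Q I|dA. h z w) \<le> (\<Sum>K\<in>{K\<in>\<F>. K \<subseteq> I}. C1 * ((g J z + 3 * \<beta> * (n J I + n K I)) * (m K * x K)))"
proof -
  have eq: "E \<inter> Q I = (\<Union>K\<in>{K\<in>\<F>. K \<subseteq> I}. S K)"
  proof (intro equalityI subsetI)
    fix w assume w: "w \<in> E \<inter> Q I"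
    then obtain K where K: "K \<in> \<F>" "w \<in> tile K" using cover by auto
    then have "K \<subseteq> I" using tile_in_Q_iff[OF D _ _ K(2), of I] w I FD by auto
    then show "w \<in> (\<Union>K\<in>{K\<in>\<F>. K \<subseteq> I}. S K)" using K w by (auto simp: S_def)
  next
    fix w assume "w \<in> (\<Union>K\<in>{K\<in>\<F>. K \<subseteq> I}. S K)"
    then obtain K where K: "K \<in> \<F>" "K \<subseteq> I" "w \<in> tile K" "w \<in> E" by (auto simp: S_def)
    then show "w \<in> E \<inter> Q I" using tile_in_Q_iff[OF D _ _ K(3), of I] I FD by auto
  qed
  show "set_integrable dA (E \<inter> Q I) (h z)"
    unfolding eq using fin S_dA(1) h_tile(1)[OF J _ I sub] by (intro set_integrable_UN) auto
  have "(LINT w:E \<inter> Q I|dA. h z w) = (\<Sum>K\<in>{K\<in>\<F>. K \<subseteq> I}. LINT w:S K|dA. h z w)"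
    unfolding eq
  proof (rule set_integral_finite_Union)
    show "disjoint_family_on S {K\<in>\<F>. K \<subseteq> I}" using S_disjoint by (auto simp: disjoint_family_on_def)
  qed (use fin S_dA(1) h_tile(1)[OF J _ I sub] in auto)
  also have "\<dots> \<le> (\<Sum>K\<in>{K\<in>\<F>. K \<subseteq> I}. C1 * ((g J z + 3 * \<beta> * (n J I + n K I)) * (m K * x K)))"
    using h_tile(2)[OF J _ I sub] by (intro sum_mono) auto
  finally show "(LINT w:E \<inter> Q I|dA. h z w) \<le> (\<Sum>K\<in>{K\<in>\<F>. K \<subseteq> I}. C1 * ((g J z + 3 * \<beta> * (n J I + n K I)) * (m K * x K)))" .
qed

definition P where "P = tree_op \<F> m x"
definition R where "R = tree_op \<F> m P"

text \<open>
  The commutator with its kernel replaced by the dyadic sum. Integrals are taken over the majorant \<open>G\<close>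
  instead, which is evidently measurable.
\<close>

definition H where "H z = (\<Sum>I\<in>{I\<in>\<F>. z \<in> Q I}. (LINT w:E \<inter> Q I|dA. h z w) / m I)"

lemma H_integral:
  assumes z: "z \<in> E"
  shows "integrable dA (\<lambda>w. \<Sum>I\<in>{I\<in>\<F>. z \<in> Q I}. indicator (E \<inter> Q I) w *\<^sub>R h z w / m I)"
    and "(LINT w|dA. (\<Sum>I\<in>{I\<in>\<F>. z \<in> Q I}. indicator (E \<inter> Q I) w *\<^sub>R h z w / m I)) = H z"
proof -
  obtain J where J: "J \<in> \<F>" "z \<in> tile J" using cover z by auto
  have int: "integrable dA (\<lambda>w. indicator (E \<inter> Q I) w *\<^sub>R h z w / m I)" if I: "I \<in> {I\<in>\<F>. z \<in> Q I}" for I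
  proof -
    have "J \<subseteq> I" using tile_in_Q_iff[OF D _ _ J(2), of I] I J FD by auto
    then have "set_integrable dA (E \<inter> Q I) (h z)" using I by (intro h_box(1)[OF J(1)]) auto
    then show ?thesis unfolding set_integrable_def by (rule integrable_divide)
  qed
  show "integrable dA (\<lambda>w. \<Sum>I\<in>{I\<in>\<F>. z \<in> Q I}. indicator (E \<inter> Q I) w *\<^sub>R h z w / m I)"
    by (rule Bochner_Integration.integrable_sum[OF int])
  show "(LINT w|dA. (\<Sum>I\<in>{I\<in>\<F>. z \<in> Q I}. indicator (E \<inter> Q I) w *\<^sub>R h z w / m I)) = H z"
    unfolding H_def set_lebesgue_integral_def using int
    by (subst Bochner_Integration.integral_sum) auto
qed

lemma H_bound:
  assumes J: "J \<in> \<F>" and z: "z \<in> S J"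
  shows "H z \<le> C1 * (g J z * P J + 6 * \<beta> * R J)"
proof -
  have eq: "{I\<in>\<F>. z \<in> Q I} = {I\<in>\<F>. J \<subseteq> I}"
    using tile_in_Q_iff[OF D _ _ , of _ J z] J z FD by (auto simp: S_def)
  have "H z \<le> (\<Sum>I\<in>{I\<in>\<F>. J \<subseteq> I}. (\<Sum>K\<in>{K\<in>\<F>. K \<subseteq> I}. C1 * ((g J z + 3 * \<beta> * (n J I + n K I)) * (m K * x K))) / m I)"
    unfolding H_def eq using h_box(2)[OF J] m_pos by (intro sum_mono divide_right_mono) (auto simp: less_imp_le)
  also have "\<dots> = C1 * (g J z * P J + 3 * \<beta> * (\<Sum>I\<in>{I\<in>\<F>. J \<subseteq> I}. (\<Sum>K\<in>{K\<in>\<F>. K \<subseteq> I}. (n J I + n K I) * (m K * x K)) / m I))"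
    unfolding P_def tree_op_def
    by (simp add: sum_distrib_left sum_divide_distrib sum.distrib[symmetric] distrib_left distrib_right add_divide_distrib mult_ac)
  also have "\<dots> \<le> C1 * (g J z * P J + 3 * \<beta> * (2 * R J))"
    unfolding R_def P_def n_def
    using c \<beta> tree_op_log_bound[OF fin m_pos x_nonneg, where J = J] by (intro mult_left_mono add_left_mono) auto
  finally show ?thesis by (simp add: mult.assoc)
qed

definition G where "G z = (\<Sum>J\<in>\<F>. indicator (S J) z * (C1 * (g J z * P J + 6 * \<beta> * R J)))"

lemma P_nonneg: "0 \<le> P J" and R_nonneg: "0 \<le> R J"
proof -
  show P: "0 \<le> P J" for J
    unfolding P_def tree_op_def by (intro sum_nonneg divide_nonneg_nonneg mult_nonneg_nonneg) (auto simp: x_nonneg)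
  show "0 \<le> R J"
    unfolding R_def tree_op_def by (intro sum_nonneg divide_nonneg_nonneg mult_nonneg_nonneg) (auto simp: P)
qed

lemma G_tile:
  assumes J: "J \<in> \<F>" and z: "z \<in> S J"
  shows "G z = C1 * (g J z * P J + 6 * \<beta> * R J)"
proof -
  have "G z = (\<Sum>K\<in>\<F>. if K = J then C1 * (g J z * P J + 6 * \<beta> * R J) else 0)"
    unfolding G_def
  proof (intro sum.cong refl)
    fix K assume K: "K \<in> \<F>"
    show "indicator (S K) z * (C1 * (g K z * P K + 6 * \<beta> * R K)) = (if K = J then C1 * (g J z * P J + 6 * \<beta> * R J) else 0)"
    proof (cases "K = J")
      case False
      then have "z \<notin> S K" using S_disjoint[OF J K] z by auto
      then show ?thesis using False by simp
    qed (use z in simp)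
  qed
  also have "\<dots> = C1 * (g J z * P J + 6 * \<beta> * R J)" using J fin by simp
  finally show ?thesis .
qed

lemma E_tiles: "E = (\<Union>J\<in>\<F>. S J)"
  using cover by (auto simp: S_def)

lemma H_le_G:
  assumes "z \<in> E"
  shows "H z \<le> G z"
proof -
  obtain J where "J \<in> \<F>" "z \<in> S J" using assms E_tiles by blast
  then show ?thesis using H_bound G_tile by simp
qed

lemma G_measurable: "G \<in> borel_measurable dA"
proof -
  have [measurable]: "S J \<in> sets dA" if "J \<in> \<F>" for J using S_dA(1)[OF that] .
  show ?thesis unfolding G_def g_def by measurable
qed

text \<open>
  On each tile the weight is comparable to its value \<open>s J\<close> at one point, so the integral reduces to
  sums weighted by \<open>m J s J\<close>. The function \<open>g\<close> enters only through its square mean, the condition on the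
  weight becomes the hypothesis of \<open>tree_op_weighted_bound\<close>, and \<open>R\<close> requires that bound twice.
\<close>

lemma weighted_G_bound:
  fixes \<sigma> :: "complex \<Rightarrow> real"
  assumes \<sigma>m: "\<sigma> \<in> borel_measurable dA" and \<sigma>: "\<And>z. z \<in> uhp \<Longrightarrow> 0 < \<sigma> z"
    and Cs: "0 < Cs" and reg: "\<And>J z w. J \<in> \<D> \<Longrightarrow> z \<in> tile J \<Longrightarrow> w \<in> tile J \<Longrightarrow> \<sigma> z \<le> Cs * \<sigma> w"
    and A: "0 < A"
    and int1: "\<And>I. I \<in> \<D> \<Longrightarrow> set_integrable dA (Q I) (\<lambda>z. bergman_density \<alpha> z * \<sigma> z)"
    and int2: "\<And>I. I \<in> \<D> \<Longrightarrow> set_integrable dA (Q I) (\<lambda>z. bergman_density \<alpha> z * inverse (\<sigma> z))"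
    and A2: "\<And>I. I \<in> \<D> \<Longrightarrow>
      (LINT z:Q I|dA. bergman_density \<alpha> z * \<sigma> z) * (LINT z:Q I|dA. bergman_density \<alpha> z * inverse (\<sigma> z))
        \<le> A * (m I)\<^sup>2"
    and if2: "set_integrable dA E (\<lambda>z. bergman_density \<alpha> z * \<sigma> z * (norm (f z))\<^sup>2)"
  defines "q \<equiv> 4 * ((2 * Cs / c)\<^sup>2 * A)"
  shows "set_integrable dA E (\<lambda>z. bergman_density \<alpha> z * \<sigma> z * (G z)\<^sup>2)"
    and "(LINT z:E|dA. bergman_density \<alpha> z * \<sigma> z * (G z)\<^sup>2)
       \<le> C1 ^ 3 * Cs * (2 * q\<^sup>2 + 72 * q ^ 4) * (Cs / c) * \<beta>\<^sup>2 * (LINT z:E|dA. bergman_density \<alpha> z * \<sigma> z * (norm (f z))\<^sup>2)"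
proof -
  note [measurable] = \<sigma>m G_measurable
  define z0 where "z0 J = (SOME z. z \<in> tile J)" for J
  define s where "s J = \<sigma> (z0 J)" for J
  have z0: "z0 J \<in> tile J" if J: "J \<in> \<F>" for J
  proof -
    have JD: "J \<in> \<D>" using J FD by auto
    obtain a k where "J = {a..<a + 2 powi k}" "len J = 2 powi k" "0 < len J" by (rule dyadic_system_interval[OF D JD])
    then have "Complex a (len J / 2) \<in> tile J" by (simp add: tile_def)
    then show ?thesis unfolding z0_def by (rule someI)
  qed
  have tu: "w \<in> uhp" if "J \<in> \<F>" "w \<in> tile J" for J w
    using that pos[of J] unfolding tile_def uhp_def by fastforce
  have s: "0 < s J" if "J \<in> \<F>" for J unfolding s_def using z0[OF that] tu[OF that] by (intro \<sigma>) auto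
  have near: "\<sigma> w \<le> Cs * s J" "s J \<le> Cs * \<sigma> w" if J: "J \<in> \<F>" and w: "w \<in> tile J" for J w
    unfolding s_def using z0[OF J] w J FD by (auto intro!: reg)
  have rho: "0 < bergman_density \<alpha> w" if "J \<in> \<F>" "w \<in> tile J" for J w
    using bergman_density_pos[OF \<alpha> tu[OF that]] .
  have tQ: "(\<Union>K\<in>{K\<in>\<F>. K \<subseteq> I}. tile K) \<subseteq> Q I" if I: "I \<in> \<F>" for I
  proof
    fix w assume "w \<in> (\<Union>K\<in>{K\<in>\<F>. K \<subseteq> I}. tile K)"
    then obtain K where K: "K \<in> \<F>" "K \<subseteq> I" "w \<in> tile K" by auto
    then show "w \<in> Q I" using tile_in_Q_iff[OF D _ _ K(3), of I] I FD by auto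
  qed
  have tile_sum: "(\<Sum>K\<in>{K\<in>\<F>. K \<subseteq> I}. u K) \<le> (2 * Cs / c) * (LINT z:Q I|dA. v z)"
    if I: "I \<in> \<F>" and iv: "set_integrable dA (Q I) v" and v0: "\<And>z. z \<in> Q I \<Longrightarrow> 0 \<le> v z"
      and low: "\<And>K w. K \<in> \<F> \<Longrightarrow> w \<in> tile K \<Longrightarrow> u K / (len K)\<^sup>2 \<le> Cs / c * v w" for I u v
  proof -
    let ?F = "{K\<in>\<F>. K \<subseteq> I}"
    have ID: "I \<in> \<D>" using I FD by auto
    note QI = dyadic_Q_dA[OF D ID]
    have sub: "tile K \<subseteq> Q I" if "K \<in> ?F" for K using tQ[OF I] that by blast
    have tdA: "tile K \<in> sets dA" "emeasure dA (tile K) < \<infinity>" "measure dA (tile K) = (len K)\<^sup>2 / 2" if "K \<in> ?F" for K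
      using dyadic_Q_dA(4-6)[OF D, of K] that FD by auto
    have it: "set_integrable dA (tile K) v" if "K \<in> ?F" for K
      by (rule set_integrable_subset[OF iv tdA(1)[OF that] sub[OF that]])
    have each: "u K \<le> (2 * Cs / c) * (LINT z:tile K|dA. v z)" if K: "K \<in> ?F" for K
    proof -
      have KF: "K \<in> \<F>" using K by simp
      have l: "0 < len K" by (rule pos[OF KF])
      have "(len K)\<^sup>2 / 2 * (u K / (len K)\<^sup>2) = (LINT z:tile K|dA. u K / (len K)\<^sup>2)"
        by (simp only: set_integral_const_dA[OF tdA(1,2)[OF K]] tdA(3)[OF K])
      also have "\<dots> \<le> (LINT z:tile K|dA. Cs / c * v z)"
        using tdA[OF K] it[OF K] low[OF KF]
        by (intro set_integral_mono set_integrable_const_dA set_integrable_mult_right) auto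
      also have "\<dots> = Cs / c * (LINT z:tile K|dA. v z)" by simp
      finally show ?thesis using l by (simp add: mult_ac)
    qed
    have "(\<Sum>K\<in>?F. u K) \<le> (\<Sum>K\<in>?F. (2 * Cs / c) * (LINT z:tile K|dA. v z))"
      by (intro sum_mono each)
    also have "\<dots> = (2 * Cs / c) * (\<Sum>K\<in>?F. (LINT z:tile K|dA. v z))" by (simp add: sum_distrib_left)
    also have "(\<Sum>K\<in>?F. (LINT z:tile K|dA. v z)) = (LINT z:(\<Union>K\<in>?F. tile K)|dA. v z)"
    proof (rule set_integral_finite_Union[symmetric])
      show "disjoint_family_on tile ?F" using tile_unique[OF D] FD by (auto simp: disjoint_family_on_def)
    qed (use fin tdA it in auto)
    also have "(2 * Cs / c) * (LINT z:(\<Union>K\<in>?F. tile K)|dA. v z) \<le> (2 * Cs / c) * (LINT z:Q I|dA. v z)"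
    proof (rule mult_left_mono)
      show "(LINT z:(\<Union>K\<in>?F. tile K)|dA. v z) \<le> (LINT z:Q I|dA. v z)"
        using fin tdA v0 by (intro set_integral_subset_mono iv tQ[OF I] sets.finite_UN) auto
    qed (use Cs c in simp)
    finally show ?thesis .
  qed
  have tree: "(\<Sum>K\<in>{K\<in>\<F>. K \<subseteq> I}. m K * s K) * (\<Sum>K\<in>{K\<in>\<F>. K \<subseteq> I}. m K / s K) \<le> ((2 * Cs / c)\<^sup>2 * A) * (m I)\<^sup>2"
    if I: "I \<in> \<F>" for I
  proof -
    have ID: "I \<in> \<D>" using I FD by auto
    have Qp: "0 < bergman_density \<alpha> z" "0 < \<sigma> z" if "z \<in> Q I" for z
      using that Q_subset_uhp \<sigma> bergman_density_pos[OF \<alpha>] by auto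
    have "(\<Sum>K\<in>{K\<in>\<F>. K \<subseteq> I}. m K * s K) \<le> (2 * Cs / c) * (LINT z:Q I|dA. bergman_density \<alpha> z * \<sigma> z)"
    proof (rule tile_sum[OF I int1[OF ID]])
      show "0 \<le> bergman_density \<alpha> z * \<sigma> z" if "z \<in> Q I" for z using Qp[OF that] by simp
      fix K w assume K: "K \<in> \<F>" and w: "w \<in> tile K"
      have "(c * len K powr \<alpha>) * s K \<le> bergman_density \<alpha> w * (Cs * \<sigma> w)"
        using s[OF K] rho[OF K w] by (intro mult_mono density_S(1)[OF K w] near(2)[OF K w]) auto
      then show "m K * s K / (len K)\<^sup>2 \<le> Cs / c * (bergman_density \<alpha> w * \<sigma> w)"
        unfolding m_eq[OF K] using pos[OF K] c by (simp add: field_simps)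
    qed
    moreover have "(\<Sum>K\<in>{K\<in>\<F>. K \<subseteq> I}. m K / s K) \<le> (2 * Cs / c) * (LINT z:Q I|dA. bergman_density \<alpha> z * inverse (\<sigma> z))"
    proof (rule tile_sum[OF I int2[OF ID]])
      show "0 \<le> bergman_density \<alpha> z * inverse (\<sigma> z)" if "z \<in> Q I" for z using Qp[OF that] by simp
      fix K w assume K: "K \<in> \<F>" and w: "w \<in> tile K"
      have sw: "0 < \<sigma> w" by (rule \<sigma>[OF tu[OF K w]])
      have "(c * len K powr \<alpha>) * \<sigma> w \<le> bergman_density \<alpha> w * (Cs * s K)"
        using sw rho[OF K w] by (intro mult_mono density_S(1)[OF K w] near(1)[OF K w]) auto
      then show "m K / s K / (len K)\<^sup>2 \<le> Cs / c * (bergman_density \<alpha> w * inverse (\<sigma> w))"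
        unfolding m_eq[OF K] using pos[OF K] c s[OF K] sw by (simp add: field_simps)
    qed
    moreover have "0 \<le> (\<Sum>K\<in>{K\<in>\<F>. K \<subseteq> I}. m K / s K)"
      using s by (intro sum_nonneg divide_nonneg_nonneg) (auto simp: less_imp_le)
    moreover have "0 \<le> (2 * Cs / c) * (LINT z:Q I|dA. bergman_density \<alpha> z * \<sigma> z)"
    proof -
      have "0 \<le> (LINT z:Q I|dA. bergman_density \<alpha> z * \<sigma> z)"
        unfolding set_lebesgue_integral_def using Qp
        by (intro Bochner_Integration.integral_nonneg) (auto simp: indicator_def less_imp_le)
      then show ?thesis using Cs c by simp
    qed
    ultimately have "(\<Sum>K\<in>{K\<in>\<F>. K \<subseteq> I}. m K * s K) * (\<Sum>K\<in>{K\<in>\<F>. K \<subseteq> I}. m K / s K)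
        \<le> ((2 * Cs / c) * (LINT z:Q I|dA. bergman_density \<alpha> z * \<sigma> z)) * ((2 * Cs / c) * (LINT z:Q I|dA. bergman_density \<alpha> z * inverse (\<sigma> z)))"
      by (intro mult_mono)
    also have "\<dots> = (2 * Cs / c)\<^sup>2 * ((LINT z:Q I|dA. bergman_density \<alpha> z * \<sigma> z) * (LINT z:Q I|dA. bergman_density \<alpha> z * inverse (\<sigma> z)))"
      by (simp only: power2_eq_square mult_ac)
    also have "\<dots> \<le> (2 * Cs / c)\<^sup>2 * (A * (m I)\<^sup>2)" by (intro mult_left_mono A2[OF ID]) auto
    finally show ?thesis by simp
  qed
  have lam: "laminar \<F>" by (rule dyadic_laminar[OF D FD])
  define N where "N = (\<Sum>J\<in>\<F>. m J * s J * (x J)\<^sup>2)"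
  have A': "0 \<le> (2 * Cs / c)\<^sup>2 * A" using A by simp
  have NP: "(\<Sum>J\<in>\<F>. m J * s J * (P J)\<^sup>2) \<le> q\<^sup>2 * N"
    unfolding P_def N_def q_def by (rule tree_op_weighted_bound[OF fin lam m_pos s A' tree x_nonneg])
  have "(\<Sum>J\<in>\<F>. m J * s J * (R J)\<^sup>2) \<le> q\<^sup>2 * (\<Sum>J\<in>\<F>. m J * s J * (P J)\<^sup>2)"
    unfolding R_def q_def by (rule tree_op_weighted_bound[OF fin lam m_pos s A' tree P_nonneg])
  also have "\<dots> \<le> q\<^sup>2 * (q\<^sup>2 * N)" by (intro mult_left_mono NP) auto
  finally have NR: "(\<Sum>J\<in>\<F>. m J * s J * (R J)\<^sup>2) \<le> q ^ 4 * N" by (simp add: power_add[symmetric])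
  have if2S: "set_integrable dA (S J) (\<lambda>z. bergman_density \<alpha> z * \<sigma> z * (norm (f z))\<^sup>2)" if "J \<in> \<F>" for J
    using S_dA(1)[OF that] by (intro set_integrable_subset[OF if2]) (auto simp: S_def)
  have disj: "disjoint_family_on S \<F>" using S_disjoint by (auto simp: disjoint_family_on_def)
  have "N \<le> (\<Sum>J\<in>\<F>. Cs / c * (LINT z:S J|dA. bergman_density \<alpha> z * \<sigma> z * (norm (f z))\<^sup>2))"
    unfolding N_def
  proof (rule sum_mono)
    fix J assume J: "J \<in> \<F>"
    have "m J * s J * (x J)\<^sup>2 = len J powr \<alpha> * s J * (\<Phi> J)\<^sup>2"
      unfolding m_eq[OF J] x_def using pos[OF J] by (simp add: power_divide)
    also have "\<dots> = (LINT z:S J|dA. len J powr \<alpha> * s J * (norm (f z))\<^sup>2)"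
      by (simp add: \<Phi>_sq)
    also have "\<dots> \<le> (LINT z:S J|dA. Cs / c * (bergman_density \<alpha> z * \<sigma> z * (norm (f z))\<^sup>2))"
    proof (intro set_integral_mono set_integrable_mult_right f_integrable(2) S_dA[OF J] if2S[OF J])
      fix w assume "w \<in> S J"
      then have w: "w \<in> tile J" by (simp add: S_def)
      have "(c * len J powr \<alpha>) * s J \<le> bergman_density \<alpha> w * (Cs * \<sigma> w)"
        using s[OF J] rho[OF J w] by (intro mult_mono density_S(1)[OF J w] near(2)[OF J w]) auto
      then have "len J powr \<alpha> * s J \<le> Cs / c * (bergman_density \<alpha> w * \<sigma> w)"
        using c by (simp add: field_simps)
      then have "len J powr \<alpha> * s J * (norm (f w))\<^sup>2 \<le> Cs / c * (bergman_density \<alpha> w * \<sigma> w) * (norm (f w))\<^sup>2"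
        by (intro mult_right_mono) auto
      then show "len J powr \<alpha> * s J * (norm (f w))\<^sup>2 \<le> Cs / c * (bergman_density \<alpha> w * \<sigma> w * (norm (f w))\<^sup>2)"
        by (simp only: mult.assoc)
    qed
    also have "\<dots> = Cs / c * (LINT z:S J|dA. bergman_density \<alpha> z * \<sigma> z * (norm (f z))\<^sup>2)" by simp
    finally show "m J * s J * (x J)\<^sup>2 \<le> Cs / c * (LINT z:S J|dA. bergman_density \<alpha> z * \<sigma> z * (norm (f z))\<^sup>2)" .
  qed
  also have "\<dots> = Cs / c * (LINT z:E|dA. bergman_density \<alpha> z * \<sigma> z * (norm (f z))\<^sup>2)"
    unfolding sum_distrib_left[symmetric] by (subst (2) E_tiles, subst set_integral_finite_Union[OF fin disj if2S S_dA(1)]) auto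
  finally have Nf: "N \<le> Cs / c * (LINT z:E|dA. bergman_density \<alpha> z * \<sigma> z * (norm (f z))\<^sup>2)" .
  have GJ: "set_integrable dA (S J) (\<lambda>z. bergman_density \<alpha> z * \<sigma> z * (G z)\<^sup>2) \<and>
      (LINT z:S J|dA. bergman_density \<alpha> z * \<sigma> z * (G z)\<^sup>2)
        \<le> C1 ^ 3 * Cs * \<beta>\<^sup>2 * (m J * s J * (2 * (P J)\<^sup>2 + 72 * (R J)\<^sup>2))" if J: "J \<in> \<F>" for J
  proof -
    note SJ = S_dA[OF J]
    have [measurable]: "S J \<in> sets dA" by (rule SJ)
    define M where "M z = C1 * len J powr \<alpha> * (Cs * s J) * (C1\<^sup>2 * (2 * (P J)\<^sup>2 * (g J z)\<^sup>2 + 72 * \<beta>\<^sup>2 * (R J)\<^sup>2))" for z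
    have iM: "set_integrable dA (S J) M"
      unfolding M_def by (intro set_integrable_mult_right set_integral_add g_sq[OF J] set_integrable_const_dA SJ)
    have nn: "0 \<le> bergman_density \<alpha> z * \<sigma> z * (G z)\<^sup>2" if "z \<in> S J" for z
      using rho[OF J, of z] \<sigma>[OF tu[OF J, of z]] that by (simp add: S_def)
    have le: "bergman_density \<alpha> z * \<sigma> z * (G z)\<^sup>2 \<le> M z" if z: "z \<in> S J" for z
    proof -
      have zt: "z \<in> tile J" using z by (simp add: S_def)
      have 1: "bergman_density \<alpha> z * \<sigma> z \<le> C1 * len J powr \<alpha> * (Cs * s J)"
        using \<sigma>[OF tu[OF J zt]] c by (intro mult_mono density_S(2)[OF J zt] near(1)[OF J zt]) auto
      have 2: "(G z)\<^sup>2 \<le> C1\<^sup>2 * (2 * (P J)\<^sup>2 * (g J z)\<^sup>2 + 72 * \<beta>\<^sup>2 * (R J)\<^sup>2)"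
      proof -
        have "(u + v)\<^sup>2 \<le> 2 * u\<^sup>2 + 2 * v\<^sup>2" for u v :: real
        proof -
          have "0 \<le> (u - v)\<^sup>2" by simp
          then show ?thesis by (simp add: power2_eq_square algebra_simps)
        qed
        from this[of "g J z * P J" "6 * \<beta> * R J"]
        have "(g J z * P J + 6 * \<beta> * R J)\<^sup>2 \<le> 2 * (P J)\<^sup>2 * (g J z)\<^sup>2 + 72 * \<beta>\<^sup>2 * (R J)\<^sup>2"
          by (simp add: power_mult_distrib mult_ac)
        then show ?thesis
          unfolding G_tile[OF J z] power_mult_distrib by (intro mult_left_mono) auto
      qed
      show ?thesis
        unfolding M_def using c Cs s[OF J] by (intro mult_mono[OF 1 2]) auto
    qed
    have iG: "set_integrable dA (S J) (\<lambda>z. bergman_density \<alpha> z * \<sigma> z * (G z)\<^sup>2)"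
      using iM unfolding set_integrable_def
    proof (rule Bochner_Integration.integrable_bound)
      show "AE z in dA. norm (indicat_real (S J) z *\<^sub>R (bergman_density \<alpha> z * \<sigma> z * (G z)\<^sup>2)) \<le> norm (indicat_real (S J) z *\<^sub>R M z)"
      proof (rule AE_I2)
        fix z
        show "norm (indicat_real (S J) z *\<^sub>R (bergman_density \<alpha> z * \<sigma> z * (G z)\<^sup>2)) \<le> norm (indicat_real (S J) z *\<^sub>R M z)"
        proof (cases "z \<in> S J")
          case True
          have "\<bar>bergman_density \<alpha> z * \<sigma> z * (G z)\<^sup>2\<bar> \<le> \<bar>M z\<bar>"
            using nn[OF True] le[OF True] by linarith
          then show ?thesis using True by simp
        qed simp
      qed
    qed measurable
    have "(LINT z:S J|dA. bergman_density \<alpha> z * \<sigma> z * (G z)\<^sup>2) \<le> (LINT z:S J|dA. M z)"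
      by (intro set_integral_mono iG iM le)
    also have "\<dots> = C1 * len J powr \<alpha> * (Cs * s J) * (C1\<^sup>2 * (2 * (P J)\<^sup>2 * (LINT z:S J|dA. (g J z)\<^sup>2) + measure dA (S J) * (72 * \<beta>\<^sup>2 * (R J)\<^sup>2)))"
      unfolding M_def set_integral_mult_right
      by (subst set_integral_add(2)) (auto intro!: set_integrable_mult_right g_sq[OF J] set_integrable_const_dA SJ simp: set_integral_const_dA[OF SJ(1,2)])
    also have "\<dots> \<le> C1 * len J powr \<alpha> * (Cs * s J) * (C1\<^sup>2 * (2 * (P J)\<^sup>2 * (\<beta>\<^sup>2 * (len J)\<^sup>2) + (len J)\<^sup>2 * (72 * \<beta>\<^sup>2 * (R J)\<^sup>2)))"
      using c Cs s[OF J] by (intro mult_left_mono add_mono mult_right_mono g_sq(2)[OF J] SJ(3)) auto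
    also have "\<dots> = C1 ^ 3 * Cs * \<beta>\<^sup>2 * (m J * s J * (2 * (P J)\<^sup>2 + 72 * (R J)\<^sup>2))"
      unfolding m_eq[OF J] by (simp add: power2_eq_square power3_eq_cube algebra_simps)
    finally show ?thesis using iG by simp
  qed
  have iGS: "set_integrable dA (S J) (\<lambda>z. bergman_density \<alpha> z * \<sigma> z * (G z)\<^sup>2)" if "J \<in> \<F>" for J
    using GJ[OF that] by simp
  have "set_integrable dA (\<Union>J\<in>\<F>. S J) (\<lambda>z. bergman_density \<alpha> z * \<sigma> z * (G z)\<^sup>2)"
    using fin iGS S_dA(1) by (intro set_integrable_UN)
  then show "set_integrable dA E (\<lambda>z. bergman_density \<alpha> z * \<sigma> z * (G z)\<^sup>2)"
    unfolding E_tiles[symmetric] .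
  have "(LINT z:(\<Union>J\<in>\<F>. S J)|dA. bergman_density \<alpha> z * \<sigma> z * (G z)\<^sup>2) = (\<Sum>J\<in>\<F>. LINT z:S J|dA. bergman_density \<alpha> z * \<sigma> z * (G z)\<^sup>2)"
    by (rule set_integral_finite_Union[OF fin disj iGS S_dA(1)])
  then have "(LINT z:E|dA. bergman_density \<alpha> z * \<sigma> z * (G z)\<^sup>2) = (\<Sum>J\<in>\<F>. LINT z:S J|dA. bergman_density \<alpha> z * \<sigma> z * (G z)\<^sup>2)"
    unfolding E_tiles[symmetric] .
  also have "\<dots> \<le> (\<Sum>J\<in>\<F>. C1 ^ 3 * Cs * \<beta>\<^sup>2 * (m J * s J * (2 * (P J)\<^sup>2 + 72 * (R J)\<^sup>2)))"
    using GJ by (intro sum_mono) auto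
  also have "\<dots> = C1 ^ 3 * Cs * \<beta>\<^sup>2 * (2 * (\<Sum>J\<in>\<F>. m J * s J * (P J)\<^sup>2) + 72 * (\<Sum>J\<in>\<F>. m J * s J * (R J)\<^sup>2))"
    by (simp add: sum_distrib_left sum.distrib[symmetric] algebra_simps)
  also have "\<dots> \<le> C1 ^ 3 * Cs * \<beta>\<^sup>2 * (2 * (q\<^sup>2 * N) + 72 * (q ^ 4 * N))"
    using c Cs by (intro mult_left_mono add_mono NP NR) auto
  also have "\<dots> = C1 ^ 3 * Cs * \<beta>\<^sup>2 * (2 * q\<^sup>2 + 72 * q ^ 4) * N" by (simp add: algebra_simps)
  also have "\<dots> \<le> C1 ^ 3 * Cs * \<beta>\<^sup>2 * (2 * q\<^sup>2 + 72 * q ^ 4) * (Cs / c * (LINT z:E|dA. bergman_density \<alpha> z * \<sigma> z * (norm (f z))\<^sup>2))"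
    using c Cs by (intro mult_left_mono Nf mult_nonneg_nonneg add_nonneg_nonneg) auto
  finally show "(LINT z:E|dA. bergman_density \<alpha> z * \<sigma> z * (G z)\<^sup>2)
       \<le> C1 ^ 3 * Cs * (2 * q\<^sup>2 + 72 * q ^ 4) * (Cs / c) * \<beta>\<^sup>2 * (LINT z:E|dA. bergman_density \<alpha> z * \<sigma> z * (norm (f z))\<^sup>2)"
    by (simp add: mult_ac)
qed

end


section \<open>The commutator on test functions\<close>

definition exhaust_box :: "nat \<Rightarrow> complex set" where
  "exhaust_box k = rect (- (real k + 1)) (real k + 1) (1 / (real k + 1)) (real k + 1)"

lemma exhaust_box_dA: "exhaust_box k \<in> sets dA" "emeasure dA (exhaust_box k) < \<infinity>"
  and exhaust_box_uhp: "exhaust_box k \<subseteq> uhp"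
proof -
  have 1: "0 < 1 / (real k + 1)" by simp
  show "exhaust_box k \<in> sets dA" "emeasure dA (exhaust_box k) < \<infinity>" "exhaust_box k \<subseteq> uhp"
    unfolding exhaust_box_def using rect_dA[OF 1] rect_subset_uhp[OF 1] by auto
qed

lemma exhaust_box_mono: "incseq exhaust_box"
proof (rule incseq_SucI)
  fix k
  have "1 / (real (Suc k) + 1) \<le> 1 / (real k + 1)" by (intro divide_left_mono) auto
  then show "exhaust_box k \<subseteq> exhaust_box (Suc k)" by (auto simp: exhaust_box_def rect_def)
qed

lemma exhaust_box_Union: "(\<Union>k. exhaust_box k) = uhp"
proof
  show "(\<Union>k. exhaust_box k) \<subseteq> uhp" using exhaust_box_uhp by blast
  show "uhp \<subseteq> (\<Union>k. exhaust_box k)"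
  proof
    fix z assume "z \<in> uhp"
    then have y: "0 < Im z" by (simp add: uhp_def)
    obtain k :: nat where k: "max (max \<bar>Re z\<bar> (Im z)) (1 / Im z) < real k" using reals_Archimedean2 by blast
    then have "\<bar>Re z\<bar> < real k" "Im z < real k" "1 / Im z < real k" by auto
    moreover from this(3) y have "1 / (real k + 1) \<le> Im z" by (simp add: field_simps)
    ultimately have "z \<in> exhaust_box k" by (auto simp: exhaust_box_def rect_def abs_less_iff)
    then show "z \<in> (\<Union>k. exhaust_box k)" by blast
  qed
qed

lemma compact_subset_exhaust_box:
  assumes K: "compact K" "K \<subseteq> uhp"
  obtains k0 where "\<And>k. k0 \<le> k \<Longrightarrow> K \<subseteq> exhaust_box k"
proof -
  define O' where "O' k = {z. - (real k + 1) < Re z \<and> Re z < real k + 1 \<and> 1 / (real k + 1) < Im z \<and> Im z < real k + 1}" for k :: nat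
  have sub: "O' k \<subseteq> exhaust_box k" for k by (auto simp: O'_def exhaust_box_def rect_def)
  have op: "open (O' k)" for k
  proof -
    have "O' k = {z. - (real k + 1) < Re z} \<inter> {z. Re z < real k + 1} \<inter> {z. 1 / (real k + 1) < Im z} \<inter> {z. Im z < real k + 1}"
      by (auto simp: O'_def)
    then show ?thesis
      by (simp add: open_Int open_halfspace_Re_gt open_halfspace_Re_lt open_halfspace_Im_gt open_halfspace_Im_lt)
  qed
  have cov: "K \<subseteq> (\<Union>k. O' k)"
  proof
    fix z assume "z \<in> K"
    then have y: "0 < Im z" using K by (auto simp: uhp_def)
    obtain k :: nat where k: "max (max \<bar>Re z\<bar> (Im z)) (1 / Im z) < real k" using reals_Archimedean2 by blast
    then have "\<bar>Re z\<bar> < real k" "Im z < real k" "1 / Im z < real k" by auto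
    moreover from this(3) y have "1 / (real k + 1) < Im z" by (simp add: field_simps)
    ultimately have "z \<in> O' k" by (auto simp: O'_def abs_less_iff)
    then show "z \<in> (\<Union>k. O' k)" by blast
  qed
  obtain X where X: "finite X" "K \<subseteq> (\<Union>k\<in>X. O' k)"
    by (rule compactE_image[OF K(1), of UNIV O', OF op cov])
  define k0 where "k0 = Max (insert 0 X)"
  show ?thesis
  proof (rule that)
    fix k assume k: "k0 \<le> k"
    show "K \<subseteq> exhaust_box k"
    proof
      fix z assume "z \<in> K"
      then obtain j where j: "j \<in> X" "z \<in> O' j" using X by blast
      have "j \<le> k0" unfolding k0_def using X(1) j(1) by (intro Max_ge) simp_all
      then have "exhaust_box j \<subseteq> exhaust_box k" using k by (intro incseqD[OF exhaust_box_mono]) simp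
      then show "z \<in> exhaust_box k" using sub[of j] j(2) by (elim subsetD)
    qed
  qed
qed

lemma window_covers:
  assumes D: "dyadic_system \<D>" and m: "2 * (real k + 1) \<le> 2 ^ m"
  shows "exhaust_box k \<subseteq> (\<Union>J\<in>dyadic_window \<D> m. tile J)"
proof
  fix z assume z: "z \<in> exhaust_box k"
  then obtain J where J: "J \<in> \<D>" "z \<in> tile J" using dyadic_tile_cover[OF D] exhaust_box_uhp by blast
  define r where "r = real k + 1"
  have r: "1 \<le> r" "2 * r \<le> 2 ^ m" using m by (simp_all add: r_def)
  have zb: "\<bar>Re z\<bar> \<le> r" "1 / r \<le> Im z" "Im z \<le> r" using z by (auto simp: exhaust_box_def rect_def r_def)
  have zt: "Re z \<in> J" "len J / 2 \<le> Im z" "Im z < len J" using J by (auto simp: tile_def)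
  have "1 / 2 ^ m \<le> 1 / r" using r by (intro divide_left_mono) auto
  then have "2 powi (- int m) \<le> len J" using zb zt by (simp add: power_int_minus inverse_eq_divide)
  moreover have "len J \<le> 2 powi (int m)" using zb zt r by simp
  moreover have "Re z \<in> J \<inter> {-(2^m)..2^m}" using zt zb r by (auto simp: abs_le_iff)
  ultimately have "J \<in> dyadic_window \<D> m" using J(1) by (auto simp: dyadic_window_def)
  then show "z \<in> (\<Union>J\<in>dyadic_window \<D> m. tile J)" using J(2) by blast
qed

lemma window_contains_kernel_interval:
  assumes z: "z \<in> exhaust_box k" and w: "w \<in> exhaust_box k"
    and I: "I \<in> \<D>" "z \<in> Q I" "2 * norm (z - cnj w) \<le> len I" "len I \<le> C * norm (z - cnj w)"
    and C: "0 < C" and m: "2 * (real k + 1) \<le> 2 ^ m" "4 * C * (real k + 1) \<le> 2 ^ m"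
  shows "I \<in> dyadic_window \<D> m"
proof -
  define r where "r = real k + 1"
  have r: "1 \<le> r" "2 * r \<le> 2 ^ m" "4 * C * r \<le> 2 ^ m" using m by (simp_all add: r_def)
  have zb: "\<bar>Re z\<bar> \<le> r" "1 / r \<le> Im z" "Im z \<le> r" using z by (auto simp: exhaust_box_def rect_def r_def)
  have wb: "\<bar>Re w\<bar> \<le> r" "1 / r \<le> Im w" "Im w \<le> r" using w by (auto simp: exhaust_box_def rect_def r_def)
  define d where "d = norm (z - cnj w)"
  have "0 < 1 / r" using r by simp
  then have yz: "0 < Im z" "0 < Im w" using zb wb by linarith+
  have "Im z + Im w \<le> d" using abs_Im_le_cmod[of "z - cnj w"] by (simp add: d_def)
  then have "1 / r \<le> d" using zb yz by linarith
  have "d \<le> \<bar>Re (z - cnj w)\<bar> + \<bar>Im (z - cnj w)\<bar>" unfolding d_def by (rule cmod_le)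
  then have d4: "d \<le> 4 * r" using zb wb yz by simp
  have "1 / 2 ^ m \<le> 1 / r" using r by (intro divide_left_mono) auto
  then have "2 powi (- int m) \<le> len I"
    using I(3) \<open>1 / r \<le> d\<close> \<open>0 < 1 / r\<close> unfolding d_def[symmetric]
    by (simp only: power_int_minus inverse_eq_divide power_int_of_nat)
  moreover have "len I \<le> C * (4 * r)"
    using I(4) d4 C unfolding d_def[symmetric] by (meson mult_left_mono less_imp_le order_trans)
  then have "len I \<le> 2 powi (int m)" using r by simp
  moreover have "Re z \<in> I \<inter> {-(2^m)..2^m}" using zb r I(2) by (auto simp: abs_le_iff Q_def)
  ultimately show ?thesis using I(1) by (auto simp: dyadic_window_def)
qed

text \<open>
  The two dyadic systems are treated separately on a box that contains the support of \<open>f\<close>. The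
  constant does not depend on the window, so the box may exhaust the half-plane.
\<close>

lemma commutator_test_bound:
  fixes \<sigma> :: "complex \<Rightarrow> real"
  assumes \<alpha>: "-1 < \<alpha>" and adj: "adjacent_dyadic_systems \<D>1 \<D>2" and B2: "\<sigma> \<in> B2 \<alpha> (\<D>1 \<union> \<D>2)"
    and \<sigma>: "\<And>z. z \<in> uhp \<Longrightarrow> 0 < \<sigma> z" and reg: "hyperbolically_regular \<sigma>"
  obtains K where "0 < K"
    "\<And>b \<beta> f F. b \<in> L2 dA \<Longrightarrow> 0 \<le> \<beta> \<Longrightarrow>
       \<forall>I\<in>\<D>1 \<union> \<D>2. (LINT z:Q I|dA. (norm (b z - average b (Q I)))\<^sup>2) \<le> \<beta>\<^sup>2 * (len I)\<^sup>2 \<Longrightarrow>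
       f \<in> test_functions \<Longrightarrow> integrable dA (\<lambda>z. bergman_density \<alpha> z * \<sigma> z * (norm (f z))\<^sup>2) \<Longrightarrow>
       AE z in dA. F z = commutator \<alpha> b f z \<Longrightarrow>
       integrable dA (\<lambda>z. bergman_density \<alpha> z * \<sigma> z * (norm (F z))\<^sup>2) \<Longrightarrow>
       (LINT z|dA. bergman_density \<alpha> z * \<sigma> z * (norm (F z))\<^sup>2)
         \<le> K * \<beta>\<^sup>2 * (LINT z|dA. bergman_density \<alpha> z * \<sigma> z * (norm (f z))\<^sup>2)"
proof -
  have wt: "weight \<sigma>" by (rule B2_weight[OF B2])
  have [measurable]: "\<sigma> \<in> borel_measurable dA" using wt by (simp add: weight_def)
  obtain c C1 where c: "0 < c" "0 < C1" and sc:
    "\<And>l w. 0 < l \<Longrightarrow> l / 4 \<le> Im w \<Longrightarrow> Im w \<le> l \<Longrightarrow>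
       c * l powr \<alpha> \<le> bergman_density \<alpha> w \<and> bergman_density \<alpha> w \<le> C1 * l powr \<alpha>"
    by (rule bergman_density_scale[OF \<alpha>]) (rule that; blast)
  obtain A where A: "0 < A" and int1: "\<And>I. I \<in> \<D>1 \<union> \<D>2 \<Longrightarrow> set_integrable dA (Q I) (\<lambda>z. bergman_density \<alpha> z * \<sigma> z)"
    and int2: "\<And>I. I \<in> \<D>1 \<union> \<D>2 \<Longrightarrow> set_integrable dA (Q I) (\<lambda>z. bergman_density \<alpha> z * inverse (\<sigma> z))"
    and A2: "\<And>I. I \<in> \<D>1 \<union> \<D>2 \<Longrightarrow>
      (LINT z:Q I|dA. bergman_density \<alpha> z * \<sigma> z) * (LINT z:Q I|dA. bergman_density \<alpha> z * inverse (\<sigma> z))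
        \<le> A * (len I powr (2 + \<alpha>))\<^sup>2"
    by (rule B2_integral_bound[OF \<alpha> adj B2]) (rule that; blast)
  obtain Ck where Ck: "0 < Ck" and ker:
    "\<And>z w. z \<in> uhp \<Longrightarrow> w \<in> uhp \<Longrightarrow> \<exists>I\<in>\<D>1 \<union> \<D>2. z \<in> Q I \<and> w \<in> Q I \<and>
       2 * norm (z - cnj w) \<le> len I \<and> len I \<le> Ck * norm (z - cnj w) \<and>
       norm (bergman_kernel \<alpha> z w) \<le> Ck powr (2 + \<alpha>) * (1 / len I powr (2 + \<alpha>))"
    by (rule kernel_dyadic_bound[OF \<alpha> adj]) (rule that; assumption)
  obtain Cs where Cs: "0 < Cs" and Har: "\<forall>z\<in>uhp. \<forall>w\<in>uhp. dist z w \<le> 3 * min (Im z) (Im w) \<longrightarrow> \<sigma> z \<le> Cs * \<sigma> w"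
    using reg unfolding hyperbolically_regular_def by blast
  have regt: "\<sigma> z \<le> Cs * \<sigma> w" if DJ: "dyadic_system \<D>" "J \<in> \<D>" and z: "z \<in> tile J" and w: "w \<in> tile J" for \<D> J z w
  proof -
    obtain a k where J: "J = {a..<a + 2 powi k}" "len J = 2 powi k" "0 < len J" by (rule dyadic_system_interval[OF DJ])
    define l where "l = len J"
    have l: "0 < l" "J = {a..<a + l}" using J by (simp_all add: l_def)
    have zb: "a \<le> Re z" "Re z < a + l" "l / 2 \<le> Im z" "Im z < l"
      using z[unfolded l(2) tile_halfopen[OF less_imp_le[OF l(1)]]] by (simp_all add: rect_def)
    have wb: "a \<le> Re w" "Re w < a + l" "l / 2 \<le> Im w" "Im w < l"
      using w[unfolded l(2) tile_halfopen[OF less_imp_le[OF l(1)]]] by (simp_all add: rect_def)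
    have "dist z w \<le> \<bar>Re (z - w)\<bar> + \<bar>Im (z - w)\<bar>" unfolding dist_norm by (rule cmod_le)
    also have "\<dots> \<le> l + l / 2"
    proof (rule add_mono)
      show "\<bar>Re (z - w)\<bar> \<le> l" using zb wb unfolding abs_le_iff by simp
      show "\<bar>Im (z - w)\<bar> \<le> l / 2" using zb wb unfolding abs_le_iff minus_complex.sel by linarith
    qed
    also have "\<dots> = 3 * (l / 2)" by simp
    also have "\<dots> \<le> 3 * min (Im z) (Im w)" using zb wb by simp
    finally have d: "dist z w \<le> 3 * min (Im z) (Im w)" .
    have "z \<in> uhp" "w \<in> uhp" using zb(3) wb(3) l(1) by (simp_all add: uhp_def)
    then show ?thesis using d by (rule Har[rule_format])
  qed
  define q where "q = 4 * ((2 * Cs / c)\<^sup>2 * A)"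
  define K0 where "K0 = C1 ^ 3 * Cs * (2 * q\<^sup>2 + 72 * q ^ 4) * (Cs / c)"
  have q: "0 < q" using A Cs c by (simp add: q_def)
  have K0: "0 < K0" unfolding K0_def using c Cs q by (intro mult_pos_pos add_pos_pos) auto
  define CK where "CK = Ck powr (2 + \<alpha>)"
  have CK: "0 < CK" using Ck by (simp add: CK_def)
  define K where "K = 4 * CK\<^sup>2 * K0"
  have K: "0 < K" using CK K0 by (simp add: K_def)
  have main: "(LINT z|dA. bergman_density \<alpha> z * \<sigma> z * (norm (F z))\<^sup>2)
         \<le> K * \<beta>\<^sup>2 * (LINT z|dA. bergman_density \<alpha> z * \<sigma> z * (norm (f z))\<^sup>2)"
    if b: "b \<in> L2 dA" and \<beta>: "0 \<le> \<beta>"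
      and osc: "\<forall>I\<in>\<D>1 \<union> \<D>2. (LINT z:Q I|dA. (norm (b z - average b (Q I)))\<^sup>2) \<le> \<beta>\<^sup>2 * (len I)\<^sup>2"
      and f: "f \<in> test_functions" and if2: "integrable dA (\<lambda>z. bergman_density \<alpha> z * \<sigma> z * (norm (f z))\<^sup>2)"
      and F: "AE z in dA. F z = commutator \<alpha> b f z"
      and iF2: "integrable dA (\<lambda>z. bergman_density \<alpha> z * \<sigma> z * (norm (F z))\<^sup>2)"
    for b \<beta> f F
  proof -
    obtain Kf where Kf: "compact Kf" "Kf \<subseteq> uhp" and f0: "\<And>z. z \<in> uhp - Kf \<Longrightarrow> f z = 0"
      and fb: "\<exists>B. \<forall>z\<in>uhp. norm (f z) \<le> B" and fm: "f \<in> borel_measurable dA"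
      using f unfolding test_functions_def by blast
    obtain k0 where k0: "\<And>k. k0 \<le> k \<Longrightarrow> Kf \<subseteq> exhaust_box k" by (rule compact_subset_exhaust_box[OF Kf]) (rule that)
    define X where "X = (LINT z|dA. bergman_density \<alpha> z * \<sigma> z * (norm (f z))\<^sup>2)"
    have box: "(LINT z:exhaust_box k|dA. bergman_density \<alpha> z * \<sigma> z * (norm (F z))\<^sup>2) \<le> K * \<beta>\<^sup>2 * X"
      if k: "k0 \<le> k" for k
    proof -
      define E where "E = exhaust_box k"
      note E = exhaust_box_dA[of k, folded E_def]
      have Eu: "E \<subseteq> uhp" unfolding E_def by (rule exhaust_box_uhp)
      have fE: "f w = 0" if "w \<in> uhp" "w \<notin> E" for w using f0 k0[OF k] that by (auto simp: E_def)
      have "\<exists>m. max (2 * (real k + 1)) (4 * Ck * (real k + 1)) < 2 ^ m"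
        by (rule real_arch_pow) simp
      then obtain m :: nat where m': "max (2 * (real k + 1)) (4 * Ck * (real k + 1)) < 2 ^ m" by (rule exE)
      have m: "2 * (real k + 1) \<le> 2 ^ m" "4 * Ck * (real k + 1) \<le> 2 ^ m" using m' by auto
      note dy = adjacent_systems_dyadic[OF adj]
      have loc: "dyadic_commutator \<alpha> \<D> (dyadic_window \<D> m) E b f \<beta> c C1"
        if D: "dyadic_system \<D>" and sub: "\<D> \<subseteq> \<D>1 \<union> \<D>2" for \<D>
      proof (rule dyadic_commutator.intro)
        show "E \<subseteq> (\<Union>J\<in>dyadic_window \<D> m. tile J)" unfolding E_def by (rule window_covers[OF D m(1)])
        show "\<And>J L I. J \<in> dyadic_window \<D> m \<Longrightarrow> I \<in> dyadic_window \<D> m \<Longrightarrow> L \<in> \<D> \<Longrightarrow> J \<subseteq> L \<Longrightarrow> L \<subseteq> I \<Longrightarrow> L \<in> dyadic_window \<D> m"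
          by (rule dyadic_window_convex[OF D])
        show "dyadic_window \<D> m \<subseteq> \<D>" by (auto simp: dyadic_window_def)
        show "finite (dyadic_window \<D> m)" by (rule finite_dyadic_window[OF D])
        show "(LINT z:Q I|dA. (norm (b z - average b (Q I)))\<^sup>2) \<le> \<beta>\<^sup>2 * (len I)\<^sup>2" if "I \<in> \<D>" for I
          using osc that sub by blast
        show "c * l powr \<alpha> \<le> bergman_density \<alpha> w \<and> bergman_density \<alpha> w \<le> C1 * l powr \<alpha>"
          if "0 < l" "l / 4 \<le> Im w" "Im w \<le> l" for l w
          by (rule sc[OF that])
      qed (fact \<alpha> D E b fm fb \<beta> c)+
      interpret X1: dyadic_commutator \<alpha> \<D>1 "dyadic_window \<D>1 m" E b f \<beta> c C1
        by (rule loc[OF dy(1)]) simp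
      interpret X2: dyadic_commutator \<alpha> \<D>2 "dyadic_window \<D>2 m" E b f \<beta> c C1
        by (rule loc[OF dy(2)]) simp
      have pw: "norm (commutator \<alpha> b f z) \<le> CK * (X1.G z + X2.G z)" if z: "z \<in> E" for z
      proof -
        have zu: "z \<in> uhp" using z Eu by auto
        define \<phi> where "\<phi> w = (b z - b w) * f w * (of_real (bergman_density \<alpha> w) * bergman_kernel \<alpha> z w)" for w
        note cf = commutator_formula[OF \<alpha> b f zu, folded \<phi>_def]
        define T1 where "T1 w = (\<Sum>I\<in>{I\<in>dyadic_window \<D>1 m. z \<in> Q I}. indicator (E \<inter> Q I) w *\<^sub>R X1.h z w / len I powr (2 + \<alpha>))" for w
        define T2 where "T2 w = (\<Sum>I\<in>{I\<in>dyadic_window \<D>2 m. z \<in> Q I}. indicator (E \<inter> Q I) w *\<^sub>R X1.h z w / len I powr (2 + \<alpha>))" for w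
        have h0: "0 \<le> X1.h z w" for w unfolding X1.h_def using bergman_density_nonneg[OF \<alpha>] by simp
        have T0: "0 \<le> T1 w" "0 \<le> T2 w" for w
          unfolding T1_def T2_def using h0 by (auto intro!: sum_nonneg divide_nonneg_nonneg)
        have i1: "integrable dA T1" "(LINT w|dA. T1 w) = X1.H z" unfolding T1_def by (rule X1.H_integral[OF z])+
        have i2: "integrable dA T2" "(LINT w|dA. T2 w) = X2.H z" unfolding T2_def by (rule X2.H_integral[OF z])+
        have "norm (commutator \<alpha> b f z) \<le> (LINT w|dA. norm (\<phi> w))" unfolding cf(2) by (rule integral_norm_bound)
        also have "\<dots> \<le> (LINT w|dA. CK * (T1 w + T2 w))"
        proof (rule integral_mono)
          show "integrable dA (\<lambda>w. norm (\<phi> w))" using cf(1) by simp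
          show "integrable dA (\<lambda>w. CK * (T1 w + T2 w))" using i1 i2 by simp
          fix w assume "w \<in> space dA"
          then have wu: "w \<in> uhp" by simp
          show "norm (\<phi> w) \<le> CK * (T1 w + T2 w)"
          proof (cases "w \<in> E")
            case False
            then show ?thesis using fE[OF wu] T0 CK by (simp add: \<phi>_def)
          next
            case True
            obtain I where I: "I \<in> \<D>1 \<union> \<D>2" "z \<in> Q I" "w \<in> Q I" "2 * norm (z - cnj w) \<le> len I" "len I \<le> Ck * norm (z - cnj w)"
              "norm (bergman_kernel \<alpha> z w) \<le> CK * (1 / len I powr (2 + \<alpha>))"
              using ker[OF zu wu] unfolding CK_def by blast
            have "norm (\<phi> w) = X1.h z w * norm (bergman_kernel \<alpha> z w)"
              using bergman_density_nonneg[OF \<alpha>, of w] by (simp add: \<phi>_def X1.h_def norm_mult)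
            also have "\<dots> \<le> X1.h z w * (CK * (1 / len I powr (2 + \<alpha>)))"
              by (intro mult_left_mono I h0)
            also have "\<dots> = CK * (indicator (E \<inter> Q I) w *\<^sub>R X1.h z w / len I powr (2 + \<alpha>))"
              using True I by simp
            also have "\<dots> \<le> CK * (T1 w + T2 w)"
            proof (rule mult_left_mono)
              have trm: "0 \<le> indicator (E \<inter> Q L) w *\<^sub>R X1.h z w / len L powr (2 + \<alpha>)" for L using h0 by simp
              from I(1) show "indicator (E \<inter> Q I) w *\<^sub>R X1.h z w / len I powr (2 + \<alpha>) \<le> T1 w + T2 w"
              proof
                assume ID: "I \<in> \<D>1"
                have "I \<in> dyadic_window \<D>1 m"
                  by (rule window_contains_kernel_interval[OF z[unfolded E_def] True[unfolded E_def] ID I(2,4,5) Ck m])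
                then have "indicator (E \<inter> Q I) w *\<^sub>R X1.h z w / len I powr (2 + \<alpha>) \<le> T1 w"
                  unfolding T1_def using I(2) X1.fin trm by (intro member_le_sum) auto
                then show ?thesis using T0(2)[of w] by linarith
              next
                assume ID: "I \<in> \<D>2"
                have "I \<in> dyadic_window \<D>2 m"
                  by (rule window_contains_kernel_interval[OF z[unfolded E_def] True[unfolded E_def] ID I(2,4,5) Ck m])
                then have "indicator (E \<inter> Q I) w *\<^sub>R X1.h z w / len I powr (2 + \<alpha>) \<le> T2 w"
                  unfolding T2_def using I(2) X2.fin trm by (intro member_le_sum) auto
                then show ?thesis using T0(1)[of w] by linarith
              qed
            qed (use CK in simp)
            finally show ?thesis .
          qed
        qed
        also have "\<dots> = CK * (X1.H z + X2.H z)" using i1 i2 by simp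
        also have "\<dots> \<le> CK * (X1.G z + X2.G z)"
          using CK X1.H_le_G[OF z] X2.H_le_G[OF z] by (intro mult_left_mono add_mono) auto
        finally show ?thesis .
      qed
      have if2E: "set_integrable dA E (\<lambda>z. bergman_density \<alpha> z * \<sigma> z * (norm (f z))\<^sup>2)"
        unfolding set_integrable_def by (rule integrable_mult_indicator[OF E(1) if2])
      have wpos: "0 \<le> bergman_density \<alpha> z * \<sigma> z" if "z \<in> uhp" for z
        using bergman_density_nonneg[OF \<alpha>] \<sigma>[OF that] by simp
      have fX: "(LINT z:E|dA. bergman_density \<alpha> z * \<sigma> z * (norm (f z))\<^sup>2) \<le> X"
        unfolding X_def set_lebesgue_integral_def
        using if2E if2 wpos by (intro integral_mono) (auto simp: set_integrable_def indicator_def)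
      have G1: "set_integrable dA E (\<lambda>z. bergman_density \<alpha> z * \<sigma> z * (X1.G z)\<^sup>2)"
        "(LINT z:E|dA. bergman_density \<alpha> z * \<sigma> z * (X1.G z)\<^sup>2) \<le> K0 * \<beta>\<^sup>2 * (LINT z:E|dA. bergman_density \<alpha> z * \<sigma> z * (norm (f z))\<^sup>2)"
        unfolding K0_def q_def
        by (rule X1.weighted_G_bound[OF _ \<sigma> Cs regt[OF dy(1)] A int1[OF UnI1] int2[OF UnI1] A2[OF UnI1] if2E]; (assumption | simp))+
      have G2: "set_integrable dA E (\<lambda>z. bergman_density \<alpha> z * \<sigma> z * (X2.G z)\<^sup>2)"
        "(LINT z:E|dA. bergman_density \<alpha> z * \<sigma> z * (X2.G z)\<^sup>2) \<le> K0 * \<beta>\<^sup>2 * (LINT z:E|dA. bergman_density \<alpha> z * \<sigma> z * (norm (f z))\<^sup>2)"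
        unfolding K0_def q_def
        by (rule X2.weighted_G_bound[OF _ \<sigma> Cs regt[OF dy(2)] A int1[OF UnI2] int2[OF UnI2] A2[OF UnI2] if2E]; (assumption | simp))+
      have iF2E: "set_integrable dA E (\<lambda>z. bergman_density \<alpha> z * \<sigma> z * (norm (F z))\<^sup>2)"
        unfolding set_integrable_def by (rule integrable_mult_indicator[OF E(1) iF2])
      have "(LINT z:E|dA. bergman_density \<alpha> z * \<sigma> z * (norm (F z))\<^sup>2)
         \<le> (LINT z:E|dA. 2 * CK\<^sup>2 * (bergman_density \<alpha> z * \<sigma> z * (X1.G z)\<^sup>2 + bergman_density \<alpha> z * \<sigma> z * (X2.G z)\<^sup>2))"
      proof (rule set_integral_mono_AE[OF iF2E])
        show "set_integrable dA E (\<lambda>z. 2 * CK\<^sup>2 * (bergman_density \<alpha> z * \<sigma> z * (X1.G z)\<^sup>2 + bergman_density \<alpha> z * \<sigma> z * (X2.G z)\<^sup>2))"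
          by (intro set_integrable_mult_right set_integral_add G1 G2)
        show "AE z\<in>E in dA. bergman_density \<alpha> z * \<sigma> z * (norm (F z))\<^sup>2
           \<le> 2 * CK\<^sup>2 * (bergman_density \<alpha> z * \<sigma> z * (X1.G z)\<^sup>2 + bergman_density \<alpha> z * \<sigma> z * (X2.G z)\<^sup>2)"
          using F
        proof eventually_elim
          case (elim z)
          show ?case
          proof
            assume z: "z \<in> E"
            have "(norm (F z))\<^sup>2 \<le> (CK * (X1.G z + X2.G z))\<^sup>2"
              unfolding elim by (intro power_mono pw z) auto
            also have "\<dots> \<le> 2 * CK\<^sup>2 * ((X1.G z)\<^sup>2 + (X2.G z)\<^sup>2)"
            proof -
              have "(u + v)\<^sup>2 \<le> 2 * (u\<^sup>2 + v\<^sup>2)" for u v :: real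
              proof -
                have "0 \<le> (u - v)\<^sup>2" by simp
                then show ?thesis by (simp add: power2_eq_square algebra_simps)
              qed
              then have "CK\<^sup>2 * (X1.G z + X2.G z)\<^sup>2 \<le> CK\<^sup>2 * (2 * ((X1.G z)\<^sup>2 + (X2.G z)\<^sup>2))"
                by (intro mult_left_mono) auto
              then show ?thesis unfolding power_mult_distrib by (simp only: mult.assoc mult.left_commute[of 2])
            qed
            finally have "bergman_density \<alpha> z * \<sigma> z * (norm (F z))\<^sup>2
                \<le> bergman_density \<alpha> z * \<sigma> z * (2 * CK\<^sup>2 * ((X1.G z)\<^sup>2 + (X2.G z)\<^sup>2))"
              using wpos z Eu by (intro mult_left_mono) auto
            then show "bergman_density \<alpha> z * \<sigma> z * (norm (F z))\<^sup>2
               \<le> 2 * CK\<^sup>2 * (bergman_density \<alpha> z * \<sigma> z * (X1.G z)\<^sup>2 + bergman_density \<alpha> z * \<sigma> z * (X2.G z)\<^sup>2)"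
              by (simp add: algebra_simps)
          qed
        qed
      qed
      also have "\<dots> = 2 * CK\<^sup>2 * ((LINT z:E|dA. bergman_density \<alpha> z * \<sigma> z * (X1.G z)\<^sup>2) + (LINT z:E|dA. bergman_density \<alpha> z * \<sigma> z * (X2.G z)\<^sup>2))"
        unfolding set_integral_mult_right set_integral_add(2)[OF G1(1) G2(1)] ..
      also have "\<dots> \<le> 2 * CK\<^sup>2 * (K0 * \<beta>\<^sup>2 * X + K0 * \<beta>\<^sup>2 * X)"
      proof (intro mult_left_mono add_mono)
        have "K0 * \<beta>\<^sup>2 * (LINT z:E|dA. bergman_density \<alpha> z * \<sigma> z * (norm (f z))\<^sup>2) \<le> K0 * \<beta>\<^sup>2 * X"
          using K0 by (intro mult_left_mono fX) auto
        then show "(LINT z:E|dA. bergman_density \<alpha> z * \<sigma> z * (X1.G z)\<^sup>2) \<le> K0 * \<beta>\<^sup>2 * X"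
          "(LINT z:E|dA. bergman_density \<alpha> z * \<sigma> z * (X2.G z)\<^sup>2) \<le> K0 * \<beta>\<^sup>2 * X"
          using G1(2) G2(2) by linarith+
      qed simp
      also have "\<dots> = K * \<beta>\<^sup>2 * X" by (simp add: K_def)
      finally show ?thesis unfolding E_def .
    qed
    have "(\<lambda>k. LINT z:exhaust_box k|dA. bergman_density \<alpha> z * \<sigma> z * (norm (F z))\<^sup>2)
        \<longlonglongrightarrow> (LINT z:(\<Union>k. exhaust_box k)|dA. bergman_density \<alpha> z * \<sigma> z * (norm (F z))\<^sup>2)"
    proof (rule set_integral_cont_up[OF _ exhaust_box_mono])
      show "exhaust_box k \<in> sets dA" for k by (rule exhaust_box_dA)
      show "set_integrable dA (\<Union>k. exhaust_box k) (\<lambda>z. bergman_density \<alpha> z * \<sigma> z * (norm (F z))\<^sup>2)"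
        unfolding set_integrable_def using exhaust_box_dA by (intro integrable_mult_indicator iF2) auto
    qed
    then have "(LINT z:(\<Union>k. exhaust_box k)|dA. bergman_density \<alpha> z * \<sigma> z * (norm (F z))\<^sup>2) \<le> K * \<beta>\<^sup>2 * X"
      by (rule LIMSEQ_le_const2) (intro exI[of _ k0] allI impI box)
    moreover have "(LINT z:(\<Union>k. exhaust_box k)|dA. bergman_density \<alpha> z * \<sigma> z * (norm (F z))\<^sup>2)
        = (LINT z|dA. bergman_density \<alpha> z * \<sigma> z * (norm (F z))\<^sup>2)"
      unfolding exhaust_box_Union set_lebesgue_integral_def
      by (intro Bochner_Integration.integral_cong) auto
    ultimately show ?thesis by (simp add: X_def)
  qed
  show ?thesis by (rule that[OF K main])
qed


section \<open>From test functions to the whole space\<close>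

definition truncate :: "(complex \<Rightarrow> complex) \<Rightarrow> nat \<Rightarrow> complex \<Rightarrow> complex" where
  "truncate f n z = (if z \<in> exhaust_box n \<and> norm (f z) \<le> real n then f z else 0)"

lemma truncate_measurable:
  assumes [measurable]: "f \<in> borel_measurable dA"
  shows "truncate f n \<in> borel_measurable dA"
proof -
  have [measurable]: "exhaust_box n \<in> sets dA" by (rule exhaust_box_dA)
  show ?thesis unfolding truncate_def by measurable
qed

lemma truncate_test:
  assumes f: "f \<in> borel_measurable dA"
  shows "truncate f n \<in> test_functions"
proof -
  define r where "r = real n + 1"
  have r: "0 < r" by (simp add: r_def)
  define K where "K = cbox (Complex (- r) (1 / r)) (Complex r r)"
  have "0 < 1 / r" using r by simp
  then have K: "compact K" "K \<subseteq> uhp"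
    unfolding K_def by (auto simp: in_cbox_complex_iff uhp_def simp del: zero_less_divide_1_iff)
  have "exhaust_box n \<subseteq> K" by (auto simp: exhaust_box_def K_def rect_def r_def in_cbox_complex_iff)
  then have "\<forall>z\<in>uhp - K. truncate f n z = 0" by (auto simp: truncate_def)
  moreover have "\<forall>z\<in>uhp. norm (truncate f n z) \<le> real n" by (simp add: truncate_def)
  ultimately show ?thesis unfolding test_functions_def using truncate_measurable[OF f] K by blast
qed

lemma truncate_eventually:
  assumes "z \<in> uhp"
  shows "eventually (\<lambda>n. truncate f n z = f z) sequentially"
proof -
  obtain k where k: "z \<in> exhaust_box k" using assms exhaust_box_Union by blast
  obtain j :: nat where j: "norm (f z) \<le> real j" using real_arch_simple by blast
  have "truncate f n z = f z" if n: "max k j \<le> n" for n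
  proof -
    have "exhaust_box k \<subseteq> exhaust_box n" using n by (intro incseqD[OF exhaust_box_mono]) simp
    then have "z \<in> exhaust_box n" using k by (rule subsetD)
    moreover have "norm (f z) \<le> real n" using j n by linarith
    ultimately show ?thesis by (simp add: truncate_def)
  qed
  then show ?thesis unfolding eventually_sequentially by (intro exI[of _ "max k j"] allI impI)
qed

text \<open>
  Truncations of a square integrable function are test functions that converge to it by
  dominated convergence. The remainder is controlled by the boundedness of \<open>T\<close>, and
  the factor \<open>2\<close> comes from splitting the square of a sum.
\<close>

lemma operator_norm_le_of_test_bound:
  assumes \<alpha>: "-1 < \<alpha>" and wt: "weight \<sigma>" and bo: "bounded_operator (weighted \<alpha> \<sigma>) T" and M: "0 \<le> M"
    and test: "\<And>f. f \<in> test_functions \<Longrightarrow> f \<in> L2 (weighted \<alpha> \<sigma>) \<Longrightarrow>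
       (L2_norm (weighted \<alpha> \<sigma>) (T f))\<^sup>2 \<le> M * (L2_norm (weighted \<alpha> \<sigma>) f)\<^sup>2"
  shows "operator_norm (weighted \<alpha> \<sigma>) T \<le> sqrt (2 * M)"
proof -
  define w where "w z = bergman_density \<alpha> z * \<sigma> z" for z
  have [measurable]: "\<sigma> \<in> borel_measurable dA" using wt by (simp add: weight_def)
  have [measurable]: "w \<in> borel_measurable dA" unfolding w_def by measurable
  have w0: "AE z in dA. 0 < w z" unfolding w_def by (rule weight_density_pos[OF \<alpha> wt])
  define O' where "O' = operator_norm (weighted \<alpha> \<sigma>) T"
  note L2w = L2_weighted_iff[OF \<alpha> wt, folded w_def] and Nw = L2_norm_weighted[OF \<alpha> wt, folded w_def]
  have main: "L2_norm (weighted \<alpha> \<sigma>) (T f) \<le> sqrt (2 * M)"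
    if f: "f \<in> L2 (weighted \<alpha> \<sigma>)" and f1: "L2_norm (weighted \<alpha> \<sigma>) f \<le> 1" for f
  proof -
    have [measurable]: "f \<in> borel_measurable dA" and if2: "integrable dA (\<lambda>z. w z * (norm (f z))\<^sup>2)"
      using f by (simp_all add: L2w)
    define g where "g n = truncate f n" for n
    have gm [measurable]: "g n \<in> borel_measurable dA" for n unfolding g_def by (rule truncate_measurable) measurable
    define r where "r n z = f z - g n z" for n z
    have rm [measurable]: "r n \<in> borel_measurable dA" for n unfolding r_def by measurable
    have le: "norm (g n z) \<le> norm (f z)" "norm (r n z) \<le> norm (f z)" for n z
      by (simp_all add: g_def r_def truncate_def)
    have bd: "integrable dA (\<lambda>z. w z * (norm (u z))\<^sup>2)"
      if [measurable]: "u \<in> borel_measurable dA" and ule: "\<And>z. norm (u z) \<le> norm (f z)" for u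
    proof (rule Bochner_Integration.integrable_bound[OF if2])
      show "AE z in dA. norm (w z * (norm (u z))\<^sup>2) \<le> norm (w z * (norm (f z))\<^sup>2)"
        using ule by (intro AE_I2) (simp add: abs_mult mult_left_mono power_mono)
    qed measurable
    have gL: "g n \<in> L2 (weighted \<alpha> \<sigma>)" and rL: "r n \<in> L2 (weighted \<alpha> \<sigma>)" for n
      using bd[OF gm le(1)] bd[OF rm le(2)] by (simp_all add: L2w)
    have TL: "u \<in> L2 (weighted \<alpha> \<sigma>) \<Longrightarrow> T u \<in> L2 (weighted \<alpha> \<sigma>)" for u
      using bo unfolding bounded_operator_def by blast
    define X where "X n = (LINT z|dA. w z * (norm (r n z))\<^sup>2)" for n
    have "X \<longlonglongrightarrow> (LINT z|dA. 0 :: real)"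
      unfolding X_def
    proof (rule integral_dominated_convergence[where w = "\<lambda>z. w z * (norm (f z))\<^sup>2"])
      show "integrable dA (\<lambda>z. w z * (norm (f z))\<^sup>2)" by (rule if2)
      show "AE z in dA. (\<lambda>n. w z * (norm (r n z))\<^sup>2) \<longlonglongrightarrow> 0"
      proof (rule AE_I2)
        fix z assume "z \<in> space dA"
        then have "eventually (\<lambda>n. g n z = f z) sequentially" unfolding g_def by (intro truncate_eventually) simp
        then have "eventually (\<lambda>n. w z * (norm (r n z))\<^sup>2 = 0) sequentially"
          by eventually_elim (simp add: r_def)
        then show "(\<lambda>n. w z * (norm (r n z))\<^sup>2) \<longlonglongrightarrow> 0" by (rule tendsto_eventually)
      qed
      show "AE z in dA. norm (w z * (norm (r n z))\<^sup>2) \<le> w z * (norm (f z))\<^sup>2" for n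
        using w0
      proof eventually_elim
        case (elim z)
        have "w z * (norm (r n z))\<^sup>2 \<le> w z * (norm (f z))\<^sup>2"
          using elim le(2)[of n z] by (intro mult_left_mono power_mono) auto
        then show ?case using elim by simp
      qed
    qed measurable
    then have X0: "X \<longlonglongrightarrow> 0" by simp
    have bound: "(L2_norm (weighted \<alpha> \<sigma>) (T f))\<^sup>2 \<le> 2 * M + 2 * O'\<^sup>2 * X n" for n
    proof -
      have Tf: "T f \<in> L2 (weighted \<alpha> \<sigma>)" and Tg: "T (g n) \<in> L2 (weighted \<alpha> \<sigma>)" and Tr: "T (r n) \<in> L2 (weighted \<alpha> \<sigma>)"
        using TL f gL rL by blast+
      note Tf' = Tf[unfolded L2w] and Tg' = Tg[unfolded L2w] and Tr' = Tr[unfolded L2w]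
      have split: "(\<lambda>z. 1 * g n z + 1 * r n z) = f" by (rule ext) (simp add: r_def)
      have "AE z in weighted \<alpha> \<sigma>. T (\<lambda>z. 1 * g n z + 1 * r n z) z = 1 * T (g n) z + 1 * T (r n) z"
        using bo gL rL unfolding bounded_operator_def by blast
      then have sp: "AE z in dA. T f z = T (g n) z + T (r n) z"
        unfolding split AE_weighted[OF \<alpha> wt] by simp
      have "(L2_norm (weighted \<alpha> \<sigma>) (T f))\<^sup>2 = (LINT z|dA. w z * (norm (T f z))\<^sup>2)"
        using Tf' by (intro Nw) simp
      also have "\<dots> \<le> (LINT z|dA. 2 * (w z * (norm (T (g n) z))\<^sup>2) + 2 * (w z * (norm (T (r n) z))\<^sup>2))"
      proof (rule integral_mono_AE)
        show "integrable dA (\<lambda>z. w z * (norm (T f z))\<^sup>2)" using Tf' by simp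
        show "integrable dA (\<lambda>z. 2 * (w z * (norm (T (g n) z))\<^sup>2) + 2 * (w z * (norm (T (r n) z))\<^sup>2))"
          using Tg' Tr' by (intro Bochner_Integration.integrable_add integrable_mult_right) simp_all
        show "AE z in dA. w z * (norm (T f z))\<^sup>2 \<le> 2 * (w z * (norm (T (g n) z))\<^sup>2) + 2 * (w z * (norm (T (r n) z))\<^sup>2)"
          using w0 sp
        proof eventually_elim
          case (elim z)
          have "(norm (T f z))\<^sup>2 \<le> (norm (T (g n) z) + norm (T (r n) z))\<^sup>2"
            unfolding elim(2) by (intro power_mono norm_triangle_ineq) auto
          also have "\<dots> \<le> 2 * (norm (T (g n) z))\<^sup>2 + 2 * (norm (T (r n) z))\<^sup>2"
          proof -
            have "0 \<le> (norm (T (g n) z) - norm (T (r n) z))\<^sup>2" by simp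
            then show ?thesis by (simp add: power2_eq_square algebra_simps)
          qed
          finally have "w z * (norm (T f z))\<^sup>2 \<le> w z * (2 * (norm (T (g n) z))\<^sup>2 + 2 * (norm (T (r n) z))\<^sup>2)"
            using elim(1) by (intro mult_left_mono) auto
          then show ?case by (simp add: algebra_simps)
        qed
      qed
      also have "\<dots> = 2 * (L2_norm (weighted \<alpha> \<sigma>) (T (g n)))\<^sup>2 + 2 * (L2_norm (weighted \<alpha> \<sigma>) (T (r n)))\<^sup>2"
        using Tg' Tr' by (subst Bochner_Integration.integral_add) (simp_all add: Nw)
      also have "\<dots> \<le> 2 * (M * (L2_norm (weighted \<alpha> \<sigma>) (g n))\<^sup>2) + 2 * (O' * L2_norm (weighted \<alpha> \<sigma>) (r n))\<^sup>2"
      proof (intro add_mono mult_left_mono)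
        show "(L2_norm (weighted \<alpha> \<sigma>) (T (g n)))\<^sup>2 \<le> M * (L2_norm (weighted \<alpha> \<sigma>) (g n))\<^sup>2"
          by (rule test[OF _ gL]) (unfold g_def, rule truncate_test, measurable)
        show "(L2_norm (weighted \<alpha> \<sigma>) (T (r n)))\<^sup>2 \<le> (O' * L2_norm (weighted \<alpha> \<sigma>) (r n))\<^sup>2"
          unfolding O'_def by (intro power_mono operator_norm_bounds(2)[OF bo rL] L2_norm_nonneg)
      qed simp_all
      also have "(L2_norm (weighted \<alpha> \<sigma>) (g n))\<^sup>2 \<le> (L2_norm (weighted \<alpha> \<sigma>) f)\<^sup>2"
      proof -
        have "(LINT z|dA. w z * (norm (g n z))\<^sup>2) \<le> (LINT z|dA. w z * (norm (f z))\<^sup>2)"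
        proof (rule integral_mono_AE[OF bd[OF gm le(1)] if2])
          show "AE z in dA. w z * (norm (g n z))\<^sup>2 \<le> w z * (norm (f z))\<^sup>2"
            using w0 by eventually_elim (use le(1) in \<open>auto intro!: mult_left_mono power_mono\<close>)
        qed
        then show ?thesis by (simp add: Nw)
      qed
      also have "(L2_norm (weighted \<alpha> \<sigma>) f)\<^sup>2 \<le> 1" using f1 L2_norm_nonneg by (intro power_le_one)
      finally show ?thesis using M by (simp add: power_mult_distrib Nw X_def mult_left_mono)
    qed
    have "(\<lambda>n. 2 * M + 2 * O'\<^sup>2 * X n) \<longlonglongrightarrow> 2 * M + 2 * O'\<^sup>2 * 0"
      by (intro tendsto_intros X0)
    then have "(L2_norm (weighted \<alpha> \<sigma>) (T f))\<^sup>2 \<le> 2 * M + 2 * O'\<^sup>2 * 0"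
      by (rule LIMSEQ_le_const) (intro exI[of _ 0] allI impI bound)
    then have "(L2_norm (weighted \<alpha> \<sigma>) (T f))\<^sup>2 \<le> 2 * M" by simp
    then show ?thesis by (rule real_le_rsqrt)
  qed
  have zero: "(\<lambda>_. 0) \<in> {f \<in> L2 (weighted \<alpha> \<sigma>). L2_norm (weighted \<alpha> \<sigma>) f \<le> 1}"
    by (simp add: L2_def L2_norm_def)
  show ?thesis
    unfolding operator_norm_def
  proof (rule cSUP_least)
    show "{f \<in> L2 (weighted \<alpha> \<sigma>). L2_norm (weighted \<alpha> \<sigma>) f \<le> 1} \<noteq> {}" using zero by blast
    fix f assume "f \<in> {f \<in> L2 (weighted \<alpha> \<sigma>). L2_norm (weighted \<alpha> \<sigma>) f \<le> 1}"
    then show "L2_norm (weighted \<alpha> \<sigma>) (T f) \<le> sqrt (2 * M)" by (intro main) simp_all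
  qed
qed

lemma commutator_norm_le_BMO2_norm:
  fixes \<sigma> :: "complex \<Rightarrow> real"
  assumes \<alpha>: "-1 < \<alpha>" and adj: "adjacent_dyadic_systems \<D>1 \<D>2" and B2: "\<sigma> \<in> B2 \<alpha> (\<D>1 \<union> \<D>2)"
    and \<sigma>: "\<And>z. z \<in> uhp \<Longrightarrow> 0 < \<sigma> z" and reg: "hyperbolically_regular \<sigma>"
  obtains C where "0 < C"
    "\<And>b T. b \<in> BMO2 (\<D>1 \<union> \<D>2) \<Longrightarrow> commutator_extension \<alpha> \<sigma> b T \<Longrightarrow>
       operator_norm (weighted \<alpha> \<sigma>) T \<le> C * BMO2_norm (\<D>1 \<union> \<D>2) b"
proof -
  have wt: "weight \<sigma>" by (rule B2_weight[OF B2])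
  note dy = adjacent_systems_dyadic[OF adj]
  obtain K where K: "0 < K" and tb:
    "\<And>b \<beta> f F. b \<in> L2 dA \<Longrightarrow> 0 \<le> \<beta> \<Longrightarrow>
       \<forall>I\<in>\<D>1 \<union> \<D>2. (LINT z:Q I|dA. (norm (b z - average b (Q I)))\<^sup>2) \<le> \<beta>\<^sup>2 * (len I)\<^sup>2 \<Longrightarrow>
       f \<in> test_functions \<Longrightarrow> integrable dA (\<lambda>z. bergman_density \<alpha> z * \<sigma> z * (norm (f z))\<^sup>2) \<Longrightarrow>
       AE z in dA. F z = commutator \<alpha> b f z \<Longrightarrow>
       integrable dA (\<lambda>z. bergman_density \<alpha> z * \<sigma> z * (norm (F z))\<^sup>2) \<Longrightarrow>
       (LINT z|dA. bergman_density \<alpha> z * \<sigma> z * (norm (F z))\<^sup>2)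
         \<le> K * \<beta>\<^sup>2 * (LINT z|dA. bergman_density \<alpha> z * \<sigma> z * (norm (f z))\<^sup>2)"
    by (rule commutator_test_bound[OF \<alpha> adj B2 \<sigma> reg], assumption) (rule that; assumption)
  define C where "C = sqrt (2 * K)"
  have C: "0 < C" using K by (simp add: C_def)
  have main: "operator_norm (weighted \<alpha> \<sigma>) T \<le> C * BMO2_norm (\<D>1 \<union> \<D>2) b"
    if bB: "b \<in> BMO2 (\<D>1 \<union> \<D>2)" and T: "commutator_extension \<alpha> \<sigma> b T" for b T
  proof -
    have b: "b \<in> L2 dA" and bdd: "bdd_above ((\<lambda>I. mean_osc2 b (Q I)) ` (\<D>1 \<union> \<D>2))"
      using bB by (simp_all add: BMO2_def)
    have bo: "bounded_operator (weighted \<alpha> \<sigma>) T" using T by (simp add: commutator_extension_def)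
    define \<beta> where "\<beta> = BMO2_norm (\<D>1 \<union> \<D>2) b"
    have le: "mean_osc2 b (Q I) \<le> \<beta>" if "I \<in> \<D>1 \<union> \<D>2" for I
      unfolding \<beta>_def BMO2_norm_def by (rule cSUP_upper[OF that bdd])
    have osc0: "0 \<le> (LINT z:Q I|dA. (norm (b z - average b (Q I)))\<^sup>2)" for I
      unfolding set_lebesgue_integral_def by simp
    have m0: "0 \<le> mean_osc2 b (Q I)" for I
      unfolding mean_osc2_def using osc0[of I] by simp
    obtain I0 where I0: "I0 \<in> \<D>1" by (rule dyadic_cover[OF dy(1), of 0 0])
    have \<beta>: "0 \<le> \<beta>" using le[of I0] m0[of I0] I0 by simp
    have osc: "\<forall>I\<in>\<D>1 \<union> \<D>2. (LINT z:Q I|dA. (norm (b z - average b (Q I)))\<^sup>2) \<le> \<beta>\<^sup>2 * (len I)\<^sup>2"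
    proof
      fix I assume I: "I \<in> \<D>1 \<union> \<D>2"
      obtain a l where Il: "I = {a..<a + l}" "len I = l" "0 < l" by (rule adjacent_interval[OF adj I])
      have mQ: "measure dA (Q I) = (len I)\<^sup>2"
        unfolding Il(2) unfolding Il(1) using Q_dA(3)[OF Il(3)] Q_halfopen_lmeasurable(2)[OF Il(3)] by simp
      have "(mean_osc2 b (Q I))\<^sup>2 \<le> \<beta>\<^sup>2" by (intro power_mono le[OF I] m0)
      then have "(LINT z:Q I|dA. (norm (b z - average b (Q I)))\<^sup>2) / (len I)\<^sup>2 \<le> \<beta>\<^sup>2"
        using osc0[of I] by (simp add: mean_osc2_def mQ)
      then show "(LINT z:Q I|dA. (norm (b z - average b (Q I)))\<^sup>2) \<le> \<beta>\<^sup>2 * (len I)\<^sup>2"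
        using Il(2,3) by (simp add: divide_le_eq)
    qed
    have "operator_norm (weighted \<alpha> \<sigma>) T \<le> sqrt (2 * (K * \<beta>\<^sup>2))"
    proof (rule operator_norm_le_of_test_bound[OF \<alpha> wt bo])
      show "0 \<le> K * \<beta>\<^sup>2" using K by simp
      fix f assume f: "f \<in> test_functions" and fL: "f \<in> L2 (weighted \<alpha> \<sigma>)"
      have TfL: "T f \<in> L2 (weighted \<alpha> \<sigma>)" using bo fL unfolding bounded_operator_def by blast
      have ae: "AE z in dA. T f z = commutator \<alpha> b f z"
        using T f unfolding commutator_extension_def by blast
      note fL' = fL[unfolded L2_weighted_iff[OF \<alpha> wt]] and TfL' = TfL[unfolded L2_weighted_iff[OF \<alpha> wt]]
      show "(L2_norm (weighted \<alpha> \<sigma>) (T f))\<^sup>2 \<le> K * \<beta>\<^sup>2 * (L2_norm (weighted \<alpha> \<sigma>) f)\<^sup>2"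
        unfolding L2_norm_weighted[OF \<alpha> wt conjunct1[OF fL']] L2_norm_weighted[OF \<alpha> wt conjunct1[OF TfL']]
        by (rule tb[OF b \<beta> osc f conjunct2[OF fL'] ae conjunct2[OF TfL']])
    qed
    also have "sqrt (2 * (K * \<beta>\<^sup>2)) = C * \<beta>"
      using \<beta> by (simp add: C_def real_sqrt_mult)
    finally show ?thesis by (simp add: \<beta>_def)
  qed
  show ?thesis by (rule that[OF C main])
qed

theorem theorem4p11:
  fixes \<alpha> :: real and \<D>1 \<D>2 \<D> :: "real set set" and \<sigma> :: "complex \<Rightarrow> real"
  assumes "\<alpha> > -1"
    and "adjacent_dyadic_systems \<D>1 \<D>2"
    and "\<D> = \<D>1 \<union> \<D>2"
    and "\<sigma> \<in> B2 \<alpha> \<D>"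
  shows "(\<forall>b\<in>L2 dA. (\<exists>T. commutator_extension \<alpha> \<sigma> b T) \<longrightarrow>
            bdd_above ((\<lambda>I. mean_osc b (Q I)) ` \<D>)) \<and>
         (\<forall>h \<Omega> (\<eta>::real).
            open \<Omega> \<and> simply_connected \<Omega> \<and> \<Omega> \<noteq> UNIV \<and> conformal_map h uhp \<Omega> \<and>
            (\<forall>z\<in>uhp. \<sigma> z = norm (deriv h z) powr \<eta>) \<longrightarrow>
            (\<exists>c>0. \<exists>C>0. \<forall>b\<in>L2 dA. \<forall>T. commutator_extension \<alpha> \<sigma> b T \<longrightarrow>
               b \<in> BMO2 \<D> \<and>
               c * BMO2_norm \<D> b \<le> operator_norm (weighted \<alpha> \<sigma>) T \<and>
               operator_norm (weighted \<alpha> \<sigma>) T \<le> C * BMO2_norm \<D> b))"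
proof (intro conjI ballI allI impI)
  have \<alpha>: "-1 < \<alpha>" by fact
  note adj = assms(2)
  have B2: "\<sigma> \<in> B2 \<alpha> (\<D>1 \<union> \<D>2)" using assms(3,4) by simp
  {
    fix b assume b: "b \<in> L2 dA" and "\<exists>T. commutator_extension \<alpha> \<sigma> b T"
    then obtain T where T: "commutator_extension \<alpha> \<sigma> b T" by blast
    obtain C where C: "\<And>b T I. b \<in> L2 dA \<Longrightarrow> commutator_extension \<alpha> \<sigma> b T \<Longrightarrow> I \<in> \<D>1 \<union> \<D>2 \<Longrightarrow>
       mean_osc b (Q I) \<le> C * operator_norm (weighted \<alpha> \<sigma>) T"
      by (rule mean_osc_le_commutator_norm[OF \<alpha> adj B2]) (rule that; assumption)
    show "bdd_above ((\<lambda>I. mean_osc b (Q I)) ` \<D>)"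
      unfolding assms(3) by (rule bdd_aboveI2) (rule C[OF b T])
  next
    fix h \<Omega> and \<eta> :: real
    assume H: "open \<Omega> \<and> simply_connected \<Omega> \<and> \<Omega> \<noteq> UNIV \<and> conformal_map h uhp \<Omega> \<and>
            (\<forall>z\<in>uhp. \<sigma> z = norm (deriv h z) powr \<eta>)"
    have \<Omega>: "open \<Omega>" "\<Omega> \<noteq> UNIV" and conf: "conformal_map h uhp \<Omega>"
      and \<sigma>h: "\<And>z. z \<in> uhp \<Longrightarrow> \<sigma> z = norm (deriv h z) powr \<eta>"
      using H by auto
    note cw = conformal_weight_regular[OF conf \<Omega> \<sigma>h]
    have reg: "hyperbolically_regular \<sigma>" by (rule cw(1))
    have pos: "\<And>z. z \<in> uhp \<Longrightarrow> 0 < \<sigma> z" by (rule cw(2))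
    obtain C1 where C1: "0 < C1" and lower: "\<And>b T I. b \<in> L2 dA \<Longrightarrow> commutator_extension \<alpha> \<sigma> b T \<Longrightarrow> I \<in> \<D>1 \<union> \<D>2 \<Longrightarrow>
       mean_osc2 b (Q I) \<le> C1 * operator_norm (weighted \<alpha> \<sigma>) T"
      by (rule mean_osc2_le_commutator_norm[OF \<alpha> adj B2 pos reg], assumption) (rule that; assumption)
    obtain C2 where C2: "0 < C2" and upper: "\<And>b T. b \<in> BMO2 (\<D>1 \<union> \<D>2) \<Longrightarrow> commutator_extension \<alpha> \<sigma> b T \<Longrightarrow>
       operator_norm (weighted \<alpha> \<sigma>) T \<le> C2 * BMO2_norm (\<D>1 \<union> \<D>2) b"
      by (rule commutator_norm_le_BMO2_norm[OF \<alpha> adj B2 pos reg], assumption) (rule that; assumption)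
    show "\<exists>c>0. \<exists>C>0. \<forall>b\<in>L2 dA. \<forall>T. commutator_extension \<alpha> \<sigma> b T \<longrightarrow>
               b \<in> BMO2 \<D> \<and>
               c * BMO2_norm \<D> b \<le> operator_norm (weighted \<alpha> \<sigma>) T \<and>
               operator_norm (weighted \<alpha> \<sigma>) T \<le> C * BMO2_norm \<D> b"
      unfolding assms(3)
    proof (rule exI[of _ "1 / C1"], rule conjI[rotated], rule exI[of _ C2], intro conjI ballI allI impI)
      show "0 < 1 / C1" "0 < C2" using C1 C2 by simp_all
      fix b T assume b: "b \<in> L2 dA" and T: "commutator_extension \<alpha> \<sigma> b T"
      show BMO: "b \<in> BMO2 (\<D>1 \<union> \<D>2)"
        unfolding BMO2_def using b by (auto intro!: bdd_aboveI2 lower[OF b T])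
      show "operator_norm (weighted \<alpha> \<sigma>) T \<le> C2 * BMO2_norm (\<D>1 \<union> \<D>2) b"
        by (rule upper[OF BMO T])
      obtain I0 where I0: "I0 \<in> \<D>1" by (rule dyadic_cover[OF adjacent_systems_dyadic(1)[OF adj], of 0 0])
      have "BMO2_norm (\<D>1 \<union> \<D>2) b \<le> C1 * operator_norm (weighted \<alpha> \<sigma>) T"
        unfolding BMO2_norm_def using I0 by (intro cSUP_least lower[OF b T]) auto
      then show "1 / C1 * BMO2_norm (\<D>1 \<union> \<D>2) b \<le> operator_norm (weighted \<alpha> \<sigma>) T"
        using C1 by (simp add: field_simps)
    qed
  }
qed


end
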